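(* Let $K$ be a compact set contained in one of the sets $I_{k,l}$, $1\le k\le4$, $l=1,2,3$. Then $(c,\gamma,x)\mapsto U^{c,\gamma}_\theta(x)$ is in $C^\infty(K\times(-1,1))$. Moreover, for every $m$ there is a constant $C(m,K)$ such that for $-1<x<1$: (i) If $k=1$ and $l\in\{1,2,3\}$, or $(k,l)=(2,2)$ or $(3,3)$: $|\partial_c^\alpha\partial_\gamma^jU^{c,\gamma}_\theta(x)|\le C(m,K)$ for all $0\le|\alpha|+j\le m$, where $j=0$ if $l=2,3$; $\alpha_1=0$ if $k=2$; $\alpha_2=0$ if $k=3$. (ii) If $(k,l)\in\{(2,1),(2,3),(4,3)\}$: $\left(\ln\frac{1+x}{3}\right)^2|\partial_c^\alpha\partial_\gamma^jU^{c,\gamma}_\theta(x)|\le C(m,K)$ for all $1\le|\alpha|+j\le m$ with $\alpha_1=0$, where $j=0$ if $l=3$, and $\alpha_2=0$ if $k=4$. (iii) If $(k,l)\in\{(3,1),(3,2),(4,2)\}$: $\left(\ln\frac{1-x}{3}\right)^2|\partial_c^\alpha\partial_\gamma^jU^{c,\gamma}_\theta(x)|\le C(m,K)$ for all $1\le|\alpha|+j\le m$ with $\alpha_2=0$, where $j=0$ if $l=2$, and $\alpha_1=0$ if $k=4$. (iv) If $(k,l)=(4,1)$: $\left(\ln\frac{1+x}{3}\right)^2\left(\ln\frac{1-x}{3}\right)^2|\partial_c^\alpha\partial_\gamma^jU^{c,\gamma}_\theta(x)|\le C(m,K)$ for all $1\le|\alpha|+j\le m$ with $\alpha_1=\alp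ha_2=0$.
   Context: For $c=(c_1,c_2,c_3)\in\mathbb{R}^3$ let $P_c(x):=c_1(1-x)+c_2(1+x)+c_3(1-x^2)$ and consider $(1-x^2)U'+2xU+\frac12U^2=P_c(x)$ on $(-1,1)$. For $c_1,c_2\ge-1$ let $\bar c_3=\bar c_3(c_1,c_2):=-\frac12(\sqrt{1+c_1}+\sqrt{1+c_2})(\sqrt{1+c_1}+\sqrt{1+c_2}+2)$, $J:=\{c: c_1\ge-1,c_2\ge-1,c_3\ge\bar c_3\}$. For $c\in J$ there are solutions $U^\pm_\theta(c)$ on $(-1,1)$ with $U^-_\theta(c)\le U\le U^+_\theta(c)$ for every solution $U$; $\gamma^\pm(c):=U^\pm_\theta(c)(0)$; $I:=\{(c,\gamma):c\in J,\gamma^-(c)\le\gamma\le\gamma^+(c)\}$; for $(c,\gamma)\in I$, $U^{c,\gamma}_\theta$ is the unique solution on $(-1,1)$ with $U^{c,\gamma}_\theta(0)=\gamma$. Let $J_1:=\{c\in J:c_1>-1,c_2>-1,c_3>\bar c_3\}$, $J_2:=\{c\in J:c_1=-1,c_2>-1,c_3>\bar c_3\}$, $J_3:=\{c\in J:c_1>-1,c_2=-1,c_3>\bar c_3\}$, $J_4:=\{c\in J:c_1=-1,c_2=-1,c_3>\bar c_3\}$, and for $1\le k\le4$: $I_{k,1}:=\{(c,\gamma)\in I:c\in J_k,\gamma^-(c)<\gamma<\gamma^+(c)\}$, $I_{k,2}:=\{(c,\gamma)\in I: c\in J_k,\gamma=\gamma^+(c)\}$, $I_{k,3}:=\{(c,\gamma)\in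 I:c\in J_k,\gamma=\gamma^-(c)\}$. Smoothness on $I_{k,l}$ means smoothness restricted to $I_{k,l}$ (parametrized by the free components of $c$, and $\gamma$ when $l=1$). For $l=2,3$ the left-hand sides are interpreted with $j=0$ as derivatives in $c$ of $U^{c,\gamma^+(c)}_\theta$ (resp. $U^{c,\gamma^-(c)}_\theta$), e.g. for $(k,l)=(1,2)$ the estimate means $|\partial_c^\alpha(U^{c,\gamma^+(c)}_\theta)|\le C(m,K)$; $\alpha=(\alpha_1,\alpha_2,\alpha_3)$ is a multi-index with $\partial_c^\alpha=\partial_{c_1}^{\alpha_1}\partial_{c_2}^{\alpha_2}\partial_{c_3}^{\alpha_3}$. *)

theory Defs
  imports "HOL-Analysis.Analysis"
begin

definition Pc :: "real^3 \<Rightarrow> real \<Rightarrow> real" where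
  "Pc c x = c$1 * (1 - x) + c$2 * (1 + x) + c$3 * (1 - x\<^sup>2)"

definition is_sol :: "real^3 \<Rightarrow> (real \<Rightarrow> real) \<Rightarrow> bool" where
  "is_sol c U \<longleftrightarrow> (\<forall>x. -1 < x \<and> x < 1 \<longrightarrow>
      (\<exists>d. (U has_real_derivative d) (at x) \<and>
           (1 - x\<^sup>2) * d + 2 * x * U x + (1/2) * (U x)\<^sup>2 = Pc c x))"

definition cbar3 :: "real \<Rightarrow> real \<Rightarrow> real" where
  "cbar3 c1 c2 = -(1/2) * (sqrt (1 + c1) + sqrt (1 + c2)) * (sqrt (1 + c1) + sqrt (1 + c2) + 2)"

definition Jset :: "(real^3) set" where
  "Jset = {c. c$1 \<ge> -1 \<and> c$2 \<ge> -1 \<and> c$3 \<ge> cbar3 (c$1) (c$2)}"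

definition gamma_plus :: "real^3 \<Rightarrow> real" where
  "gamma_plus c = (THE g. \<exists>U. is_sol c U \<and>
      (\<forall>V. is_sol c V \<longrightarrow> (\<forall>x. -1 < x \<and> x < 1 \<longrightarrow> V x \<le> U x)) \<and> U 0 = g)"

definition gamma_minus :: "real^3 \<Rightarrow> real" where
  "gamma_minus c = (THE g. \<exists>U. is_sol c U \<and>
      (\<forall>V. is_sol c V \<longrightarrow> (\<forall>x. -1 < x \<and> x < 1 \<longrightarrow> U x \<le> V x)) \<and> U 0 = g)"

definition Iset :: "((real^3) \<times> real) set" where
  "Iset = {(c, g). c \<in> Jset \<and> gamma_minus c \<le> g \<and> g \<le> gamma_plus c}"

definition Usol :: "real^3 \<Rightarrow> real \<Rightarrow> real \<Rightarrow> real" where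
  "Usol c g x = (THE y. \<exists>U. is_sol c U \<and> U 0 = g \<and> U x = y)"

definition Jk :: "nat \<Rightarrow> (real^3) set" where
  "Jk k = {c \<in> Jset. c$3 > cbar3 (c$1) (c$2) \<and>
     (if k = 1 then c$1 > -1 \<and> c$2 > -1
      else if k = 2 then c$1 = -1 \<and> c$2 > -1
      else if k = 3 then c$1 > -1 \<and> c$2 = -1
      else c$1 = -1 \<and> c$2 = -1)}"

definition Ikl :: "nat \<Rightarrow> nat \<Rightarrow> ((real^3) \<times> real) set" where
  "Ikl k l = {(c, g) \<in> Iset. c \<in> Jk k \<and>
     (if l = 1 then gamma_minus c < g \<and> g < gamma_plus c
      else if l = 2 then g = gamma_plus c
      else g = gamma_minus c)}"

(* Free-coordinate parametrization of I_{k,l} x (-1,1):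
   a point p :: real^5 stands for (c1,c2,c3,gamma,x) = (p$1,p$2,p$3,p$4,p$5);
   the components that are fixed on I_{k,l} (c1 = -1 if k in {2,4}, c2 = -1 if k in {3,4},
   gamma = gamma^+(c) if l = 2, gamma = gamma^-(c) if l = 3) are substituted, so the
   corresponding coordinates of p are dummies on which nothing depends. *)
definition eff_c :: "nat \<Rightarrow> real^5 \<Rightarrow> real^3" where
  "eff_c k p = vector [if k = 2 \<or> k = 4 then -1 else p$1,
                       if k = 3 \<or> k = 4 then -1 else p$2,
                       p$3]"

definition eff_g :: "nat \<Rightarrow> nat \<Rightarrow> real^5 \<Rightarrow> real" where
  "eff_g k l p = (if l = 1 then p$4
                  else if l = 2 then gamma_plus (eff_c k p)
                  else gamma_minus (eff_c k p))"

definition Fmap :: "nat \<Rightarrow> nat \<Rightarrow> real^5 \<Rightarrow> real" where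
  "Fmap k l p = Usol (eff_c k p) (eff_g k l p) (p$5)"

definition cyl :: "nat \<Rightarrow> nat \<Rightarrow> ((real^3) \<times> real) set \<Rightarrow> (real^5) set" where
  "cyl k l K = {p. (eff_c k p, eff_g k l p) \<in> K \<and> -1 < p$5 \<and> p$5 < 1}"

definition partial :: "'n::finite \<Rightarrow> (real^'n \<Rightarrow> real) \<Rightarrow> real^'n \<Rightarrow> real" where
  "partial i f p = deriv (\<lambda>t. f (p + t *\<^sub>R axis i 1)) 0"

fun iter_partial :: "'n::finite list \<Rightarrow> (real^'n \<Rightarrow> real) \<Rightarrow> real^'n \<Rightarrow> real" where
  "iter_partial [] f = f"
| "iter_partial (i # is) f = partial i (iter_partial is f)"

definition C_infinity_on :: "(real^'n::finite) set \<Rightarrow> (real^'n \<Rightarrow> real) \<Rightarrow> bool" where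
  "C_infinity_on N f \<longleftrightarrow> (\<forall>is. continuous_on N (iter_partial is f) \<and>
      (\<forall>i. \<forall>p\<in>N. (\<lambda>t. iter_partial is f (p + t *\<^sub>R axis i 1)) differentiable (at 0)))"

definition Dcg :: "nat \<Rightarrow> nat \<Rightarrow> nat \<Rightarrow> nat \<Rightarrow> (real^5 \<Rightarrow> real) \<Rightarrow> real^5 \<Rightarrow> real" where
  "Dcg a1 a2 a3 j f = iter_partial (replicate a1 (1::5) @ replicate a2 2 @ replicate a3 3 @ replicate j 4) f"

end

theory Submission
  imports Defs "HOL-Complex_Analysis.Cauchy_Integral_Formula" "HOL-Real_Asymp.Real_Asymp"
begin

text \<open>Put \<open>s = sqrt (1 + c\<^sub>1)\<close>, \<open>t = sqrt (1 + c\<^sub>2)\<close>, \<open>k = (c\<^sub>3 - cbar3 c\<^sub>1 c\<^sub>2) / 2\<close>, \<open>z = (1 + x) / 2\<close>.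
  The substitution \<open>U = 2 (1 - x\<^sup>2) w' / w\<close>, \<open>w = (1 + x)\<^bsup>(1+s)/2\<^esup> (1 - x)\<^bsup>(1+t)/2\<^esup> f(z)\<close> turns the Riccati
  equation into the hypergeometric equation
  \<open>z (1 - z) f'' + (1 + s - (2 + s + t) z) f' - k f = 0\<close>, which is solved by
  \<open>u(z) = F(a, b; 1 + s; z)\<close> and \<open>g(z) = F(a, b; 1 + t; 1 - z)\<close>, where \<open>a + b = 1 + s + t\<close> and \<open>a b = k\<close>.
  For \<open>k > 0\<close> all coefficients are positive, and the global solutions \<open>U\<close> correspond exactly to
  \<open>f = A u + B g\<close> with \<open>A, B \<ge> 0\<close> not both zero; \<open>B = 0\<close> gives the upper and \<open>A = 0\<close> the lower extremal solution.

  This formula makes sense for complex \<open>c\<close>, \<open>\<gamma>\<close> and \<open>x\<close>, which gives smoothness. By Cauchy's estimates with \<open>x\<close> fixed,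
  the derivatives in \<open>(c, \<gamma>)\<close> are bounded as soon as \<open>U\<close> itself, up to a function of \<open>x\<close> alone, is
  bounded on a complex neighbourhood of the parameters. The behaviour at \<open>z = 0\<close> follows from the Wronskian:
  \<open>(g / u)'\<close> is a constant times \<open>z\<^bsup>-1-s\<^esup> (1 - z)\<^bsup>-1-t\<^esup> / u\<^sup>2\<close>, so \<open>g\<close> behaves like \<open>z\<^bsup>-s\<^esup>\<close>
  for \<open>s > 0\<close>, and like \<open>- ln z\<close> for \<open>s = 0\<close>, in which case \<open>U = 2 + 4 / ln z + O(1 / ln\<^sup>2 z)\<close> if \<open>B \<noteq> 0\<close>.
  The endpoint \<open>z = 1\<close> is symmetric.\<close>

section \<open>Separately holomorphic functions\<close>

text \<open>The difficulty is uniformity in x. Cauchy's estimates need one complex parameter radius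
  for all x in (-1,1), and compactness of K alone does not give it: f must stay nonzero for complex
  parameters arbitrarily close to the singular endpoints. On [d, 1/2] positivity of f at real
  parameters and compactness suffice; on (0, d] the Wronskian supplies lower bounds for |A + B g/u|.
  There the strata separate. If B = 0, f is analytic at z = 0. If B > 0 and s > 0, z f'/f is merely
  bounded, which is all that is claimed. If s = 0 and B > 0, f is logarithmic, but the terms 2 + 4 /
  ln(2z/3) do not involve the parameters, so a derivative in (c, gamma) sees only the O(1/ln^2)
  remainder: hence the squared logarithms, with 2z/3 = (1+x)/3. These regimes do not survive moving
  s or B away from 0, so such parameters are frozen on each stratum and only the free coordinates
  are complexified.\<close>

definition cpartial :: "'n::finite \<Rightarrow> (complex^'n \<Rightarrow> complex) \<Rightarrow> complex^'n \<Rightarrow> complex" where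
  "cpartial i G q = deriv (\<lambda>t. G (q + axis i t)) 0"

fun iter_cpartial :: "'n::finite list \<Rightarrow> (complex^'n \<Rightarrow> complex) \<Rightarrow> complex^'n \<Rightarrow> complex" where
  "iter_cpartial [] G = G"
| "iter_cpartial (i # is) G = cpartial i (iter_cpartial is G)"

text \<open>Joint continuity with holomorphy along each coordinate; by Osgood's lemma this is
  holomorphy in several variables. Continuity is part of the definition because it provides the
  local bounds that make difference quotients converge uniformly.\<close>

definition sep_holo :: "(complex^'n::finite) set \<Rightarrow> (complex^'n \<Rightarrow> complex) \<Rightarrow> bool" where
  "sep_holo S G \<longleftrightarrow> open S \<and> continuous_on S G \<and>
     (\<forall>q\<in>S. \<forall>i. (\<lambda>t. G (q + axis i t)) field_differentiable at 0)"

definition cvec :: "real^'n::finite \<Rightarrow> complex^'n" where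
  "cvec p = (\<chi> i. complex_of_real (p $ i))"

lemma axis_add: "axis i (s + t) = (axis i s + axis i t :: 'a::monoid_add^'n::finite)"
  by (simp add: vec_eq_iff axis_def)

lemma norm_axis_complex [simp]: "norm (axis i (t::complex) :: complex^'n::finite) = norm t"
proof -
  have "norm (axis i t $ j) = (if j = i then norm t else 0)" for j
    by (simp add: axis_def)
  then show ?thesis
    by (simp add: norm_vec_def L2_set_def if_distrib[of "\<lambda>x. x\<^sup>2"] cong: if_cong)
qed

text \<open>Differentiability is given only at t = 0, but at every base point of S, so a slice is
  differentiated at w by moving the base point to \<open>q + axis i w\<close>.\<close>

lemma sep_holo_slice:
  assumes "sep_holo S G" "\<And>t. t \<in> T \<Longrightarrow> q + axis i t \<in> S"
  shows "(\<lambda>t. G (q + axis i t)) holomorphic_on T"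
proof -
  have "(\<lambda>t. G (q + axis i t)) field_differentiable (at w)" if "w \<in> T" for w
  proof -
    have "(\<lambda>t. G ((q + axis i w) + axis i t)) field_differentiable at 0"
      using assms that unfolding sep_holo_def by blast
    then obtain D where "((\<lambda>t. G ((q + axis i w) + axis i t)) has_field_derivative D) (at (w - w))"
      by (auto simp: field_differentiable_def)
    then have "((\<lambda>t. G ((q + axis i w) + axis i (t - w))) has_field_derivative D) (at w)"
      using DERIV_shift[of "\<lambda>t. G ((q + axis i w) + axis i t)" D w "-w"] by simp
    moreover have "axis i w + axis i (t - w) = (axis i t :: complex^'a)" for t
      by (simp flip: axis_add)
    ultimately show ?thesis
      by (auto simp: field_differentiable_def add.assoc)
  qed
  then show ?thesis
    by (simp add: field_differentiable_at_within holomorphic_on_def)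
qed

lemma sep_holo_subset: "sep_holo S G \<Longrightarrow> open T \<Longrightarrow> T \<subseteq> S \<Longrightarrow> sep_holo T G"
  unfolding sep_holo_def using continuous_on_subset by blast

lemma sep_holo_const [intro]: "open S \<Longrightarrow> sep_holo S (\<lambda>q. c)"
  by (simp add: sep_holo_def)

lemma sep_holo_add [intro]: "sep_holo S F \<Longrightarrow> sep_holo S G \<Longrightarrow> sep_holo S (\<lambda>q. F q + G q)"
  and sep_holo_diff [intro]: "sep_holo S F \<Longrightarrow> sep_holo S G \<Longrightarrow> sep_holo S (\<lambda>q. F q - G q)"
  and sep_holo_mult [intro]: "sep_holo S F \<Longrightarrow> sep_holo S G \<Longrightarrow> sep_holo S (\<lambda>q. F q * G q)"
  unfolding sep_holo_def
  by (auto intro!: continuous_intros field_differentiable_add field_differentiable_diff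
      field_differentiable_mult)

lemma axis_zero [simp]: "axis i 0 = (0 :: complex^'n::finite)"
  by (simp add: vec_eq_iff axis_def)

lemma sep_holo_divide [intro]:
  assumes "sep_holo S F" "sep_holo S G" "\<And>q. q \<in> S \<Longrightarrow> G q \<noteq> 0"
  shows "sep_holo S (\<lambda>q. F q / G q)"
  using assms unfolding sep_holo_def
  by (auto intro!: continuous_intros field_differentiable_divide)

lemma sep_holo_power [intro]: "sep_holo S F \<Longrightarrow> sep_holo S (\<lambda>q. F q ^ n)"
proof (induction n)
  case 0
  then show ?case by (auto simp: sep_holo_def)
next
  case (Suc n)
  then show ?case using sep_holo_mult[of S F "\<lambda>q. F q ^ n"] by simp
qed

lemma sep_holo_sum [intro]:
  "open S \<Longrightarrow> (\<And>n. n \<in> A \<Longrightarrow> sep_holo S (F n)) \<Longrightarrow> sep_holo S (\<lambda>q. \<Sum>n\<in>A. F n q)"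
  by (induction A rule: infinite_finite_induct) auto

lemma sep_holo_nth [intro]: "open S \<Longrightarrow> sep_holo S (\<lambda>q. q $ i)"
proof -
  have "(\<lambda>t. t * axis j 1 $ i) field_differentiable at (0::complex)" for j
    by (intro field_differentiable_mult field_differentiable_ident field_differentiable_const)
  moreover have "(\<lambda>t. axis j t $ i) = (\<lambda>t::complex. t * axis j 1 $ i)" for j
    by (rule ext) (simp add: axis_def)
  ultimately show "open S \<Longrightarrow> ?thesis"
    unfolding sep_holo_def
    by (auto intro!: continuous_intros field_differentiable_add)
qed

lemma sep_holo_compose1:
  assumes "sep_holo S G" "h holomorphic_on T" "open T" "\<And>q. q \<in> S \<Longrightarrow> G q \<in> T"
  shows "sep_holo S (\<lambda>q. h (G q))"
  unfolding sep_holo_def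
proof (intro conjI ballI allI)
  show "open S" using assms by (simp add: sep_holo_def)
  show "continuous_on S (\<lambda>q. h (G q))"
    by (rule continuous_on_compose2[OF holomorphic_on_imp_continuous_on[OF assms(2)]])
      (use assms in \<open>auto simp: sep_holo_def\<close>)
  fix q i assume q: "q \<in> S"
  have "h field_differentiable at (G (q + axis i 0))"
    using assms q by (simp add: holomorphic_on_imp_differentiable_at)
  moreover have "(\<lambda>t. G (q + axis i t)) field_differentiable at 0"
    using assms q by (simp add: sep_holo_def)
  ultimately have "(h \<circ> (\<lambda>t. G (q + axis i t))) field_differentiable at 0"
    by (intro field_differentiable_compose)
  then show "(\<lambda>t. h (G (q + axis i t))) field_differentiable at 0"
    by (simp add: o_def)
qed

text \<open>Weierstrass' theorem on each coordinate slice. The sequence may change with the point: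
  difference quotients have a step tied to the distance from the boundary of S, and
  parameter-dependent series converge only locally uniformly.\<close>

lemma sep_holo_uniform_limit:
  fixes g :: "complex^'n::finite \<Rightarrow> complex"
  assumes "open S"
    and lim: "\<And>p. p \<in> S \<Longrightarrow> \<exists>r>0. \<exists>F. ball p r \<subseteq> S \<and> (\<forall>n. sep_holo (ball p r) (F n)) \<and>
               uniform_limit (ball p r) F g sequentially"
  shows "sep_holo S g"
  unfolding sep_holo_def
proof (intro conjI ballI allI)
  show "open S" by fact
  show "continuous_on S g"
    unfolding continuous_on_eq_continuous_at[OF \<open>open S\<close>]
  proof
    fix p assume "p \<in> S"
    then obtain r F where r: "r > 0" "\<forall>n. sep_holo (ball p r) (F n)" "uniform_limit (ball p r) F g sequentially"
      using lim by blast
    have "continuous_on (ball p r) g"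
      by (rule uniform_limit_theorem[OF _ r(3)]) (use r(2) in \<open>auto simp: sep_holo_def\<close>)
    then show "isCont g p"
      using r(1) by (simp add: continuous_on_eq_continuous_at)
  qed
  fix p and i :: 'n assume "p \<in> S"
  then obtain r F where r: "r > 0" "\<forall>n. sep_holo (ball p r) (F n)" "uniform_limit (ball p r) F g sequentially"
    using lim by blast
  have inb: "p + axis i t \<in> ball p r \<longleftrightarrow> t \<in> ball 0 r" for t :: complex
    by (simp add: dist_norm)
  have "(\<lambda>t. g (p + axis i t)) holomorphic_on ball 0 r"
  proof (rule holomorphic_uniform_sequence)
    show "(\<lambda>t. F n (p + axis i t)) holomorphic_on ball 0 r" for n
      using r inb by (intro sep_holo_slice[of "ball p r"]) auto
    fix x :: complex assume "x \<in> ball 0 r"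
    then obtain d where d: "d > 0" "cball x d \<subseteq> ball 0 r"
      using open_contains_cball[of "ball 0 r"] by (meson open_ball)
    have "uniform_limit (cball x d) (\<lambda>n t. F n (p + axis i t)) (\<lambda>t. g (p + axis i t)) sequentially"
      using d inb by (intro uniform_limit_compose'[OF r(3)]) blast
    then show "\<exists>d. 0 < d \<and> cball x d \<subseteq> ball 0 r \<and>
        uniform_limit (cball x d) (\<lambda>n t. F n (p + axis i t)) (\<lambda>t. g (p + axis i t)) sequentially"
      using d by blast
  qed auto
  then show "(\<lambda>t. g (p + axis i t)) field_differentiable at 0"
    using r(1) holomorphic_on_imp_differentiable_at by fastforce
qed

text \<open>First-order Taylor remainder. Cauchy's inequality on circles of radius r bounds the
  second derivative throughout \<open>cball 0 r\<close>, which is why g lives on a disc of radius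
  3r.\<close>

lemma difference_quotient_bound:
  fixes g :: "complex \<Rightarrow> complex"
  assumes hol: "g holomorphic_on ball 0 (3*r)" and bd: "\<And>t. norm t < 3*r \<Longrightarrow> norm (g t) \<le> M"
    and r: "r > 0" and h: "norm h \<le> r" "h \<noteq> 0"
  shows "norm ((g h - g 0) / h - deriv g 0) \<le> 2 * M / r^2 * norm h"
proof -
  have "cmod ((\<lambda>i. (deriv^^i) g) 0 h - (\<Sum>i\<le>1. (\<lambda>i. (deriv^^i) g) i 0 * (h - 0)^i / fact i))
          \<le> (2 * M / r^2) * cmod (h - 0) ^ Suc 1 / fact 1"
  proof (rule complex_Taylor)
    show "convex (cball (0::complex) r)" by simp
    show "0 \<in> cball 0 r" "h \<in> cball 0 r" using r h by auto
    fix x :: complex assume x: "x \<in> cball 0 r"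
    then have sub: "cball x r \<subseteq> ball 0 (3*r)"
    proof -
      have "norm y < 3 * r" if "dist x y \<le> r" for y
        using x that r norm_triangle_ineq2[of y x] by (simp add: dist_norm norm_minus_commute)
      then show ?thesis by auto
    qed
    show "((deriv^^i) g has_field_derivative (deriv^^Suc i) g x) (at x within cball 0 r)" if "i \<le> 1" for i
      using x r hol by (intro has_field_derivative_higher_deriv[THEN has_field_derivative_at_within]) auto
    have "norm ((deriv^^2) g x) \<le> fact 2 * M / r^2"
    proof (rule Cauchy_inequality)
      show "g holomorphic_on ball x r"
        using sub hol by (meson ball_subset_cball holomorphic_on_subset)
      show "continuous_on (cball x r) g"
        using sub hol by (meson holomorphic_on_imp_continuous_on holomorphic_on_subset)
      show "norm (g w) \<le> M" if "norm (x - w) = r" for w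
        using sub that by (intro bd) (auto simp: subset_iff dist_norm)
    qed fact
    then show "norm ((deriv^^Suc 1) g x) \<le> 2 * M / r^2"
      by (simp add: numeral_2_eq_2)
  qed
  then have "norm (g h - g 0 - deriv g 0 * h) \<le> (2 * M / r^2 * norm h) * norm h"
    by (simp add: power2_eq_square diff_diff_eq)
  moreover have "(g h - g 0) / h - deriv g 0 = (g h - g 0 - deriv g 0 * h) / h"
    using h by (simp add: field_simps)
  ultimately show ?thesis
    using h by (simp add: norm_divide divide_le_eq)
qed

lemma sep_holo_translate:
  assumes "sep_holo S G" "open T" "\<And>q. q \<in> T \<Longrightarrow> q + a \<in> S"
  shows "sep_holo T (\<lambda>q. G (q + a))"
  unfolding sep_holo_def
proof (intro conjI ballI allI)
  show "continuous_on T (\<lambda>q. G (q + a))"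
    by (rule continuous_on_compose2[of S G])
      (use assms in \<open>auto simp: sep_holo_def intro!: continuous_intros\<close>)
  fix q i assume "q \<in> T"
  then show "(\<lambda>t. G (q + axis i t + a)) field_differentiable at 0"
    using assms(1) assms(3)[of q] by (auto simp: sep_holo_def add.assoc add.commute[of _ a])
qed fact

text \<open>The difference quotients of \<open>G\<close> converge to the partial derivative locally uniformly.\<close>
lemma sep_holo_cpartial:
  fixes G :: "complex^'n::finite \<Rightarrow> complex"
  assumes "sep_holo S G"
  shows "sep_holo S (cpartial i G)"
proof -
  have "open S" using assms by (simp add: sep_holo_def)
  define e where "e r n = complex_of_real (r / Suc n)" for r n
  define F where "F r n q = (G (q + axis i (e r n)) - G q) / e r n" for r n q
  show ?thesis
  proof (rule sep_holo_uniform_limit[OF \<open>open S\<close>])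
    fix p assume "p \<in> S"
    then obtain R where R: "R > 0" "cball p R \<subseteq> S"
      using \<open>open S\<close> open_contains_cball by blast
    \<comment> \<open>A point within r of p, moved by at most 3r along an axis, stays in
      \<open>cball p R\<close>; this is the room that \<open>difference_quotient_bound\<close>
      requires.\<close>
    define r where "r = R / 4"
    have r: "r > 0" using R by (simp add: r_def)
    have "compact (cball p R)" by simp
    moreover have "continuous_on (cball p R) G"
      using assms R by (auto simp: sep_holo_def intro: continuous_on_subset)
    ultimately have "bounded (G ` cball p R)"
      by (intro compact_imp_bounded compact_continuous_image)
    then obtain M where M: "\<And>q. q \<in> cball p R \<Longrightarrow> norm (G q) \<le> M"
      unfolding bounded_iff by blast
    have inR: "q + axis i t \<in> cball p R" if "q \<in> ball p r" "norm t \<le> 3 * r" for q and t :: complex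
    proof -
      have "dist p (q + axis i t) \<le> norm (p - q) + norm (axis i t :: complex^'n)"
        unfolding dist_norm using norm_triangle_ineq4[of "p - q" "axis i t"] by (simp add: diff_diff_eq)
      then show ?thesis using that r by (simp add: r_def dist_norm)
    qed
    have er: "norm (e r n) \<le> r" "e r n \<noteq> 0" for n
      using r by (auto simp: e_def norm_divide divide_le_eq field_simps simp del: of_nat_Suc)
    have pb: "ball p r \<subseteq> S"
    proof
      fix q assume "q \<in> ball p r"
      then show "q \<in> S" using R(2) r unfolding r_def by (auto simp: subset_iff)
    qed
    have "sep_holo (ball p r) (F r n)" for n
    proof -
      have "q + axis i (e r n) \<in> S" if "q \<in> ball p r" for q
        using inR[OF that, of "e r n"] er(1)[of n] r R(2) by auto
      then show ?thesis
        unfolding F_def using er(2)[of n] pb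
        by (intro sep_holo_divide sep_holo_diff sep_holo_translate[OF assms]
            sep_holo_subset[OF assms] sep_holo_const) auto
    qed
    moreover have "uniform_limit (ball p r) (F r) (cpartial i G) sequentially"
    proof (rule uniform_limitI)
      fix \<epsilon> :: real assume "\<epsilon> > 0"
      have bd: "norm (F r n q - cpartial i G q) \<le> 2 * M / r^2 * (r / Suc n)" if q: "q \<in> ball p r" for q n
      proof -
        have "norm (((\<lambda>t. G (q + axis i t)) (e r n) - (\<lambda>t. G (q + axis i t)) 0) / e r n
               - deriv (\<lambda>t. G (q + axis i t)) 0) \<le> 2 * M / r^2 * norm (e r n)"
        proof (rule difference_quotient_bound)
          show "(\<lambda>t. G (q + axis i t)) holomorphic_on ball 0 (3 * r)"
            by (rule sep_holo_slice[OF assms]) (use inR[OF q] R in auto)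
          show "norm (G (q + axis i t)) \<le> M" if "norm t < 3 * r" for t
            using inR[OF q, of t] that by (intro M) auto
        qed (use er r in auto)
        then show ?thesis
          using r unfolding F_def cpartial_def by (simp add: e_def norm_divide del: of_nat_Suc)
      qed
      have "(\<lambda>n. 2 * M / r^2 * (r / Suc n)) \<longlonglongrightarrow> 0"
        using tendsto_mult[OF tendsto_const LIMSEQ_Suc[OF lim_const_over_n[of r]], of "2 * M / r^2"]
        by simp
      then have "\<forall>\<^sub>F n in sequentially. 2 * M / r^2 * (r / Suc n) < \<epsilon>"
        using \<open>\<epsilon> > 0\<close> by (rule order_tendstoD)
      then show "\<forall>\<^sub>F n in sequentially. \<forall>q\<in>ball p r. dist (F r n q) (cpartial i G q) < \<epsilon>"
      proof (rule eventually_mono, intro ballI)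
        fix n q assume "2 * M / r^2 * (r / Suc n) < \<epsilon>" "q \<in> ball p r"
        then show "dist (F r n q) (cpartial i G q) < \<epsilon>"
          using bd[of q n] unfolding dist_norm by linarith
      qed
    qed
    ultimately show "\<exists>r>0. \<exists>F. ball p r \<subseteq> S \<and> (\<forall>n. sep_holo (ball p r) (F n)) \<and>
        uniform_limit (ball p r) F (cpartial i G) sequentially"
      using r pb by blast

  qed
qed

section \<open>Real restrictions and Cauchy estimates\<close>

lemma sep_holo_iter_cpartial: "sep_holo S G \<Longrightarrow> sep_holo S (iter_cpartial is G)"
  by (induction "is") (auto intro: sep_holo_cpartial)

lemma cvec_axis: "cvec (p + t *\<^sub>R axis i 1) = cvec p + axis i (complex_of_real t)"
  by (simp add: cvec_def vec_eq_iff axis_def)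

lemma continuous_on_cvec [continuous_intros]:
  "continuous_on T f \<Longrightarrow> continuous_on T (\<lambda>x. cvec (f x) :: complex^'n::finite)"
  unfolding cvec_def by (intro continuous_intros)

text \<open>A real slice of F is the real part of a complex slice of G restricted to the real axis;
  agreement on the open set N is enough because derivatives are local.\<close>

lemma Re_slice_has_derivative:
  assumes "sep_holo S G" "cvec p \<in> S" "open N" "p \<in> N" "\<And>q. q \<in> N \<Longrightarrow> F q = Re (G (cvec q))"
  shows "((\<lambda>t. F (p + t *\<^sub>R axis i 1)) has_real_derivative Re (cpartial i G (cvec p))) (at 0)"
proof -
  have "(\<lambda>t. G (cvec p + axis i t)) field_differentiable at 0"
    using assms by (simp add: sep_holo_def)
  then have "((\<lambda>t. G (cvec p + axis i t)) has_field_derivative cpartial i G (cvec p)) (at (complex_of_real 0))"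
    unfolding cpartial_def using DERIV_deriv_iff_field_differentiable by auto
  then have "((\<lambda>t. G (cvec p + axis i t)) \<circ> complex_of_real has_vector_derivative
      1 * cpartial i G (cvec p)) (at 0)"
    by (intro field_vector_diff_chain_at) (auto intro!: derivative_eq_intros)
  then have "((\<lambda>t. Re (G (cvec p + axis i (complex_of_real t)))) has_real_derivative Re (cpartial i G (cvec p))) (at 0)"
    unfolding has_real_derivative_iff_has_vector_derivative o_def
    by (auto dest: bounded_linear.has_vector_derivative[OF bounded_linear_Re])
  moreover have "open ((\<lambda>t. p + t *\<^sub>R axis i 1) -` N)"
    by (intro open_vimage \<open>open N\<close> continuous_intros)
  moreover have "0 \<in> (\<lambda>t. p + t *\<^sub>R axis i 1) -` N"
    using assms by simp
  ultimately show ?thesis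
    using assms(5) unfolding cvec_axis[symmetric]
    by (elim has_field_derivative_transform_within_open) auto
qed

text \<open>Openness of N lets the agreement pass from a function to its partial derivatives, so the
  induction runs with the same N and S.\<close>

lemma iter_partial_eq_Re:
  assumes "sep_holo S G" "open N" "\<And>q. q \<in> N \<Longrightarrow> cvec q \<in> S"
    and "\<And>q. q \<in> N \<Longrightarrow> F q = Re (G (cvec q))" and "p \<in> N"
  shows "iter_partial is F p = Re (iter_cpartial is G (cvec p))"
  using \<open>p \<in> N\<close>
proof (induction "is" arbitrary: p)
  case Nil
  then show ?case using assms by simp
next
  case (Cons i "is")
  then show ?case
    using Re_slice_has_derivative[OF sep_holo_iter_cpartial[OF assms(1)] assms(3) \<open>open N\<close>, where p = p and F = "iter_partial is F" and i = i]
    by (auto simp: partial_def intro!: DERIV_imp_deriv)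
qed

lemma C_infinity_on_Re:
  fixes F :: "real^'n::finite \<Rightarrow> real"
  assumes G: "sep_holo S G" and N: "open N" "\<And>q. q \<in> N \<Longrightarrow> cvec q \<in> S"
    and F: "\<And>q. q \<in> N \<Longrightarrow> F q = Re (G (cvec q))"
  shows "C_infinity_on N F"
  unfolding C_infinity_on_def
proof (intro allI conjI ballI)
  fix "is" :: "'n list"
  have hol: "sep_holo S (iter_cpartial is G)"
    by (rule sep_holo_iter_cpartial[OF G])
  have "continuous_on N (\<lambda>p. iter_cpartial is G (cvec p))"
    by (rule continuous_on_compose2[of S "iter_cpartial is G"])
      (use hol N in \<open>auto simp: sep_holo_def intro!: continuous_intros\<close>)
  then have "continuous_on N (\<lambda>p. Re (iter_cpartial is G (cvec p)))"
    by (intro continuous_intros)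
  then show "continuous_on N (iter_partial is F)"
    by (rule continuous_on_eq) (use iter_partial_eq_Re[OF G N F] in auto)
  fix i p assume "p \<in> N"
  then show "(\<lambda>t. iter_partial is F (p + t *\<^sub>R axis i 1)) differentiable at 0"
    using Re_slice_has_derivative[OF hol N(2) N(1), where p = p and F = "iter_partial is F" and i = i]
      iter_partial_eq_Re[OF G N F]
    by (metis real_differentiable_def)
qed

text \<open>Coordinates outside I are frozen. Later I consists of the four parameter coordinates, so
  that the radius stays fixed while x approaches an endpoint.\<close>

definition polydisc :: "'n::finite set \<Rightarrow> complex^'n \<Rightarrow> real \<Rightarrow> (complex^'n) set" where
  "polydisc I p R = {q. (\<forall>i\<in>I. norm (q $ i - p $ i) < R) \<and> (\<forall>i. i \<notin> I \<longrightarrow> q $ i = p $ i)}"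

lemma polydisc_half:
  assumes "q \<in> polydisc I p (R/2)"
  shows "polydisc I q (R/2) \<subseteq> polydisc I p R"
proof
  fix w assume w: "w \<in> polydisc I q (R/2)"
  have "norm (w $ i - p $ i) < R" if "i \<in> I" for i
    using norm_triangle_ineq[of "w $ i - q $ i" "q $ i - p $ i"] assms w that
    by (force simp: polydisc_def)
  then show "w \<in> polydisc I p R"
    using assms w by (auto simp: polydisc_def)
qed

lemma polydisc_axis: "R > 0 \<Longrightarrow> i \<in> I \<Longrightarrow> norm t < R \<Longrightarrow> p + axis i t \<in> polydisc I p R"
  by (auto simp: polydisc_def axis_def)

text \<open>C is chosen before S, G, p and B, hence depends only on the list and on R. Each further
  derivative costs half of the radius: the inner derivatives are bounded on the disc of radius R/2,
  and Cauchy's inequality is applied on the circle of radius R/4.\<close>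

lemma Cauchy_estimate_polydisc:
  fixes "is" :: "'n::finite list"
  assumes "set is \<subseteq> I" "R > 0"
  shows "\<exists>C>0. \<forall>S G p B. sep_holo S G \<longrightarrow> polydisc I p R \<subseteq> S \<longrightarrow>
     (\<forall>q\<in>polydisc I p R. norm (G q) \<le> B) \<longrightarrow> norm (iter_cpartial is G p) \<le> C * B"
  using assms
proof (induction "is" arbitrary: R)
  case Nil
  have "p \<in> polydisc I p R" for p :: "complex^'n"
    using Nil by (simp add: polydisc_def)
  then show ?case
    by (intro exI[of _ 1]) auto
next
  case (Cons i "is")
  then have "\<exists>C>0. \<forall>S G p B. sep_holo S G \<longrightarrow> polydisc I p (R/2) \<subseteq> S \<longrightarrow>
     (\<forall>q\<in>polydisc I p (R/2). norm (G q) \<le> B) \<longrightarrow> norm (iter_cpartial is G p) \<le> C * B"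
    using Cons.IH[of "R/2"] by simp
  then obtain C where C: "C > 0" "\<And>S G p B. sep_holo S G \<Longrightarrow> polydisc I p (R/2) \<subseteq> S \<Longrightarrow>
     (\<forall>q\<in>polydisc I p (R/2). norm (G q) \<le> B) \<Longrightarrow> norm (iter_cpartial is G p) \<le> C * B"
    by blast
  have "norm (iter_cpartial (i # is) G p) \<le> (C / (R/4)) * B"
    if S: "sep_holo S G" "polydisc I p R \<subseteq> S" and B: "\<forall>q\<in>polydisc I p R. norm (G q) \<le> B" for S G p B
  proof -
    let ?g = "\<lambda>t. iter_cpartial is G (p + axis i t)"
    have mem: "p + axis i t \<in> polydisc I p (R/2)" if "norm t < R/2" for t
      using that Cons.prems by (intro polydisc_axis) auto
    have sub: "polydisc I q (R/2) \<subseteq> polydisc I p R" if "q \<in> polydisc I p (R/2)" for q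
      by (rule polydisc_half[OF that])
    have self: "q \<in> polydisc I q (R/2)" for q
      using Cons.prems by (simp add: polydisc_def)
    have hol: "?g holomorphic_on ball 0 (R/2)"
      by (rule sep_holo_slice[OF sep_holo_iter_cpartial[OF S(1)]]) (use mem sub self S(2) in force)
    have bd: "norm (?g t) \<le> C * B" if "norm t < R/2" for t
      by (rule C(2)[OF S(1)]) (use mem[OF that] sub S(2) B in blast)+
    have "norm ((deriv ^^ 1) ?g 0) \<le> fact 1 * (C * B) / (R/4) ^ 1"
    proof (rule Cauchy_inequality)
      have "cball 0 (R/4) \<subseteq> ball (0::complex) (R/2)" using Cons.prems by auto
      then show "?g holomorphic_on ball 0 (R/4)" "continuous_on (cball 0 (R/4)) ?g"
        using hol by (meson ball_subset_cball holomorphic_on_subset holomorphic_on_imp_continuous_on order_trans)+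
    qed (use Cons.prems bd in auto)
    then show ?thesis
      by (simp add: cpartial_def mult_ac)
  qed
  then show ?case
    using C(1) Cons.prems by (intro exI[of _ "C / (R/4)"]) auto
qed

lemma cpartial_diff_const: "cpartial i (\<lambda>q. G q - c) = cpartial i G"
proof (rule ext)
  fix q
  have "((\<lambda>t. G (q + axis i t) - c) has_field_derivative D) (at 0) \<longleftrightarrow>
        ((\<lambda>t. G (q + axis i t)) has_field_derivative D) (at 0)" for D
    using DERIV_add[of "\<lambda>t. G (q + axis i t) - c" D 0 UNIV "\<lambda>_. c" 0]
      DERIV_diff[of "\<lambda>t. G (q + axis i t)" D 0 UNIV "\<lambda>_. c" 0] by auto
  then show "cpartial i (\<lambda>q. G q - c) q = cpartial i G q"
    by (simp add: cpartial_def deriv_def)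
qed

lemma iter_cpartial_diff_const:
  "is \<noteq> [] \<Longrightarrow> iter_cpartial is (\<lambda>q. G q - c) = iter_cpartial is G"
proof (induction "is")
  case (Cons i "is")
  then show ?case by (cases "is = []") (auto simp: cpartial_diff_const)
qed simp

lemma Cauchy_estimate_uniform:
  fixes I :: "'n::finite set"
  assumes "R > 0"
  shows "\<exists>C>0. \<forall>is S G p B T. set is \<subseteq> I \<longrightarrow> length is \<le> m \<longrightarrow> sep_holo S G \<longrightarrow> polydisc I p R \<subseteq> S \<longrightarrow>
     (\<forall>q\<in>polydisc I p R. norm (G q - T) \<le> B) \<longrightarrow> (is = [] \<longrightarrow> T = 0) \<longrightarrow>
     norm (iter_cpartial is G p) \<le> C * B"
proof -
  define L where "L = {is. set is \<subseteq> I \<and> length is \<le> m}"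
  have fin: "finite L"
    unfolding L_def by (rule finite_lists_length_le) simp
  have "\<forall>is\<in>L. \<exists>C>0. \<forall>S G p B. sep_holo S G \<longrightarrow> polydisc I p R \<subseteq> S \<longrightarrow>
     (\<forall>q\<in>polydisc I p R. norm (G q) \<le> B) \<longrightarrow> norm (iter_cpartial is G p) \<le> C * B"
    using Cauchy_estimate_polydisc[OF _ assms] by (auto simp: L_def)
  then obtain C where C: "\<And>is. is \<in> L \<Longrightarrow> C is > 0" "\<And>is S G p B. is \<in> L \<Longrightarrow> sep_holo S G \<Longrightarrow>
     polydisc I p R \<subseteq> S \<Longrightarrow> (\<forall>q\<in>polydisc I p R. norm (G q) \<le> B) \<Longrightarrow> norm (iter_cpartial is G p) \<le> C is * B"
    by metis
  have "norm (iter_cpartial is G p) \<le> sum C L * B"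
    if "is \<in> L" "sep_holo S G" "polydisc I p R \<subseteq> S" "\<forall>q\<in>polydisc I p R. norm (G q - T) \<le> B" "is = [] \<longrightarrow> T = 0"
    for "is" S G p B T
  proof -
    have "open S" using that by (simp add: sep_holo_def)
    then have "norm (iter_cpartial is (\<lambda>q. G q - T) p) \<le> C is * B"
      using that by (intro C(2)[of "is" S]) auto
    then have 1: "norm (iter_cpartial is G p) \<le> C is * B"
      using that(5) iter_cpartial_diff_const[of "is" G T] by (cases "is = []") auto
    have "0 \<le> norm (G p - T)" by simp
    also have "\<dots> \<le> B" using that(4) assms by (simp add: polydisc_def)
    finally have "B \<ge> 0" .
    moreover have "C is \<le> sum C L"
      using fin that(1) C(1) by (intro member_le_sum) (auto intro: less_imp_le)
    ultimately show ?thesis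
      using 1 mult_right_mono by (meson order_trans)
  qed
  moreover have "sum C L > 0"
    using fin C(1) by (intro sum_pos) (auto simp: L_def intro: exI[of _ "[]"])
  ultimately show ?thesis
    by (intro exI[of _ "sum C L"]) (auto simp: L_def)
qed

section \<open>The hypergeometric series\<close>

text \<open>The ratio of consecutive coefficients is (n+a)(n+b) / ((n+1)(n+1+s)), with the numerator
  expanded.\<close>

fun hyp_coeff :: "'a::real_normed_field \<Rightarrow> 'a \<Rightarrow> 'a \<Rightarrow> nat \<Rightarrow> 'a" where
  "hyp_coeff s t k 0 = 1"
| "hyp_coeff s t k (Suc n) = hyp_coeff s t k n * (of_nat n ^ 2 + of_nat n * (1 + s + t) + k)
                        / ((of_nat n + 1) * (of_nat n + 1 + s))"

text \<open>\<open>hyp j s t k\<close> is the \<open>j\<close>-th derivative of \<open>F(a, b; 1 + s; z)\<close>, where \<open>a + b = 1 + s + t\<close> and \<open>a b = k\<close>: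
  only these symmetric functions of \<open>a\<close> and \<open>b\<close> enter the coefficients, so \<open>a\<close> and \<open>b\<close> need not be real.\<close>
definition hyp :: "nat \<Rightarrow> 'a::{real_normed_field,banach} \<Rightarrow> 'a \<Rightarrow> 'a \<Rightarrow> 'a \<Rightarrow> 'a" where
  "hyp j s t k z = (\<Sum>n. (diffs ^^ j) (hyp_coeff s t k) n * z ^ n)"

text \<open>The recurrence of \<open>hyp_coeff\<close> with every factor estimated: norms of s, t, k
  at most M, and |n+1+s| at least n + 1/2 when Re s is at least -1/2. A complex neighbourhood of s =
  0 contains s with negative real part; the bound -1/2 stays clear of the pole at s = -1.\<close>

fun hyp_majorant :: "real \<Rightarrow> nat \<Rightarrow> real" where
  "hyp_majorant M 0 = 1"
| "hyp_majorant M (Suc n) = hyp_majorant M n * (real n ^ 2 + real n * (1 + 2 * M) + M) / ((real n + 1) * (real n + 1/2))"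

lemma hyp_majorant_nonneg: "M \<ge> 0 \<Longrightarrow> hyp_majorant M n \<ge> 0"
  by (induction n) auto

lemma norm_hyp_coeff_le:
  fixes s t k :: complex
  assumes "norm s \<le> M" "norm t \<le> M" "norm k \<le> M" "Re s \<ge> -1/2"
  shows "norm (hyp_coeff s t k n) \<le> hyp_majorant M n"
proof (induction n)
  case (Suc n)
  have M: "M \<ge> 0" using assms(1) norm_ge_zero order_trans by blast
  have "norm (of_nat n ^ 2 + of_nat n * (1 + s + t) + k) \<le>
      norm (of_nat n ^ 2 :: complex) + norm (of_nat n * (1 + s + t)) + norm k"
    by (intro order_trans[OF norm_triangle_ineq] add_mono norm_triangle_ineq) auto
  also have "\<dots> \<le> real n ^ 2 + real n * (1 + 2 * M) + M"
  proof -
    have "norm (1 + s + t) \<le> 1 + 2 * M"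
      using norm_triangle_ineq[of "1 + s" t] norm_triangle_ineq[of 1 s] assms by simp
    then show ?thesis
      using assms by (auto simp: norm_power norm_mult intro!: add_mono mult_left_mono)
  qed
  finally have num: "norm (of_nat n ^ 2 + of_nat n * (1 + s + t) + k) \<le> real n ^ 2 + real n * (1 + 2 * M) + M" .
  have "real n + 1/2 \<le> Re (of_nat n + 1 + s)" using assms by simp
  also have "\<dots> \<le> norm (of_nat n + 1 + s)" by (rule complex_Re_le_cmod)
  finally have "real n + 1/2 \<le> norm (of_nat n + 1 + s)" .
  moreover have "norm (of_nat n + 1 :: complex) = real n + 1"
    using norm_of_nat[of "Suc n", where 'a = complex] by (simp add: add.commute)
  ultimately have den: "(real n + 1) * (real n + 1/2) \<le> norm ((of_nat n + 1) * (of_nat n + 1 + s))"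
    by (simp add: norm_mult mult_left_mono)
  show ?case
    unfolding hyp_coeff.simps hyp_majorant.simps norm_divide norm_mult[of "hyp_coeff s t k n"]
    using Suc.IH num den M by (intro frac_le mult_mono) (auto simp: hyp_majorant_nonneg)
qed simp

lemma summable_hyp_majorant:
  assumes "norm r < 1" "M \<ge> 0"
  shows "summable (\<lambda>n. hyp_majorant M n * r ^ n)"
proof -
  \<comment> \<open>The ratio of consecutive majorants tends to 1, so for |r| < 1 the ratio test
    applies with the midpoint of |r| and 1.\<close>
  define q where "q n = (real n ^ 2 + real n * (1 + 2 * M) + M) / ((real n + 1) * (real n + 1/2))" for n
  have "q \<longlonglongrightarrow> 1"
    unfolding q_def by real_asymp
  then have "(\<lambda>n. norm r * q n) \<longlonglongrightarrow> norm r * 1"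
    by (intro tendsto_intros)
  then have "\<forall>\<^sub>F n in sequentially. norm r * q n < (1 + norm r) / 2"
    using assms by (intro order_tendstoD) auto
  then obtain N where N: "\<And>n. n \<ge> N \<Longrightarrow> norm r * q n < (1 + norm r) / 2"
    by (auto simp: eventually_sequentially)
  show ?thesis
  proof (rule summable_ratio_test[of "(1 + norm r) / 2" N])
    fix n assume "n \<ge> N"
    have "norm (hyp_majorant M (Suc n) * r ^ Suc n) = norm r * q n * norm (hyp_majorant M n * r ^ n)"
      using assms(2) by (simp add: q_def norm_mult norm_divide abs_mult hyp_majorant_nonneg norm_power)
    also have "\<dots> \<le> (1 + norm r) / 2 * norm (hyp_majorant M n * r ^ n)"
      using N[OF \<open>n \<ge> N\<close>] by (intro mult_right_mono) auto
    finally show "norm (hyp_majorant M (Suc n) * r ^ Suc n) \<le> (1 + norm r) / 2 * norm (hyp_majorant M n * r ^ n)" .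
  qed (use assms in auto)
qed

lemma summable_diffs_funpow:
  fixes c :: "nat \<Rightarrow> 'a::{real_normed_field,banach}"
  assumes "\<And>x. norm x < K \<Longrightarrow> summable (\<lambda>n. c n * x ^ n)" "norm x < K"
  shows "summable (\<lambda>n. (diffs ^^ j) c n * x ^ n)"
  using assms(2)
proof (induction j arbitrary: x)
  case (Suc j)
  then show ?case
    using termdiff_converges[of x K "(diffs ^^ j) c"] by simp
qed (use assms in simp)

lemma norm_diffs_funpow_le:
  fixes c :: "nat \<Rightarrow> 'a::real_normed_algebra_1"
  assumes "\<And>n. norm (c n) \<le> b n"
  shows "norm ((diffs ^^ j) c n) \<le> (diffs ^^ j) b n"
proof (induction j arbitrary: n)
  case (Suc j)
  have "norm (of_nat (Suc n) * (diffs ^^ j) c (Suc n)) \<le> norm (of_nat (Suc n) :: 'a) * norm ((diffs ^^ j) c (Suc n))"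
    by (rule norm_mult_ineq)
  also have "\<dots> \<le> real (Suc n) * (diffs ^^ j) b (Suc n)"
    using Suc.IH by (intro mult_mono) (auto simp: norm_of_nat simp del: of_nat_Suc)
  finally show ?case
    by (simp add: diffs_def[of "(diffs ^^ j) c"] diffs_def[of "(diffs ^^ j) b"])
qed (use assms in simp)

definition hyp_dom :: "real \<Rightarrow> real \<Rightarrow> (complex \<times> complex \<times> complex \<times> complex) set" where
  "hyp_dom M r = {(s,t,k,z). norm s \<le> M \<and> norm t \<le> M \<and> norm k \<le> M \<and> Re s \<ge> -1/2 \<and> norm z \<le> r}"

lemma norm_hyp_term_le:
  assumes "(s,t,k,z) \<in> hyp_dom M r"
  shows "norm ((diffs ^^ j) (hyp_coeff s t k) n * z ^ n) \<le> (diffs ^^ j) (hyp_majorant M) n * r ^ n"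
proof -
  have "norm ((diffs ^^ j) (hyp_coeff s t k) n) \<le> (diffs ^^ j) (hyp_majorant M) n"
    using assms by (intro norm_diffs_funpow_le norm_hyp_coeff_le) (auto simp: hyp_dom_def)
  moreover have "norm z ^ n \<le> r ^ n"
    using assms by (intro power_mono) (auto simp: hyp_dom_def)
  ultimately show ?thesis
    unfolding norm_mult norm_power by (meson mult_mono norm_ge_zero order_trans zero_le_power)
qed

lemma summable_hyp_majorant_diffs:
  assumes "M \<ge> 0" "0 \<le> r" "r < 1"
  shows "summable (\<lambda>n. (diffs ^^ j) (hyp_majorant M) n * r ^ n)"
  using assms by (intro summable_diffs_funpow[of 1]) (auto intro: summable_hyp_majorant)

text \<open>One Weierstrass majorant for parameters and argument together; this is what makes the
  series jointly continuous and holomorphic in (s, t, k, z).\<close>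

lemma hyp_uniform_limit:
  assumes "M \<ge> 0" "0 \<le> r" "r < 1"
  shows "uniform_limit (hyp_dom M r) (\<lambda>N (s,t,k,z). \<Sum>n<N. (diffs ^^ j) (hyp_coeff s t k) n * z ^ n)
           (\<lambda>(s,t,k,z). hyp j s t k z) sequentially"
proof -
  have "uniform_limit (hyp_dom M r) (\<lambda>N p. \<Sum>n<N. (case p of (s,t,k,z) \<Rightarrow> (diffs ^^ j) (hyp_coeff s t k) n * z ^ n))
     (\<lambda>p. \<Sum>n. (case p of (s,t,k,z) \<Rightarrow> (diffs ^^ j) (hyp_coeff s t k) n * z ^ n)) sequentially"
    by (rule Weierstrass_m_test[OF _ summable_hyp_majorant_diffs[OF assms]])
      (auto intro: norm_hyp_term_le)
  then show ?thesis
    by (simp add: hyp_def case_prod_unfold)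
qed

lemma hyp_sums:
  fixes s t k z :: complex
  assumes "Re s \<ge> -1/2" "norm z < 1"
  shows "(\<lambda>n. (diffs ^^ j) (hyp_coeff s t k) n * z ^ n) sums hyp j s t k z"
proof -
  define M where "M = norm s + norm t + norm k"
  have "(s,t,k,z) \<in> hyp_dom M (norm z)"
    using assms by (auto simp: hyp_dom_def M_def)
  then have "summable (\<lambda>n. (diffs ^^ j) (hyp_coeff s t k) n * z ^ n)"
    using assms by (intro summable_comparison_test'[OF summable_hyp_majorant_diffs[of M "norm z" j]] norm_hyp_term_le)
      (auto simp: M_def)
  then show ?thesis
    by (simp add: hyp_def summable_sums)
qed

lemma hyp_has_field_derivative:
  fixes s t k z :: complex
  assumes "Re s \<ge> -1/2" "norm z < 1"
  shows "(hyp j s t k has_field_derivative hyp (Suc j) s t k z) (at z)"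
  using termdiffs_strong'[of 1 "(diffs ^^ j) (hyp_coeff s t k)" z] hyp_sums[OF assms(1)] assms(2)
  unfolding hyp_def by (auto simp: sums_iff)

text \<open>Comparison of coefficients: every term becomes a series in z^n whose coefficients
  involve \<open>hyp_coeff\<close> at n and n+1, and the recurrence says that the total coefficient
  of z^n vanishes.\<close>

lemma hyp_ode:
  fixes s t k z :: complex
  assumes "Re s \<ge> -1/2" "norm z < 1"
  shows "z * (1 - z) * hyp 2 s t k z + ((1 + s) - (2 + s + t) * z) * hyp 1 s t k z - k * hyp 0 s t k z = 0"
proof -
  let ?c = "hyp_coeff s t k"
  have S0: "(\<lambda>n. ?c n * z ^ n) sums hyp 0 s t k z"
    using hyp_sums[OF assms, of 0] by simp
  have S1: "(\<lambda>n. of_nat (Suc n) * ?c (Suc n) * z ^ n) sums hyp 1 s t k z"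
    using hyp_sums[OF assms, of 1] by (simp add: diffs_def del: of_nat_Suc hyp_coeff.simps)
  have S2: "(\<lambda>n. of_nat (Suc n) * (of_nat (Suc (Suc n)) * ?c (Suc (Suc n))) * z ^ n) sums hyp 2 s t k z"
    using hyp_sums[OF assms, of 2] by (simp add: diffs_def numeral_2_eq_2 del: of_nat_Suc hyp_coeff.simps)
  \<comment> \<open>Multiplication by z shifts the index by one; the factor n makes the new zeroth
    term vanish.\<close>
  have Z1: "(\<lambda>n. of_nat n * ?c n * z ^ n) sums (z * hyp 1 s t k z)"
    by (rule sums_Suc_imp) (use sums_mult[OF S1, of z] in \<open>simp_all add: mult_ac del: of_nat_Suc hyp_coeff.simps\<close>)
  have Z2: "(\<lambda>n. of_nat n * of_nat (Suc n) * ?c (Suc n) * z ^ n) sums (z * hyp 2 s t k z)"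
    by (rule sums_Suc_imp) (use sums_mult[OF S2, of z] in \<open>simp_all add: mult_ac del: of_nat_Suc hyp_coeff.simps\<close>)
  have Z3: "(\<lambda>n. of_nat n * (of_nat n - 1) * ?c n * z ^ n) sums (z * (z * hyp 2 s t k z))"
    by (rule sums_Suc_imp) (use sums_mult[OF Z2, of z] in \<open>simp_all add: mult_ac del: hyp_coeff.simps\<close>)
  have rec: "(of_nat n + 1) * (of_nat n + 1 + s) * ?c (Suc n) = ?c n * (of_nat n ^ 2 + of_nat n * (1 + s + t) + k)" for n
  proof -
    have "Re (of_nat n + 1 + s) > 0" using assms by simp
    then have "of_nat n + 1 + s \<noteq> 0" by (metis less_irrefl zero_complex.simps(1))
    moreover have "of_nat n + 1 \<noteq> (0::complex)"
      by (metis of_nat_Suc of_nat_neq_0 add.commute)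
    ultimately show ?thesis by simp
  qed
  have "(\<lambda>n. of_nat n * of_nat (Suc n) * ?c (Suc n) * z ^ n - of_nat n * (of_nat n - 1) * ?c n * z ^ n
     + ((1 + s) * (of_nat (Suc n) * ?c (Suc n) * z ^ n) - (2 + s + t) * (of_nat n * ?c n * z ^ n))
     - k * (?c n * z ^ n)) sums
     (z * hyp 2 s t k z - z * (z * hyp 2 s t k z)
     + ((1 + s) * hyp 1 s t k z - (2 + s + t) * (z * hyp 1 s t k z)) - k * hyp 0 s t k z)"
    by (intro sums_diff sums_add sums_mult S0 S1 Z1 Z2 Z3)
  moreover have "of_nat n * of_nat (Suc n) * ?c (Suc n) * z ^ n - of_nat n * (of_nat n - 1) * ?c n * z ^ n
     + ((1 + s) * (of_nat (Suc n) * ?c (Suc n) * z ^ n) - (2 + s + t) * (of_nat n * ?c n * z ^ n))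
     - k * (?c n * z ^ n) = 0" for n
  proof -
    have "of_nat n * of_nat (Suc n) * ?c (Suc n) * z ^ n - of_nat n * (of_nat n - 1) * ?c n * z ^ n
     + ((1 + s) * (of_nat (Suc n) * ?c (Suc n) * z ^ n) - (2 + s + t) * (of_nat n * ?c n * z ^ n))
     - k * (?c n * z ^ n) = ((of_nat n + 1) * (of_nat n + 1 + s) * ?c (Suc n)
        - ?c n * (of_nat n ^ 2 + of_nat n * (1 + s + t) + k)) * z ^ n"
      by (simp add: algebra_simps power2_eq_square del: hyp_coeff.simps)
    then show ?thesis by (simp add: rec del: hyp_coeff.simps)
  qed
  ultimately have "(\<lambda>n. 0) sums (z * hyp 2 s t k z - z * (z * hyp 2 s t k z)
     + ((1 + s) * hyp 1 s t k z - (2 + s + t) * (z * hyp 1 s t k z)) - k * hyp 0 s t k z)"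
    by (simp only:)
  from sums_unique2[OF this sums_zero]
  have "z * hyp 2 s t k z - z * (z * hyp 2 s t k z)
     + ((1 + s) * hyp 1 s t k z - (2 + s + t) * (z * hyp 1 s t k z)) - k * hyp 0 s t k z = 0" .
  then show ?thesis
    by (simp add: algebra_simps)
qed

section \<open>Real parameters: agreement with the complex series, positivity, divergence at z =
  1\<close>

lemma hyp_coeff_of_real: "hyp_coeff (of_real s) (of_real t) (of_real k) n = of_real (hyp_coeff s t k n)"
  by (induction n) auto

lemma diffs_of_real:
  assumes "\<And>n. c' n = of_real (c n)"
  shows "(diffs ^^ j) c' n = of_real ((diffs ^^ j) c n)"
  by (induction j arbitrary: n) (auto simp: diffs_def assms)

lemma hyp_sums_real:
  fixes s t k z :: real
  assumes "s \<ge> -1/2" "\<bar>z\<bar> < 1"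
  shows "(\<lambda>n. (diffs ^^ j) (hyp_coeff s t k) n * z ^ n) sums hyp j s t k z"
proof -
  have "summable (\<lambda>n. complex_of_real ((diffs ^^ j) (hyp_coeff s t k) n * z ^ n))"
    using hyp_sums[of "of_real s" "of_real z" j "of_real t" "of_real k"] assms
    by (simp add: sums_iff diffs_of_real[where c = "hyp_coeff s t k", OF hyp_coeff_of_real])
  then have "summable (\<lambda>n. (diffs ^^ j) (hyp_coeff s t k) n * z ^ n)"
    unfolding summable_of_real_iff .
  then show ?thesis by (simp add: hyp_def summable_sums)
qed

lemma hyp_of_real:
  fixes s t k z :: real
  assumes "s \<ge> -1/2" "\<bar>z\<bar> < 1"
  shows "hyp j (complex_of_real s) (of_real t) (of_real k) (of_real z) = of_real (hyp j s t k z)"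
proof -
  have "(\<lambda>n. complex_of_real ((diffs ^^ j) (hyp_coeff s t k) n * z ^ n)) sums of_real (hyp j s t k z)"
    using hyp_sums_real[OF assms, of j t k] by (simp only: sums_of_real_iff)
  then show ?thesis
    unfolding hyp_def[where 'a = complex]
    by (simp add: diffs_of_real[where c = "hyp_coeff s t k", OF hyp_coeff_of_real] sums_iff)
qed

lemma hyp_has_real_derivative:
  fixes s t k z :: real
  assumes "s \<ge> -1/2" "\<bar>z\<bar> < 1"
  shows "(hyp j s t k has_real_derivative hyp (Suc j) s t k z) (at z)"
  using termdiffs_strong'[of 1 "(diffs ^^ j) (hyp_coeff s t k)" z] hyp_sums_real[OF assms(1)] assms(2)
  unfolding hyp_def by (auto simp: sums_iff)

lemma hyp_ode_real:
  fixes s t k z :: real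
  assumes "s \<ge> -1/2" "\<bar>z\<bar> < 1"
  shows "z * (1 - z) * hyp 2 s t k z + ((1 + s) - (2 + s + t) * z) * hyp 1 s t k z - k * hyp 0 s t k z = 0"
proof -
  have "complex_of_real (z * (1 - z) * hyp 2 s t k z + ((1 + s) - (2 + s + t) * z) * hyp 1 s t k z - k * hyp 0 s t k z) = 0"
    using hyp_ode[of "of_real s" "of_real z" "of_real t" "of_real k"] assms
    by (simp add: hyp_of_real)
  then show ?thesis
    unfolding of_real_eq_0_iff .
qed

lemma hyp_coeff_pos:
  fixes s t k :: real
  assumes "s \<ge> 0" "t \<ge> 0" "k > 0"
  shows "hyp_coeff s t k n > 0"
proof (induction n)
  case (Suc n)
  have "real n ^ 2 + real n * (1 + s + t) + k > 0"
    using assms by (intro add_nonneg_pos add_nonneg_nonneg mult_nonneg_nonneg) auto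
  then show ?case using Suc assms by simp
qed simp

lemma hyp_pos:
  fixes s t k z :: real
  assumes "s \<ge> 0" "t \<ge> 0" "k > 0" "0 \<le> z" "z < 1"
  shows "hyp j s t k z > 0"
proof -
  have pos: "(diffs ^^ j) (hyp_coeff s t k) n > 0" for n
    using assms by (induction j arbitrary: n) (auto simp: diffs_def hyp_coeff_pos)
  have sm: "(\<lambda>n. (diffs ^^ j) (hyp_coeff s t k) n * z ^ n) sums hyp j s t k z"
    using assms by (intro hyp_sums_real) auto
  have "0 < (\<Sum>n<1. (diffs ^^ j) (hyp_coeff s t k) n * z ^ n)" using pos[of 0] by simp
  also have "\<dots> \<le> hyp j s t k z"
    unfolding sums_unique[OF sm]
    by (rule sum_le_suminf) (use sm pos assms in \<open>auto simp: sums_iff less_imp_le\<close>)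
  finally show ?thesis .
qed

lemma hyp_0_zero [simp]: "hyp 0 s t k 0 = 1"
  by (simp add: hyp_def suminf_finite[of "{0}"])

text \<open>The coefficients dominate a multiple of the harmonic series, so the partial sums at z =
  1 are unbounded. A large finite partial sum is continuous up to z = 1 and, by positivity, bounds
  the series from below.\<close>

lemma hyp_at_top:
  fixes s t k :: real
  assumes "s \<ge> 0" "t \<ge> 0" "k > 0"
  shows "\<exists>z0\<in>{0..<1}. \<forall>z\<in>{z0..<1}. hyp 0 s t k z \<ge> X"
proof -
  \<comment> \<open>The ratio of consecutive coefficients is at least m/(m+1), the corresponding
    ratio for 1/m.\<close>
  have low: "hyp_coeff s t k (Suc n) \<ge> hyp_coeff s t k 1 / real (Suc n)" for n
  proof (induction n)
    case (Suc n)
    let ?m = "Suc n"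
    have "a / real (Suc ?m) = a / real ?m * (real ?m / (real ?m + 1))" for a
      by simp
    then have "hyp_coeff s t k 1 / real (Suc ?m) = hyp_coeff s t k 1 / real ?m * (real ?m / (real ?m + 1))" .
    also have "\<dots> \<le> hyp_coeff s t k ?m * (real ?m / (real ?m + 1))"
      using Suc by (intro mult_right_mono) auto
    also have "\<dots> \<le> hyp_coeff s t k ?m * ((real ?m ^ 2 + real ?m * (1 + s + t) + k) / ((real ?m + 1) * (real ?m + 1 + s)))"
    proof (intro mult_left_mono)
      have "real ?m * (real ?m + 1 + s) \<le> real ?m ^ 2 + real ?m * (1 + s + t) + k"
        using assms by (simp add: algebra_simps power2_eq_square)
      moreover have "real ?m + 1 > 0" "real ?m + 1 + s > 0" using assms by auto
      ultimately show "real ?m / (real ?m + 1) \<le> (real ?m ^ 2 + real ?m * (1 + s + t) + k) / ((real ?m + 1) * (real ?m + 1 + s))"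
        by (simp add: divide_le_eq le_divide_eq mult.commute mult.assoc)
    qed (use hyp_coeff_pos[OF assms] less_imp_le in blast)
    also have "\<dots> = hyp_coeff s t k (Suc ?m)" by simp
    finally show ?case .
  qed simp
  have "\<not> summable (hyp_coeff s t k)"
  proof
    assume "summable (hyp_coeff s t k)"
    then have "summable (\<lambda>n. hyp_coeff s t k (Suc n))" by (simp add: summable_Suc_iff del: hyp_coeff.simps)
    then have "summable (\<lambda>n. hyp_coeff s t k 1 / real (Suc n))"
      by (rule summable_comparison_test'[where N = 0])
        (use low hyp_coeff_pos[OF assms, of 1] in \<open>auto simp del: hyp_coeff.simps of_nat_Suc\<close>)
    then have "summable (\<lambda>n. hyp_coeff s t k 1 * (1 / real (Suc n)))"
      by (simp del: hyp_coeff.simps)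
    then have "summable (\<lambda>n. 1 / real (Suc n))"
      using hyp_coeff_pos[OF assms, of 1] by (subst (asm) summable_cmult_iff) (auto simp del: hyp_coeff.simps)
    then show False
      using not_summable_harmonic[where 'a = real] summable_Suc_iff[of "\<lambda>n. 1 / real n"]
      by (simp add: inverse_eq_divide)
  qed
  then have "\<not> (\<forall>N. (\<Sum>n<N. hyp_coeff s t k n) \<le> X + 1)"
    using bounded_imp_summable[of "hyp_coeff s t k" "X + 1"] hyp_coeff_pos[OF assms] less_imp_le
    by (metis (no_types, lifting) lessThan_Suc_atMost)
  then obtain N where N: "(\<Sum>n<N. hyp_coeff s t k n) > X + 1" by (auto simp: not_le)
  have "((\<lambda>z. \<Sum>n<N. hyp_coeff s t k n * z ^ n) \<longlongrightarrow> (\<Sum>n<N. hyp_coeff s t k n * 1 ^ n)) (at_left 1)"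
    by (intro tendsto_intros)
  then have "\<forall>\<^sub>F z in at_left 1. (\<Sum>n<N. hyp_coeff s t k n * z ^ n) > X + 1"
    using N by (intro order_tendstoD(1)) auto
  then obtain b where b: "b < 1" "\<And>z. b < z \<Longrightarrow> z < 1 \<Longrightarrow> (\<Sum>n<N. hyp_coeff s t k n * z ^ n) > X + 1"
    by (auto simp: eventually_at_left_field)
  \<comment> \<open>The half-open interval includes its left end, so it starts strictly to the right
    of b, at the midpoint of b and 1, or at 0 if that is larger.\<close>
  have "hyp 0 s t k z \<ge> X" if "z \<in> {max 0 ((1 + b)/2)..<1}" for z
  proof -
    have sm: "(\<lambda>n. (diffs ^^ 0) (hyp_coeff s t k) n * z ^ n) sums hyp 0 s t k z"
      using assms that by (intro hyp_sums_real) auto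
    have "X + 1 < (\<Sum>n<N. hyp_coeff s t k n * z ^ n)"
      using that b(1) by (intro b(2)) auto
    also have "\<dots> \<le> hyp 0 s t k z"
      unfolding sums_unique[OF sm] funpow_0
      by (rule sum_le_suminf) (use sm hyp_coeff_pos[OF assms] that in \<open>auto simp: sums_iff less_imp_le\<close>)
    finally show ?thesis by simp
  qed
  then show ?thesis
    using b(1) by (intro bexI[of _ "max 0 ((1 + b)/2)"]) auto
qed

section \<open>Joint continuity and holomorphy of the series in its parameters and argument\<close>

lemma continuous_on_hyp_coeff:
  fixes s :: "_ \<Rightarrow> complex"
  assumes "continuous_on X s" "continuous_on X t" "continuous_on X k" "\<And>q. q \<in> X \<Longrightarrow> Re (s q) > -1/2"
  shows "continuous_on X (\<lambda>q. hyp_coeff (s q) (t q) (k q) n)"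
proof (induction n)
  case (Suc n)
  have "(of_nat n + 1) * (of_nat n + 1 + s q) \<noteq> 0" if "q \<in> X" for q
  proof -
    have "Re (of_nat n + 1 + s q) > 0" "Re (of_nat n + 1) > 0" using assms(4)[OF that] by auto
    then show ?thesis by (metis less_irrefl mult_eq_0_iff zero_complex.simps(1))
  qed
  then show ?case
    unfolding hyp_coeff.simps using Suc assms by (intro continuous_intros) auto
qed simp

lemma sep_holo_hyp_coeff:
  assumes "sep_holo X s" "sep_holo X t" "sep_holo X k" "\<And>q. q \<in> X \<Longrightarrow> Re (s q) > -1/2"
  shows "sep_holo X (\<lambda>q. hyp_coeff (s q) (t q) (k q) n)"
proof (induction n)
  case 0
  then show ?case using assms(1) by (auto simp: sep_holo_def)
next
  case (Suc n)
  have "(of_nat n + 1) * (of_nat n + 1 + s q) \<noteq> 0" if "q \<in> X" for q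
  proof -
    have "Re (of_nat n + 1 + s q) > 0" "Re (of_nat n + 1) > 0" using assms(4)[OF that] by auto
    then show ?thesis by (metis less_irrefl mult_eq_0_iff zero_complex.simps(1))
  qed
  moreover have "open X" using assms(1) by (simp add: sep_holo_def)
  ultimately show ?case
    unfolding hyp_coeff.simps using Suc assms
    by (intro sep_holo_divide sep_holo_mult sep_holo_add sep_holo_const) auto
qed

lemma sep_holo_diffs:
  assumes "\<And>n. sep_holo X (\<lambda>q. c q n)" "open X"
  shows "sep_holo X (\<lambda>q. (diffs ^^ j) (c q) n)"
  using assms by (induction j arbitrary: n) (auto simp: diffs_def simp del: of_nat_Suc)

lemma continuous_on_diffs:
  fixes c :: "'b::topological_space \<Rightarrow> nat \<Rightarrow> complex"
  assumes "\<And>n. continuous_on X (\<lambda>q. c q n)"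
  shows "continuous_on X (\<lambda>q. (diffs ^^ j) (c q) n)"
  using assms by (induction j arbitrary: n) (auto simp: diffs_def simp del: of_nat_Suc intro!: continuous_intros)

text \<open>Continuity keeps the parameters near p inside one set \<open>hyp_dom M \<rho>\<close>,
  where the series has a single majorant.\<close>

lemma hyp_local_uniform_limit:
  fixes s t k z :: "'q::metric_space \<Rightarrow> complex"
  assumes cont: "continuous_on X s" "continuous_on X t" "continuous_on X k" "continuous_on X z"
    and X: "open X" "p \<in> X" and dom: "\<And>q. q \<in> X \<Longrightarrow> Re (s q) > -1/2 \<and> norm (z q) < 1"
  shows "\<exists>r>0. ball p r \<subseteq> X \<and> uniform_limit (ball p r)
     (\<lambda>N q. \<Sum>n<N. (diffs ^^ j) (hyp_coeff (s q) (t q) (k q)) n * z q ^ n) (\<lambda>q. hyp j (s q) (t q) (k q) (z q)) sequentially"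
proof -
  define M where "M = norm (s p) + norm (t p) + norm (k p) + 1"
  define \<rho> where "\<rho> = (1 + norm (z p)) / 2"
  define Y where "Y = X \<inter> (\<lambda>q. (s q, t q, k q, z q)) -` (ball 0 M \<times> ball 0 M \<times> ball 0 M \<times> ball 0 \<rho>)"
  have \<rho>: "0 \<le> \<rho>" "\<rho> < 1" "norm (z p) < \<rho>" using dom[OF X(2)] by (auto simp: \<rho>_def)
  have "open Y"
    unfolding Y_def using cont X
    by (intro continuous_open_preimage open_Times continuous_on_Pair) auto
  moreover have "p \<in> Y"
  proof -
    have "norm (s p) < M" "norm (t p) < M" "norm (k p) < M"
      using norm_ge_zero[of "s p"] norm_ge_zero[of "t p"] norm_ge_zero[of "k p"] by (auto simp: M_def simp del: norm_ge_zero)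
    then show ?thesis
      using X \<rho> by (auto simp: Y_def)
  qed
  ultimately obtain r where r: "r > 0" "ball p r \<subseteq> Y"
    using open_contains_ball by blast
  have "M \<ge> 0" by (simp add: M_def)
  have "uniform_limit (ball p r)
     (\<lambda>N q. (\<lambda>(s,t,k,z). \<Sum>n<N. (diffs ^^ j) (hyp_coeff s t k) n * z ^ n) (s q, t q, k q, z q))
     (\<lambda>q. (\<lambda>(s,t,k,z). hyp j s t k z) (s q, t q, k q, z q)) sequentially"
  proof (rule uniform_limit_compose'[OF hyp_uniform_limit[OF \<open>M \<ge> 0\<close> \<rho>(1,2)]])
    show "(\<lambda>q. (s q, t q, k q, z q)) \<in> ball p r \<rightarrow> hyp_dom M \<rho>"
      using r(2) dom by (fastforce simp: Y_def hyp_dom_def less_imp_le)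
  qed
  then show ?thesis
    using r by (auto simp: Y_def)
qed

lemma continuous_on_hyp:
  fixes s t k z :: "'q::metric_space \<Rightarrow> complex"
  assumes cont: "continuous_on X s" "continuous_on X t" "continuous_on X k" "continuous_on X z"
    and X: "open X" and dom: "\<And>q. q \<in> X \<Longrightarrow> Re (s q) > -1/2 \<and> norm (z q) < 1"
  shows "continuous_on X (\<lambda>q. hyp j (s q) (t q) (k q) (z q))"
  unfolding continuous_on_eq_continuous_at[OF X]
proof
  fix p assume "p \<in> X"
  then obtain r where r: "r > 0" "ball p r \<subseteq> X" "uniform_limit (ball p r)
     (\<lambda>N q. \<Sum>n<N. (diffs ^^ j) (hyp_coeff (s q) (t q) (k q)) n * z q ^ n) (\<lambda>q. hyp j (s q) (t q) (k q) (z q)) sequentially"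
    using hyp_local_uniform_limit[OF cont X _ dom] by blast
  have cr: "continuous_on (ball p r) s" "continuous_on (ball p r) t" "continuous_on (ball p r) k" "continuous_on (ball p r) z"
    using cont r(2) by (auto intro: continuous_on_subset)
  have "continuous_on (ball p r) (\<lambda>q. hyp j (s q) (t q) (k q) (z q))"
  proof (rule uniform_limit_theorem[OF always_eventually r(3)], intro allI)
    show "continuous_on (ball p r) (\<lambda>q. \<Sum>n<N. (diffs ^^ j) (hyp_coeff (s q) (t q) (k q)) n * z q ^ n)" for N
      using cr r(2) dom by (intro continuous_intros continuous_on_diffs continuous_on_hyp_coeff) auto
  qed auto
  then show "isCont (\<lambda>q. hyp j (s q) (t q) (k q) (z q)) p"
    using r(1) by (simp add: continuous_on_eq_continuous_at)
qed

lemma sep_holo_hyp: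
  assumes hol: "sep_holo X s" "sep_holo X t" "sep_holo X k" "sep_holo X z"
    and dom: "\<And>q. q \<in> X \<Longrightarrow> Re (s q) > -1/2 \<and> norm (z q) < 1"
  shows "sep_holo X (\<lambda>q. hyp j (s q) (t q) (k q) (z q))"
proof (rule sep_holo_uniform_limit)
  show "open X" using hol by (simp add: sep_holo_def)
  fix p assume "p \<in> X"
  have cont: "continuous_on X s" "continuous_on X t" "continuous_on X k" "continuous_on X z"
    using hol by (auto simp: sep_holo_def)
  obtain r where r: "r > 0" "ball p r \<subseteq> X" "uniform_limit (ball p r)
     (\<lambda>N q. \<Sum>n<N. (diffs ^^ j) (hyp_coeff (s q) (t q) (k q)) n * z q ^ n) (\<lambda>q. hyp j (s q) (t q) (k q) (z q)) sequentially"
    using hyp_local_uniform_limit[OF cont \<open>open X\<close> \<open>p \<in> X\<close> dom] by blast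
  have "sep_holo (ball p r) (\<lambda>q. \<Sum>n<N. (diffs ^^ j) (hyp_coeff (s q) (t q) (k q)) n * z q ^ n)" for N
  proof -
    have sub: "sep_holo (ball p r) s" "sep_holo (ball p r) t" "sep_holo (ball p r) k" "sep_holo (ball p r) z"
      by (rule sep_holo_subset[OF _ open_ball r(2)], fact)+
    have "sep_holo (ball p r) (\<lambda>q. hyp_coeff (s q) (t q) (k q) n)" for n
      using r(2) dom by (intro sep_holo_hyp_coeff sub) auto
    then have "sep_holo (ball p r) (\<lambda>q. (diffs ^^ j) (hyp_coeff (s q) (t q) (k q)) n)" for n
      by (rule sep_holo_diffs) simp
    then show ?thesis
      by (intro sep_holo_sum sep_holo_mult sep_holo_power sub(4) open_ball)
  qed
  then show "\<exists>r>0. \<exists>F. ball p r \<subseteq> X \<and> (\<forall>n. sep_holo (ball p r) (F n)) \<and>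
      uniform_limit (ball p r) F (\<lambda>q. hyp j (s q) (t q) (k q) (z q)) sequentially"
    using r by (intro exI[of _ r] exI conjI allI r) assumption+
qed

section \<open>The Riccati equation\<close>

definition lincomb :: "'a::{real_normed_field,banach} \<Rightarrow> 'a \<Rightarrow> 'a \<Rightarrow> 'a \<Rightarrow> 'a \<Rightarrow> 'a \<Rightarrow> 'a" where
  "lincomb s t k A B z = A * hyp 0 s t k z + B * hyp 0 t s k (1 - z)"

definition lincomb1 :: "'a::{real_normed_field,banach} \<Rightarrow> 'a \<Rightarrow> 'a \<Rightarrow> 'a \<Rightarrow> 'a \<Rightarrow> 'a \<Rightarrow> 'a" where
  "lincomb1 s t k A B z = A * hyp 1 s t k z - B * hyp 1 t s k (1 - z)"

definition lincomb2 :: "'a::{real_normed_field,banach} \<Rightarrow> 'a \<Rightarrow> 'a \<Rightarrow> 'a \<Rightarrow> 'a \<Rightarrow> 'a \<Rightarrow> 'a" where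
  "lincomb2 s t k A B z = A * hyp 2 s t k z + B * hyp 2 t s k (1 - z)"

text \<open>This is 2 (1-x^2) w'/w in the variable z, where 1-x = 2(1-z), 1+x = 2z and 1-x^2 =
  4z(1-z). It depends on A and B only through their ratio.\<close>

definition riccati_U :: "'a::{real_normed_field,banach} \<Rightarrow> 'a \<Rightarrow> 'a \<Rightarrow> 'a \<Rightarrow> 'a \<Rightarrow> 'a \<Rightarrow> 'a" where
  "riccati_U s t k A B z = 2 * (1 + s) * (1 - z) - 2 * (1 + t) * z
     + 4 * z * (1 - z) * (lincomb1 s t k A B z / lincomb s t k A B z)"

lemma lincomb_swap: "lincomb s t k A B z = lincomb t s k B A (1 - z)"
  and lincomb1_swap: "lincomb1 s t k A B z = - lincomb1 t s k B A (1 - z)"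
  by (simp_all add: lincomb_def lincomb1_def)

text \<open>The reflection x -> -x, U -> -U exchanges the endpoints together with s, t and A, B; it
  reduces the analysis at z = 1 to that at z = 0.\<close>

lemma riccati_U_swap: "riccati_U s t k A B z = - riccati_U t s k B A (1 - z)"
  unfolding riccati_U_def lincomb_swap[of s t k A B z] lincomb1_swap[of s t k A B z]
  by (simp add: algebra_simps)

lemma riccati_U_midpoint_form:
  fixes s t k A B x :: real
  shows "riccati_U s t k A B ((1 + x) / 2) = (1 + s) * (1 - x) - (1 + t) * (1 + x)
     + (1 - x\<^sup>2) * (lincomb1 s t k A B ((1 + x) / 2) / lincomb s t k A B ((1 + x) / 2))"
proof -
  have "4 * ((1 + x) / 2) * (1 - (1 + x) / 2) = 1 - x\<^sup>2"
    "2 * (1 + s) * (1 - (1 + x) / 2) = (1 + s) * (1 - x)" "2 * (1 + t) * ((1 + x) / 2) = (1 + t) * (1 + x)"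
    by (simp_all add: field_simps power2_eq_square)
  then show ?thesis
    unfolding riccati_U_def by (simp only:)
qed

lemma riccati_U_half: "riccati_U s t k A B (1/2 :: real) = s - t + lincomb1 s t k A B (1/2) / lincomb s t k A B (1/2)"
  by (simp add: riccati_U_def field_simps)

lemma lincomb_has_real_derivative:
  fixes s t k A B z :: real
  assumes "s \<ge> 0" "t \<ge> 0" "0 < z" "z < 1"
  shows "(lincomb s t k A B has_real_derivative lincomb1 s t k A B z) (at z)"
    and "(lincomb1 s t k A B has_real_derivative lincomb2 s t k A B z) (at z)"
proof -
  have *: "(hyp j s t k has_real_derivative hyp (Suc j) s t k z) (at z)"
    "((\<lambda>z. hyp j t s k (1 - z)) has_real_derivative - hyp (Suc j) t s k (1 - z)) (at z)" for j
  proof -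
    show "(hyp j s t k has_real_derivative hyp (Suc j) s t k z) (at z)"
      using assms by (intro hyp_has_real_derivative) auto
    have "(hyp j t s k has_real_derivative hyp (Suc j) t s k (1 - z)) (at (1 - z))"
      using assms by (intro hyp_has_real_derivative) auto
    moreover have "((\<lambda>z. 1 - z) has_real_derivative -1) (at z)"
      by (auto intro!: derivative_eq_intros)
    ultimately show "((\<lambda>z. hyp j t s k (1 - z)) has_real_derivative - hyp (Suc j) t s k (1 - z)) (at z)"
      using DERIV_chain2 by fastforce
  qed
  show "(lincomb s t k A B has_real_derivative lincomb1 s t k A B z) (at z)"
    unfolding lincomb_def lincomb1_def using *[of 0] by (auto intro!: derivative_eq_intros)
  show "(lincomb1 s t k A B has_real_derivative lincomb2 s t k A B z) (at z)"
    unfolding lincomb1_def lincomb2_def using *[of 1]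
    by (auto intro!: derivative_eq_intros simp: numeral_2_eq_2)
qed

text \<open>Both parts solve the same equation: under z -> 1-z with s and t exchanged, the
  coefficient (1+s) - (2+s+t)z changes sign, and so does the first derivative.\<close>

lemma lincomb_ode:
  fixes s t k A B z :: real
  assumes "s \<ge> 0" "t \<ge> 0" "0 < z" "z < 1"
  shows "z * (1 - z) * lincomb2 s t k A B z = k * lincomb s t k A B z - ((1 + s) - (2 + s + t) * z) * lincomb1 s t k A B z"
proof -
  have 1: "z * (1 - z) * hyp 2 s t k z = k * hyp 0 s t k z - ((1 + s) - (2 + s + t) * z) * hyp 1 s t k z"
    using hyp_ode_real[of s z t k] assms by simp
  have "(1 - z) * (1 - (1 - z)) * hyp 2 t s k (1 - z) =
     k * hyp 0 t s k (1 - z) - ((1 + t) - (2 + t + s) * (1 - z)) * hyp 1 t s k (1 - z)"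
    using hyp_ode_real[of t "1 - z" s k] assms by (simp add: algebra_simps)
  then have 2: "z * (1 - z) * hyp 2 t s k (1 - z) = k * hyp 0 t s k (1 - z) + ((1 + s) - (2 + s + t) * z) * hyp 1 t s k (1 - z)"
    by (simp add: algebra_simps)
  have "z * (1 - z) * lincomb2 s t k A B z = A * (z * (1 - z) * hyp 2 s t k z) + B * (z * (1 - z) * hyp 2 t s k (1 - z))"
    by (simp add: lincomb2_def algebra_simps)
  also have "\<dots> = k * lincomb s t k A B z - ((1 + s) - (2 + s + t) * z) * lincomb1 s t k A B z"
    unfolding 1 2 by (simp add: lincomb_def lincomb1_def algebra_simps)
  finally show ?thesis .
qed

text \<open>Integrating factor exp(-g) with g' = a. The coefficient may blow up at -1 and 1, so the
  antiderivative is taken on a compact subinterval containing w and x.\<close>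

lemma linear_ode_zero:
  fixes y a :: "real \<Rightarrow> real"
  assumes der: "\<And>x. -1 < x \<Longrightarrow> x < 1 \<Longrightarrow> (y has_real_derivative a x * y x) (at x)"
    and cont: "continuous_on {-1<..<1} a"
    and w: "-1 < w" "w < 1" "y w = 0" and x: "-1 < x" "x < 1"
  shows "y x = 0"
proof -
  define c d where "c = (-1 + min w x) / 2" and "d = (1 + max w x) / 2"
  have cd: "-1 < c" "c < w" "c < x" "w < d" "x < d" "d < 1"
    using w x by (auto simp: c_def d_def min_def max_def)
  have "continuous_on {c..d} a"
    by (rule continuous_on_subset[OF cont]) (use cd in auto)
  then obtain g where g: "\<And>u. u \<in> {c..d} \<Longrightarrow> (g has_vector_derivative a u) (at u within {c..d})"
    by (metis antiderivative_continuous)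
  have "((\<lambda>u. y u * exp (- g u)) has_real_derivative 0) (at u within {c..d})" if u: "u \<in> {c..d}" for u
  proof -
    have "(y has_real_derivative a u * y u) (at u within {c..d})"
      using der[of u] cd u by (auto intro: has_field_derivative_at_within)
    moreover have "(g has_real_derivative a u) (at u within {c..d})"
      using g[OF u] by (simp add: has_real_derivative_iff_has_vector_derivative)
    ultimately show ?thesis
      by (auto intro!: derivative_eq_intros)
  qed
  then obtain C where "\<And>u. u \<in> {c..d} \<Longrightarrow> y u * exp (- g u) = C"
    using has_field_derivative_zero_constant[of "{c..d}" "\<lambda>u. y u * exp (- g u)"] by auto
  then have "y x * exp (- g x) = y w * exp (- g w)"
    using cd by auto
  then show ?thesis using w by simp
qed

text \<open>The last equation is k = (c3 - cbar3)/2 solved for c3, so k > 0 is the strict inequality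
  c3 > cbar3.\<close>

locale riccati_params =
  fixes c :: "real^3" and s t k :: real
  assumes st: "s \<ge> 0" "t \<ge> 0" and k: "k > 0"
    and c1: "c$1 = s\<^sup>2 - 1" and c2: "c$2 = t\<^sup>2 - 1" and c3: "c$3 = 2 * k - (s + t) * (s + t + 2) / 2"
begin

abbreviation u where "u \<equiv> hyp 0 s t k"
abbreviation u1 where "u1 \<equiv> hyp 1 s t k"
abbreviation g where "g \<equiv> hyp 0 t s k"
abbreviation g1 where "g1 \<equiv> hyp 1 t s k"
text \<open>With m = \<gamma> - s + t, these coefficients give f = D and f' = m D at z = 1/2, where
  D is the positive value of u g1 + u1 g there; hence U(0) = \<gamma>. Both are affine in
  \<gamma>.\<close>

abbreviation Acoef where "Acoef \<gamma> \<equiv> g1 (1/2) + (\<gamma> - s + t) * g (1/2)"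
abbreviation Bcoef where "Bcoef \<gamma> \<equiv> u1 (1/2) - (\<gamma> - s + t) * u (1/2)"

lemma pos: "0 \<le> z \<Longrightarrow> z < 1 \<Longrightarrow> hyp j s t k z > 0" "0 \<le> z \<Longrightarrow> z < 1 \<Longrightarrow> hyp j t s k z > 0"
  using st k by (auto intro!: hyp_pos)

text \<open>The right-hand side is the Riccati operator applied to the linear function m(x) =
  (1+s)(1-x) - (1+t)(1+x), plus 2k(1-x^2). In this form subtracting m from a solution leaves a
  simple equation.\<close>

lemma Pc_eq: "Pc c x = (1 - x\<^sup>2) * (2 * k - (s + t + 2)) + 2 * x * ((1 + s) * (1 - x) - (1 + t) * (1 + x))
    + ((1 + s) * (1 - x) - (1 + t) * (1 + x))\<^sup>2 / 2"
  unfolding Pc_def c1 c2 c3 by (simp add: power2_eq_square field_simps)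

text \<open>The hypergeometric equation expresses f''/f through r = f'/f, after which the Riccati
  equation is a polynomial identity in z, r and the parameters.\<close>

lemma riccati_U_is_sol:
  assumes "\<And>z. 0 < z \<Longrightarrow> z < 1 \<Longrightarrow> lincomb s t k A B z \<noteq> 0"
  shows "is_sol c (\<lambda>x. riccati_U s t k A B ((1 + x) / 2))"
  unfolding is_sol_def
proof (intro allI impI)
  fix x :: real assume x: "-1 < x \<and> x < 1"
  define z where "z = (1 + x) / 2"
  have z: "0 < z" "z < 1" "x = 2 * z - 1" using x by (auto simp: z_def field_simps)
  define f f1 f2 where "f = lincomb s t k A B z" "f1 = lincomb1 s t k A B z" "f2 = lincomb2 s t k A B z"
  have f: "f \<noteq> 0" using assms z by (simp add: f_f1_f2_def)
  note D = lincomb_has_real_derivative[OF st z(1,2)]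
  have D': "((\<lambda>x. lincomb s t k A B ((1 + x) / 2)) has_real_derivative f1 / 2) (at x)"
    "((\<lambda>x. lincomb1 s t k A B ((1 + x) / 2)) has_real_derivative f2 / 2) (at x)"
  proof -
    have *: "((\<lambda>x. (1 + x) / 2) has_real_derivative 1/2) (at x)"
      by (auto intro!: derivative_eq_intros)
    show "((\<lambda>x. lincomb s t k A B ((1 + x) / 2)) has_real_derivative f1 / 2) (at x)"
      using DERIV_chain2[OF D(1)[unfolded z_def, of k A B] *] by (simp add: f_f1_f2_def z_def)
    show "((\<lambda>x. lincomb1 s t k A B ((1 + x) / 2)) has_real_derivative f2 / 2) (at x)"
      using DERIV_chain2[OF D(2)[unfolded z_def, of k A B] *] by (simp add: f_f1_f2_def z_def)
  qed
  let ?d = "- (1 + s) - (1 + t) + ((1 - 2 * z) * 2 * (f1 / f) + 4 * z * (1 - z) * ((f2 * f - f1 * f1) / (2 * f\<^sup>2)))"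
  have "((\<lambda>x. riccati_U s t k A B ((1 + x) / 2)) has_real_derivative ?d) (at x)"
  proof -
    define F F1 where "F x = lincomb s t k A B ((1 + x) / 2)" and "F1 x = lincomb1 s t k A B ((1 + x) / 2)" for x
    have F: "F x = f" "F1 x = f1" by (simp_all add: F_def F1_def f_f1_f2_def z_def)
    have DF: "(F has_real_derivative f1 / 2) (at x)" "(F1 has_real_derivative f2 / 2) (at x)"
      using D' unfolding F_def F1_def .
    have "((\<lambda>x. F1 x / F x) has_real_derivative (f2 / 2 * f - f1 * (f1 / 2)) / (f * f)) (at x)"
      using DERIV_divide[OF DF(2,1)] f by (simp add: F)
    moreover have "(f2 / 2 * f - f1 * (f1 / 2)) / (f * f) = (f2 * f - f1 * f1) / (2 * f\<^sup>2)"
      using f by (simp add: field_simps power2_eq_square)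
    ultimately have Q: "((\<lambda>x. F1 x / F x) has_real_derivative (f2 * f - f1 * f1) / (2 * f\<^sup>2)) (at x)"
      by simp
    have "((\<lambda>x. (1 + s) * (1 - x) - (1 + t) * (1 + x) + (1 - x\<^sup>2) * (F1 x / F x)) has_real_derivative
        - (1 + s) - (1 + t) + (- 2 * x * (f1 / f) + (1 - x\<^sup>2) * ((f2 * f - f1 * f1) / (2 * f\<^sup>2)))) (at x)"
      by (rule derivative_eq_intros Q refl)+ (simp add: F)
    moreover have "(\<lambda>x. (1 + s) * (1 - x) - (1 + t) * (1 + x) + (1 - x\<^sup>2) * (F1 x / F x)) =
        (\<lambda>x. riccati_U s t k A B ((1 + x) / 2))"
      by (simp add: riccati_U_midpoint_form F_def F1_def)
    moreover have "- 2 * x = (1 - 2 * z) * 2" "1 - x\<^sup>2 = 4 * z * (1 - z)"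
      by (simp_all add: z(3) algebra_simps power2_eq_square)
    ultimately show ?thesis by (simp only:)
  qed
  moreover have "(1 - x\<^sup>2) * ?d + 2 * x * riccati_U s t k A B z + (1/2) * (riccati_U s t k A B z)\<^sup>2 = Pc c x"
  proof -
    define r where "r = f1 / f"
    have U: "riccati_U s t k A B z = 2 * (1 + s) * (1 - z) - 2 * (1 + t) * z + 4 * z * (1 - z) * r"
      by (simp add: riccati_U_def r_def f_f1_f2_def)
    have "z * (1 - z) * f2 = k * f - ((1 + s) - (2 + s + t) * z) * f1"
      using lincomb_ode[OF st z(1,2)] by (simp add: f_f1_f2_def)
    then have "z * (1 - z) * f2 / f = (k * f - ((1 + s) - (2 + s + t) * z) * f1) / f" by simp
    then have "z * (1 - z) * (f2 / f) = k - ((1 + s) - (2 + s + t) * z) * r"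
      using f by (simp add: r_def diff_divide_distrib)
    moreover have "(f2 * f - f1 * f1) / (2 * f\<^sup>2) = (f2 / f - r\<^sup>2) / 2"
      using f by (simp add: r_def field_simps power2_eq_square)
    moreover have "4 * z * (1 - z) * ((f2 / f - r\<^sup>2) / 2) = 2 * (z * (1 - z) * (f2 / f)) - 2 * z * (1 - z) * r\<^sup>2"
      by (simp add: field_simps flip: add_divide_distrib diff_divide_distrib)
    ultimately have "4 * z * (1 - z) * ((f2 * f - f1 * f1) / (2 * f\<^sup>2)) =
        2 * (k - ((1 + s) - (2 + s + t) * z) * r) - 2 * z * (1 - z) * r\<^sup>2"
      by (simp only:)
    then have d: "?d = - (1 + s) - (1 + t) + ((1 - 2 * z) * 2 * r + (2 * (k - ((1 + s) - (2 + s + t) * z) * r) - 2 * z * (1 - z) * r\<^sup>2))"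
      by (simp add: r_def)
    show ?thesis
      unfolding d U Pc_eq z(3) by (simp add: field_simps power2_eq_square)
  qed
  ultimately show "\<exists>d. ((\<lambda>x. riccati_U s t k A B ((1 + x) / 2)) has_real_derivative d) (at x) \<and>
      (1 - x\<^sup>2) * d + 2 * x * riccati_U s t k A B ((1 + x) / 2) + (1/2) * (riccati_U s t k A B ((1 + x) / 2))\<^sup>2 = Pc c x"
    unfolding z_def by blast
qed

text \<open>With \<psi> = V - m and f' the derivative in z, the defect N = (1-x^2) f' - \<psi> f
  solves a homogeneous linear equation and vanishes at 0 by the choice of A and B, so N = 0
  throughout. Then f' is a multiple of f, so a zero of f would propagate to 0, where f is positive;
  division by f is therefore legitimate everywhere.\<close>

lemma sol_eq_riccati_U:
  assumes V: "is_sol c V" and x: "-1 < x" "x < 1"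
  defines "A \<equiv> Acoef (V 0)" and "B \<equiv> Bcoef (V 0)"
  shows "lincomb s t k A B ((1 + x) / 2) > 0" "V x = riccati_U s t k A B ((1 + x) / 2)"
proof -
  define f where "f x = lincomb s t k A B ((1 + x) / 2)" for x
  define f1 where "f1 x = lincomb1 s t k A B ((1 + x) / 2)" for x
  define f2 where "f2 x = lincomb2 s t k A B ((1 + x) / 2)" for x
  define m where "m x = (1 + s) * (1 - x) - (1 + t) * (1 + x)" for x
  define \<psi> where "\<psi> x = V x - m x" for x
  define N where "N x = (1 - x\<^sup>2) * f1 x - \<psi> x * f x" for x
  define V' where "V' x = (Pc c x - 2 * x * V x - (V x)\<^sup>2 / 2) / (1 - x\<^sup>2)" for x
  have om: "1 - x\<^sup>2 > 0" if "-1 < x" "x < 1" for x :: real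
    using that by (simp add: abs_square_less_1)
  have dV: "(V has_real_derivative V' x) (at x)" if xx: "-1 < x" "x < 1" for x
  proof -
    obtain d where d: "(V has_real_derivative d) (at x)"
      "(1 - x\<^sup>2) * d + 2 * x * V x + (1/2) * (V x)\<^sup>2 = Pc c x"
      using V xx unfolding is_sol_def by blast
    then have "d = V' x"
      using om[OF xx] by (simp add: V'_def eq_divide_eq algebra_simps)
    then show ?thesis using d(1) by simp
  qed
  have contV: "continuous_on {-1<..<1} V"
    by (intro continuous_at_imp_continuous_on ballI DERIV_isCont[OF dV]) auto
  have D: "(f has_real_derivative f1 x / 2) (at x)" "(f1 has_real_derivative f2 x / 2) (at x)"
    if xx: "-1 < x" "x < 1" for x
  proof -
    have z: "0 < (1 + x) / 2" "(1 + x) / 2 < 1" using xx by auto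
    have *: "((\<lambda>x. (1 + x) / 2) has_real_derivative 1/2) (at x)"
      by (auto intro!: derivative_eq_intros)
    show "(f has_real_derivative f1 x / 2) (at x)"
      using DERIV_chain2[OF lincomb_has_real_derivative(1)[OF st z, of k A B] *] unfolding f_def f1_def by simp
    show "(f1 has_real_derivative f2 x / 2) (at x)"
      using DERIV_chain2[OF lincomb_has_real_derivative(2)[OF st z, of k A B] *] unfolding f1_def f2_def by simp
  qed
  have N0: "N x = 0" if xx: "-1 < x" "x < 1" for x
  proof (rule linear_ode_zero[where y = N and w = 0 and a = "\<lambda>x. - (2 * x + m x + \<psi> x / 2) / (1 - x\<^sup>2)"])
    fix x :: real assume xx: "-1 < x" "x < 1"
    note om = om[OF xx]
    have ode: "(1 - x\<^sup>2) * f2 x = 4 * k * f x - 2 * m x * f1 x"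
    proof -
      have "(1 + x) / 2 * (1 - (1 + x) / 2) = (1 - x\<^sup>2) / 4" "(1 + s) - (2 + s + t) * ((1 + x) / 2) = m x / 2"
        by (simp_all add: m_def power2_eq_square field_simps)
      moreover have "(1 + x) / 2 * (1 - (1 + x) / 2) * f2 x = k * f x - ((1 + s) - (2 + s + t) * ((1 + x) / 2)) * f1 x"
        unfolding f_def f1_def f2_def using xx by (intro lincomb_ode st) auto
      ultimately have "(1 - x\<^sup>2) / 4 * f2 x = k * f x - m x / 2 * f1 x"
        by (simp only:)
      then show ?thesis by simp
    qed
    have V1: "(1 - x\<^sup>2) * V' x = Pc c x - 2 * x * V x - (V x)\<^sup>2 / 2"
      using om by (simp add: V'_def)
    \<comment> \<open>\<open>V' x + (s + t + 2)\<close> is the derivative of \<psi>, since m has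
      slope -(s+t+2).\<close>
    have \<psi>1: "(1 - x\<^sup>2) * (V' x + (s + t + 2)) = 2 * k * (1 - x\<^sup>2) - (\<psi> x)\<^sup>2 / 2 - m x * \<psi> x - 2 * x * \<psi> x"
      unfolding distrib_left V1 Pc_eq by (simp add: \<psi>_def m_def power2_eq_square field_simps)
    let ?d = "- 2 * x * f1 x + (1 - x\<^sup>2) * (f2 x / 2) - ((V' x + (s + t + 2)) * f x + \<psi> x * (f1 x / 2))"
    have "(N has_real_derivative ?d) (at x)"
      unfolding N_def \<psi>_def m_def
      by (rule derivative_eq_intros D[OF xx] dV[OF xx] refl)+ (simp add: algebra_simps)
    moreover have "?d = - (2 * x + m x + \<psi> x / 2) / (1 - x\<^sup>2) * N x"
    proof -
      have "(1 - x\<^sup>2) * ?d = - 2 * x * (1 - x\<^sup>2) * f1 x + (1 - x\<^sup>2) * ((1 - x\<^sup>2) * f2 x) / 2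
          - ((1 - x\<^sup>2) * (V' x + (s + t + 2)) * f x + (1 - x\<^sup>2) * \<psi> x * f1 x / 2)"
        by (simp add: field_simps power2_eq_square)
      also have "\<dots> = - (2 * x + m x + \<psi> x / 2) * N x"
        unfolding ode \<psi>1 N_def by (simp add: field_simps power2_eq_square)
      finally show ?thesis
        using om by (simp add: eq_divide_eq mult.commute)
    qed
    ultimately show "(N has_real_derivative - (2 * x + m x + \<psi> x / 2) / (1 - x\<^sup>2) * N x) (at x)" by simp
  next
    show "continuous_on {-1<..<1} (\<lambda>x. - (2 * x + m x + \<psi> x / 2) / (1 - x\<^sup>2))"
      unfolding \<psi>_def m_def using om contV by (intro continuous_intros) force+
    show "N 0 = 0"
      by (simp add: N_def f1_def f_def \<psi>_def m_def lincomb_def lincomb1_def A_def B_def algebra_simps)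
  qed (use xx in auto)
  have f0: "f 0 > 0"
  proof -
    have "f 0 = g1 (1/2) * u (1/2) + u1 (1/2) * g (1/2)"
      by (simp add: f_def lincomb_def A_def B_def algebra_simps)
    then show ?thesis using pos by (auto intro!: add_pos_pos mult_pos_pos)
  qed
  have nz: "f x \<noteq> 0" if xx: "-1 < x" "x < 1" for x
  proof
    assume "f x = 0"
    have "f 0 = 0"
    proof (rule linear_ode_zero[where y = f and w = x and a = "\<lambda>x. \<psi> x / (2 * (1 - x\<^sup>2))"])
      fix y :: real assume y: "-1 < y" "y < 1"
      have "f1 y / 2 = \<psi> y / (2 * (1 - y\<^sup>2)) * f y"
        using N0[OF y] om[OF y] by (simp add: N_def field_simps)
      then show "(f has_real_derivative \<psi> y / (2 * (1 - y\<^sup>2)) * f y) (at y)"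
        using D(1)[OF y] by (simp only:)
    next
      show "continuous_on {-1<..<1} (\<lambda>x. \<psi> x / (2 * (1 - x\<^sup>2)))"
        unfolding \<psi>_def m_def using om contV by (intro continuous_intros) force+
    qed (use xx \<open>f x = 0\<close> in auto)
    then show False using f0 by simp
  qed
  have "continuous_on {-1<..<1} f"
    by (intro continuous_at_imp_continuous_on ballI DERIV_isCont[OF D(1)]) auto
  then have conn: "connected (f ` {-1<..<1})"
    by (intro connected_continuous_image) auto
  have "f x > 0"
  proof (rule ccontr)
    assume "\<not> f x > 0"
    then have "0 \<in> f ` {-1<..<1}"
      using connectedD_interval[OF conn, of "f x" "f 0" 0] f0 x by auto
    then show False using nz by auto
  qed
  then show "lincomb s t k A B ((1 + x) / 2) > 0" by (simp add: f_def)
  have "V x = m x + (1 - x\<^sup>2) * (f1 x / f x)"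
    using N0[OF x] nz[OF x] by (simp add: N_def \<psi>_def field_simps)
  also have "\<dots> = riccati_U s t k A B ((1 + x) / 2)"
    by (simp add: riccati_U_midpoint_form f1_def f_def m_def)
  finally show "V x = riccati_U s t k A B ((1 + x) / 2)" .
qed

text \<open>The representation in \<open>sol_eq_riccati_U\<close> depends on a solution only through
  its value at 0, so the definite description is well defined.\<close>

lemma Usol_eq:
  assumes "is_sol c U" "-1 < x" "x < 1"
  shows "Usol c (U 0) x = U x"
  unfolding Usol_def
proof (rule the_equality)
  fix y assume "\<exists>V. is_sol c V \<and> V 0 = U 0 \<and> V x = y"
  then show "y = U x"
    using sol_eq_riccati_U(2)[OF _ assms(2,3)] assms(1) by metis
qed (use assms in blast)

end

text \<open>As z tends to 1 the first series diverges, while the second is evaluated at arguments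
  near 0 and stays bounded; a negative A would therefore decide the sign of f.\<close>

lemma lincomb_pos_imp_nonneg:
  fixes s t k :: real
  assumes st: "s \<ge> 0" "t \<ge> 0" "k > 0" and pos: "\<And>z. 0 < z \<Longrightarrow> z < 1 \<Longrightarrow> lincomb s t k A B z > 0"
  shows "A \<ge> 0"
proof (rule ccontr)
  assume "\<not> A \<ge> 0"
  then have A: "A < 0" by simp
  \<comment> \<open>Once u reaches X, the term A u outweighs B g(1-z), because g is increasing and
    1-z < 1/2.\<close>
  define X where "X = \<bar>B\<bar> * hyp 0 t s k (1/2) / - A"
  obtain z0 where z0: "z0 \<in> {0..<1}" "\<And>z. z \<in> {z0..<1} \<Longrightarrow> hyp 0 s t k z \<ge> X"
    using hyp_at_top[OF st] by blast
  define z where "z = max z0 (3/4)"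
  have z: "z0 \<le> z" "z < 1" "1/2 < z" using z0 by (auto simp: z_def)
  have "hyp 0 t s k (1 - z) \<le> hyp 0 t s k (1/2)"
  proof (rule DERIV_nonneg_imp_nondecreasing[of "1 - z" "1/2" "hyp 0 t s k"])
    fix w assume "1 - z \<le> w" "w \<le> 1/2"
    then have "(hyp 0 t s k has_real_derivative hyp (Suc 0) t s k w) (at w)" "hyp (Suc 0) t s k w \<ge> 0"
      using z st by (auto intro!: hyp_has_real_derivative less_imp_le[OF hyp_pos])
    then show "\<exists>y. (hyp 0 t s k has_real_derivative y) (at w) \<and> 0 \<le> y" by blast
  qed (use z in auto)
  moreover have "hyp 0 t s k (1 - z) > 0" using z st by (intro hyp_pos) auto
  ultimately have "B * hyp 0 t s k (1 - z) \<le> \<bar>B\<bar> * hyp 0 t s k (1/2)"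
    by (intro mult_mono) auto
  moreover have "A * hyp 0 s t k z \<le> A * X"
    using A z0(2)[of z] z by (intro mult_left_mono_neg) auto
  moreover have "A * X = - (\<bar>B\<bar> * hyp 0 t s k (1/2))"
    using A by (simp add: X_def)
  ultimately have "lincomb s t k A B z \<le> 0"
    by (simp add: lincomb_def)
  then show False using pos[of z] z by simp
qed

section \<open>Nonnegative coefficients, the two extremal solutions, and formulas for gamma^+ and
  gamma^-\<close>

context riccati_params
begin

lemma sol_coef_nonneg:
  assumes "is_sol c V"
  shows "Acoef (V 0) \<ge> 0" "Bcoef (V 0) \<ge> 0"
proof -
  have pos: "lincomb s t k (Acoef (V 0)) (Bcoef (V 0)) z > 0" if "0 < z" "z < 1" for z
    using sol_eq_riccati_U(1)[OF assms, of "2 * z - 1"] that by simp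
  show "Acoef (V 0) \<ge> 0"
    using lincomb_pos_imp_nonneg[OF st k, of "Acoef (V 0)" "Bcoef (V 0)"] pos by blast
  show "Bcoef (V 0) \<ge> 0"
  proof (rule lincomb_pos_imp_nonneg[OF st(2,1) k])
    fix z :: real assume "0 < z" "z < 1"
    then show "lincomb t s k (Bcoef (V 0)) (Acoef (V 0)) z > 0"
      using pos[of "1 - z"] by (subst lincomb_swap) auto
  qed
qed

lemma lincomb_pos:
  assumes "A \<ge> 0" "B \<ge> 0" "A + B > 0" "0 < z" "z < 1"
  shows "lincomb s t k A B z > 0"
proof -
  have "hyp 0 s t k z > 0" "hyp 0 t s k (1 - z) > 0"
    using assms pos by auto
  then show ?thesis
    using assms unfolding lincomb_def
    by (metis add_nonneg_pos add_pos_nonneg add_cancel_right_left less_eq_real_def mult_nonneg_nonneg mult_pos_pos)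
qed

text \<open>f'/f is a weighted mean of u'/u and -g1/g with nonnegative weights. After clearing
  denominators the two differences are B and A times the same positive expression, the Wronskian up
  to sign.\<close>

lemma riccati_U_le:
  assumes "A \<ge> 0" "B \<ge> 0" "A + B > 0" "0 < z" "z < 1"
  shows "riccati_U s t k A B z \<le> riccati_U s t k 1 0 z" "riccati_U s t k 0 1 z \<le> riccati_U s t k A B z"
proof -
  have P: "u z > 0" "u1 z > 0" "g (1 - z) > 0" "g1 (1 - z) > 0"
    using assms pos by auto
  have f: "lincomb s t k A B z > 0" by (rule lincomb_pos[OF assms])
  have "lincomb1 s t k A B z / lincomb s t k A B z \<le> u1 z / u z"
  proof -
    have "lincomb1 s t k A B z * u z \<le> u1 z * lincomb s t k A B z"
    proof -
      have "0 \<le> B * (g1 (1 - z) * u z + u1 z * g (1 - z))"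
        using P assms by (intro mult_nonneg_nonneg add_nonneg_nonneg) auto
      then show ?thesis by (simp add: lincomb_def lincomb1_def algebra_simps)
    qed
    then show ?thesis using P f by (simp add: divide_le_eq le_divide_eq mult.commute)
  qed
  moreover have "- g1 (1 - z) / g (1 - z) \<le> lincomb1 s t k A B z / lincomb s t k A B z"
  proof -
    have "- g1 (1 - z) * lincomb s t k A B z \<le> lincomb1 s t k A B z * g (1 - z)"
    proof -
      have "0 \<le> A * (g1 (1 - z) * u z + u1 z * g (1 - z))"
        using P assms by (intro mult_nonneg_nonneg add_nonneg_nonneg) auto
      then show ?thesis by (simp add: lincomb_def lincomb1_def algebra_simps)
    qed
    then have "0 \<le> (lincomb1 s t k A B z * g (1 - z) + g1 (1 - z) * lincomb s t k A B z) / (lincomb s t k A B z * g (1 - z))"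
      using P f by (intro divide_nonneg_pos mult_pos_pos) auto
    also have "\<dots> = lincomb1 s t k A B z / lincomb s t k A B z - (- g1 (1 - z) / g (1 - z))"
      using P f by (simp add: add_divide_distrib)
    finally show ?thesis by simp
  qed
  ultimately have "4 * z * (1 - z) * (lincomb1 s t k A B z / lincomb s t k A B z) \<le> 4 * z * (1 - z) * (u1 z / u z)"
    "4 * z * (1 - z) * (- g1 (1 - z) / g (1 - z)) \<le> 4 * z * (1 - z) * (lincomb1 s t k A B z / lincomb s t k A B z)"
    using assms by (intro mult_left_mono; simp)+
  then show "riccati_U s t k A B z \<le> riccati_U s t k 1 0 z" "riccati_U s t k 0 1 z \<le> riccati_U s t k A B z"
    unfolding riccati_U_def lincomb_def[of _ _ _ 1 0] lincomb_def[of _ _ _ 0 1] lincomb1_def[of _ _ _ 1 0] lincomb1_def[of _ _ _ 0 1]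
    by simp_all
qed

text \<open>A u + B g at z = 1/2 is the positive number u g1 + u1 g for every \<gamma>, so A and B
  cannot vanish together.\<close>

lemma Acoef_Bcoef_pos: "Acoef \<gamma> \<ge> 0 \<Longrightarrow> Bcoef \<gamma> \<ge> 0 \<Longrightarrow> Acoef \<gamma> + Bcoef \<gamma> > 0"
proof -
  have "Acoef \<gamma> * u (1/2) + Bcoef \<gamma> * g (1/2) = g1 (1/2) * u (1/2) + u1 (1/2) * g (1/2)"
    by (simp add: algebra_simps)
  also have "\<dots> > 0" using pos by (auto intro!: add_pos_pos mult_pos_pos)
  finally have "Acoef \<gamma> \<noteq> 0 \<or> Bcoef \<gamma> \<noteq> 0" by (metis add_0 less_irrefl mult_zero_left)
  then show "Acoef \<gamma> \<ge> 0 \<Longrightarrow> Bcoef \<gamma> \<ge> 0 \<Longrightarrow> ?thesis" by linarith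
qed

lemma extremal_sols: "is_sol c (\<lambda>x. riccati_U s t k 1 0 ((1 + x) / 2))" "is_sol c (\<lambda>x. riccati_U s t k 0 1 ((1 + x) / 2))"
  by (intro riccati_U_is_sol; use lincomb_pos[of 1 0] lincomb_pos[of 0 1] in force)+

lemma sol_between:
  assumes "is_sol c V" "-1 < x" "x < 1"
  shows "V x \<le> riccati_U s t k 1 0 ((1 + x) / 2)" "riccati_U s t k 0 1 ((1 + x) / 2) \<le> V x"
  using sol_eq_riccati_U(2)[OF assms] riccati_U_le[OF sol_coef_nonneg[OF assms(1)] Acoef_Bcoef_pos[OF sol_coef_nonneg[OF assms(1)]]] assms
  by auto

text \<open>The definite description is resolved by mutual comparison: any largest solution and the
  one with B = 0 bound each other at 0.\<close>

lemma gamma_plus_eq: "gamma_plus c = s - t + u1 (1/2) / u (1/2)"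
proof -
  have "gamma_plus c = riccati_U s t k 1 0 ((1 + 0) / 2)"
    unfolding gamma_plus_def
  proof (rule the_equality)
    show "\<exists>U. is_sol c U \<and> (\<forall>V. is_sol c V \<longrightarrow> (\<forall>x. -1 < x \<and> x < 1 \<longrightarrow> V x \<le> U x)) \<and> U 0 = riccati_U s t k 1 0 ((1 + 0) / 2)"
      using extremal_sols(1) sol_between(1) by (intro exI[of _ "\<lambda>x. riccati_U s t k 1 0 ((1 + x) / 2)"]) auto
    fix y assume "\<exists>U. is_sol c U \<and> (\<forall>V. is_sol c V \<longrightarrow> (\<forall>x. -1 < x \<and> x < 1 \<longrightarrow> V x \<le> U x)) \<and> U 0 = y"
    then obtain U where U: "is_sol c U" "\<And>V x. is_sol c V \<Longrightarrow> -1 < x \<Longrightarrow> x < 1 \<Longrightarrow> V x \<le> U x" "U 0 = y"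
      by blast
    show "y = riccati_U s t k 1 0 ((1 + 0) / 2)"
      using U(2)[OF extremal_sols(1), of 0] sol_between(1)[OF U(1), of 0] U(3) by simp
  qed
  then show ?thesis by (simp add: riccati_U_half lincomb_def lincomb1_def)
qed

lemma gamma_minus_eq: "gamma_minus c = s - t - g1 (1/2) / g (1/2)"
proof -
  have "gamma_minus c = riccati_U s t k 0 1 ((1 + 0) / 2)"
    unfolding gamma_minus_def
  proof (rule the_equality)
    show "\<exists>U. is_sol c U \<and> (\<forall>V. is_sol c V \<longrightarrow> (\<forall>x. -1 < x \<and> x < 1 \<longrightarrow> U x \<le> V x)) \<and> U 0 = riccati_U s t k 0 1 ((1 + 0) / 2)"
      using extremal_sols(2) sol_between(2) by (intro exI[of _ "\<lambda>x. riccati_U s t k 0 1 ((1 + x) / 2)"]) auto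
    fix y assume "\<exists>U. is_sol c U \<and> (\<forall>V. is_sol c V \<longrightarrow> (\<forall>x. -1 < x \<and> x < 1 \<longrightarrow> U x \<le> V x)) \<and> U 0 = y"
    then obtain U where U: "is_sol c U" "\<And>V x. is_sol c V \<Longrightarrow> -1 < x \<Longrightarrow> x < 1 \<Longrightarrow> U x \<le> V x" "U 0 = y"
      by blast
    show "y = riccati_U s t k 0 1 ((1 + 0) / 2)"
      using U(2)[OF extremal_sols(2), of 0] sol_between(2)[OF U(1), of 0] U(3) by simp
  qed
  then show ?thesis by (simp add: riccati_U_half lincomb_def lincomb1_def)
qed

text \<open>A increases and B decreases in \<gamma>, and by the two formulas above they vanish
  exactly at gamma^- and gamma^+.\<close>

lemma coef_pos_iff: "Acoef \<gamma> > 0 \<longleftrightarrow> gamma_minus c < \<gamma>" "Bcoef \<gamma> > 0 \<longleftrightarrow> \<gamma> < gamma_plus c"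
  using pos(1)[of "1/2" 0] pos(2)[of "1/2" 0]
  unfolding gamma_plus_eq gamma_minus_eq by (auto simp: field_simps)

lemma Usol_gamma_plus: "-1 < x \<Longrightarrow> x < 1 \<Longrightarrow> Usol c (gamma_plus c) x = riccati_U s t k 1 0 ((1 + x) / 2)"
  using Usol_eq[OF extremal_sols(1), of x] by (simp add: gamma_plus_eq riccati_U_half lincomb_def[of _ _ _ _ _ "1/2"] lincomb1_def[of _ _ _ _ _ "1/2"])

lemma Usol_gamma_minus: "-1 < x \<Longrightarrow> x < 1 \<Longrightarrow> Usol c (gamma_minus c) x = riccati_U s t k 0 1 ((1 + x) / 2)"
  using Usol_eq[OF extremal_sols(2), of x] by (simp add: gamma_minus_eq riccati_U_half lincomb_def[of _ _ _ _ _ "1/2"] lincomb1_def[of _ _ _ _ _ "1/2"])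

lemma Usol_between:
  assumes "Acoef \<gamma> > 0" "Bcoef \<gamma> > 0" "-1 < x" "x < 1"
  shows "Usol c \<gamma> x = riccati_U s t k (Acoef \<gamma>) (Bcoef \<gamma>) ((1 + x) / 2)"
proof -
  define U where "U x = riccati_U s t k (Acoef \<gamma>) (Bcoef \<gamma>) ((1 + x) / 2)" for x
  have "is_sol c U"
    unfolding U_def using assms lincomb_pos[of "Acoef \<gamma>" "Bcoef \<gamma>"] by (intro riccati_U_is_sol) force
  moreover have "U 0 = \<gamma>"
  proof -
    define D where "D = g1 (1/2) * u (1/2) + u1 (1/2) * g (1/2)"
    have "D > 0" unfolding D_def using pos by (auto intro!: add_pos_pos mult_pos_pos)
    moreover have "lincomb s t k (Acoef \<gamma>) (Bcoef \<gamma>) (1/2) = D"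
      "lincomb1 s t k (Acoef \<gamma>) (Bcoef \<gamma>) (1/2) = (\<gamma> - s + t) * D"
      by (simp_all add: lincomb_def lincomb1_def D_def algebra_simps)
    ultimately show ?thesis by (simp add: U_def riccati_U_half)
  qed
  ultimately show ?thesis
    using Usol_eq[of U x] assms by (simp add: U_def)
qed

end

lemma riccati_paramsI:
  fixes c :: "real^3"
  assumes "c$1 \<ge> -1" "c$2 \<ge> -1" "c$3 > cbar3 (c$1) (c$2)"
  shows "riccati_params c (sqrt (1 + c$1)) (sqrt (1 + c$2)) ((c$3 - cbar3 (c$1) (c$2)) / 2)"
  using assms by unfold_locales (auto simp: cbar3_def field_simps)

section \<open>The Wronskian\<close>

text \<open>The negative of the usual Wronskian of u and z -> g(1-z); with this sign both terms are
  positive for real parameters in question.\<close>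

definition wronskian :: "complex \<Rightarrow> complex \<Rightarrow> complex \<Rightarrow> complex \<Rightarrow> complex" where
  "wronskian s t k z = hyp 0 s t k z * hyp 1 t s k (1 - z) + hyp 1 s t k z * hyp 0 t s k (1 - z)"

definition wronskian_const :: "complex \<Rightarrow> complex \<Rightarrow> complex \<Rightarrow> complex" where
  "wronskian_const s t k = wronskian s t k (1/2) * (1/2) powr (2 + s + t)"

text \<open>The factor of z (g/u)' that is regular at z = 0. It equals 1 there, which isolates the
  leading behaviour z^(-s).\<close>

definition ratio_factor :: "complex \<Rightarrow> complex \<Rightarrow> complex \<Rightarrow> complex \<Rightarrow> complex" where
  "ratio_factor s t k z = (1 - z) powr (-1 - t) / (hyp 0 s t k z)\<^sup>2"

lemma hyp_reflect_deriv:
  fixes s t k z :: complex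
  assumes "Re t \<ge> -1/2" "norm (1 - z) < 1"
  shows "((\<lambda>z. hyp j t s k (1 - z)) has_field_derivative - hyp (Suc j) t s k (1 - z)) (at z)"
proof -
  have "((\<lambda>z. 1 - z) has_field_derivative -1) (at z)"
    by (auto intro!: derivative_eq_intros)
  from DERIV_chain2[OF hyp_has_field_derivative[OF assms] this] show ?thesis by simp
qed

text \<open>Abel's formula: the derivative of the product vanishes by the two hypergeometric
  equations. Both series converge on the lens |z| < 1, |1-z| < 1, which is convex and contains 1/2,
  where the constant is read off.\<close>

lemma wronskian_times_powr:
  assumes st: "Re s \<ge> -1/2" "Re t \<ge> -1/2" and z: "norm z < 1" "norm (1 - z) < 1"
  shows "wronskian s t k z * (z powr (1 + s) * (1 - z) powr (1 + t)) = wronskian_const s t k"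
proof -
  define S where "S = ball (0::complex) 1 \<inter> ball 1 1"
  define F where "F z = wronskian s t k z * (z powr (1 + s) * (1 - z) powr (1 + t))" for z
  have inS: "w \<in> S \<longleftrightarrow> norm w < 1 \<and> norm (1 - w) < 1" for w
    by (auto simp: S_def dist_norm)
  have "(F has_field_derivative 0) (at w within S)" if "w \<in> S" for w
  proof -
    have w: "norm w < 1" "norm (1 - w) < 1" using that inS by auto
    have Rew: "Re w > 0" "Re w < 1"
      using w complex_Re_le_cmod[of "1 - w"] complex_Re_le_cmod[of w] by auto
    have nz: "w \<noteq> 0" "1 - w \<noteq> 0" and nr: "w \<notin> \<real>\<^sub>\<le>\<^sub>0" "1 - w \<notin> \<real>\<^sub>\<le>\<^sub>0"
      using Rew by (auto simp: complex_nonpos_Reals_iff)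
    define p where "p = (1 + s) * (1 - w) - (1 + t) * w"
    define u u1 u2 where "u = hyp 0 s t k w" "u1 = hyp 1 s t k w" "u2 = hyp 2 s t k w"
    define g g1 g2 where "g = hyp 0 t s k (1 - w)" "g1 = hyp 1 t s k (1 - w)" "g2 = hyp 2 t s k (1 - w)"
    have ou: "w * (1 - w) * u2 = k * u - p * u1"
      using hyp_ode[OF st(1) w(1), of t k] by (simp add: u_u1_u2_def p_def algebra_simps)
    have og: "w * (1 - w) * g2 = k * g + p * g1"
      using hyp_ode[OF st(2) w(2), of s k] by (simp add: g_g1_g2_def p_def algebra_simps)
    have dXi: "(wronskian s t k has_field_derivative u2 * g - u * g2) (at w)"
    proof -
      have "((\<lambda>z. hyp 0 s t k z * hyp 1 t s k (1 - z) + hyp 1 s t k z * hyp 0 t s k (1 - z)) has_field_derivative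
         (u1 * g1 + (- g2) * u) + (u2 * g + (- g1) * u1)) (at w)"
        using DERIV_add[OF DERIV_mult'[OF hyp_has_field_derivative[OF st(1) w(1), of 0 t k] hyp_reflect_deriv[OF st(2) w(2), of 1 s k]]
           DERIV_mult'[OF hyp_has_field_derivative[OF st(1) w(1), of 1 t k] hyp_reflect_deriv[OF st(2) w(2), of 0 s k]]]
        unfolding u_u1_u2_def g_g1_g2_def by (simp add: numeral_2_eq_2 algebra_simps)
      then show ?thesis unfolding wronskian_def[abs_def] by (simp add: algebra_simps)
    qed
    have dp1: "((\<lambda>z. z powr (1 + s)) has_field_derivative (1 + s) * w powr s) (at w)"
      using has_field_derivative_powr[OF nr(1), of "1 + s"] by simp
    have dp2: "((\<lambda>z. (1 - z) powr (1 + t)) has_field_derivative (1 + t) * (1 - w) powr t * (-1)) (at w)"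
    proof -
      have "((\<lambda>z. 1 - z) has_field_derivative -1) (at w)" by (auto intro!: derivative_eq_intros)
      from DERIV_chain2[OF has_field_derivative_powr[OF nr(2), of "1 + t"] this] show ?thesis by simp
    qed
    have pw: "w powr (1 + s) = w * w powr s" "(1 - w) powr (1 + t) = (1 - w) * (1 - w) powr t"
      using nz by (simp_all add: powr_add)
    let ?e = "w powr s * (1 - w) powr t"
    have "(F has_field_derivative
       (u2 * g - u * g2) * (w powr (1 + s) * (1 - w) powr (1 + t)) +
       ((1 + s) * w powr s * (1 - w) powr (1 + t) + (1 + t) * (1 - w) powr t * (-1) * w powr (1 + s)) * wronskian s t k w) (at w)"
      unfolding F_def by (rule DERIV_mult[OF dXi DERIV_mult[OF dp1 dp2]])
    moreover have "(u2 * g - u * g2) * (w powr (1 + s) * (1 - w) powr (1 + t)) +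
       ((1 + s) * w powr s * (1 - w) powr (1 + t) + (1 + t) * (1 - w) powr t * (-1) * w powr (1 + s)) * wronskian s t k w
       = ?e * ((w * (1 - w) * u2) * g - u * (w * (1 - w) * g2) + p * (u * g1 + u1 * g))"
      unfolding pw p_def wronskian_def u_u1_u2_def[symmetric] g_g1_g2_def[symmetric] by (simp add: algebra_simps)
    moreover have "(w * (1 - w) * u2) * g - u * (w * (1 - w) * g2) + p * (u * g1 + u1 * g) = 0"
      unfolding ou og by (simp add: algebra_simps)
    ultimately show ?thesis
      by (simp add: has_field_derivative_at_within)
  qed
  moreover have "convex S" unfolding S_def by (intro convex_Int convex_ball)
  ultimately have "\<exists>c. \<forall>w\<in>S. F w = c"
    by (intro has_field_derivative_zero_constant)
  then obtain c where c: "\<And>w. w \<in> S \<Longrightarrow> F w = c"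
    by blast
  have "1/2 \<in> S" "z \<in> S" using z by (auto simp: inS)
  then have "F z = F (1/2)" using c by simp
  also have "\<dots> = wronskian_const s t k"
    unfolding F_def wronskian_const_def by (simp add: powr_add[symmetric] algebra_simps)
  finally show ?thesis by (simp add: F_def)
qed

lemma wronskian_eq_powr:
  assumes st: "Re s \<ge> -1/2" "Re t \<ge> -1/2" and z: "0 < z" "z < 1"
  defines "w \<equiv> complex_of_real z"
  shows "w * wronskian s t k w / (hyp 0 s t k w)\<^sup>2 = wronskian_const s t k * w powr (- s) * ratio_factor s t k w"
proof -
  have nz: "w \<noteq> 0" "1 - w \<noteq> 0" using z by (auto simp: w_def complex_eq_iff)
  have "1 - w = of_real (1 - z)" by (simp add: w_def)
  then have "norm w < 1" "norm (1 - w) < 1"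
    using z by (simp_all only: w_def norm_of_real)
  from wronskian_times_powr[OF st this, of k]
  have "wronskian s t k w * (w powr (1 + s) * (1 - w) powr (1 + t)) * (w powr (- s) * (1 - w) powr (-1 - t)) =
        wronskian_const s t k * (w powr (- s) * (1 - w) powr (-1 - t))" by simp
  moreover have "w powr (1 + s) * w powr (- s) = w"
    using nz by (simp flip: powr_add)
  moreover have "(1 - w) powr (1 + t) * (1 - w) powr (-1 - t) = 1"
    using nz by (simp flip: powr_add)
  ultimately have "w * wronskian s t k w = wronskian_const s t k * (w powr (- s) * (1 - w) powr (-1 - t))"
    by (metis (no_types, opaque_lifting) mult.assoc mult.commute mult.right_neutral)
  then show ?thesis by (simp add: ratio_factor_def)
qed

text \<open>Unlike in \<open>continuous_on_hyp\<close>, X need not be open: the series is continuous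
  on the open set of admissible quadruples and the rest is composition. The intended X are compact
  boxes.\<close>

lemma continuous_on_hyp':
  fixes s t k z :: "'q::metric_space \<Rightarrow> complex"
  assumes "continuous_on X s" "continuous_on X t" "continuous_on X k" "continuous_on X z"
    and "\<And>q. q \<in> X \<Longrightarrow> Re (s q) > -1/2 \<and> norm (z q) < 1"
  shows "continuous_on X (\<lambda>q. hyp j (s q) (t q) (k q) (z q))"
proof -
  define Y where "Y = {(s::complex,t::complex,k::complex,z::complex). Re s > -1/2 \<and> norm z < 1}"
  have Y: "Y = {w. Re w > -1/2} \<times> UNIV \<times> UNIV \<times> ball 0 1"
    by (auto simp: Y_def)
  have "open Y"
    unfolding Y by (intro open_Times open_halfspace_Re_gt) auto
  have "continuous_on Y (\<lambda>q. hyp j (fst q) (fst (snd q)) (fst (snd (snd q))) (snd (snd (snd q))))"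
    by (rule continuous_on_hyp[OF _ _ _ _ \<open>open Y\<close>]) (auto simp: Y_def intro!: continuous_intros)
  moreover have "continuous_on X (\<lambda>q. (s q, t q, k q, z q))"
    using assms by (intro continuous_on_Pair) auto
  ultimately have "continuous_on X (\<lambda>x. (\<lambda>q. hyp j (fst q) (fst (snd q)) (fst (snd (snd q))) (snd (snd (snd q)))) (s x, t x, k x, z x))"
    by (rule continuous_on_compose2) (use assms(5) in \<open>auto simp: Y_def\<close>)
  then show ?thesis by simp
qed

section \<open>Bounds on small closed boxes of complex parameters\<close>

lemma compact_norm_bound:
  fixes f :: "'a::topological_space \<Rightarrow> 'b::real_normed_vector"
  assumes "compact X" "continuous_on X f"
  obtains C where "C > 0" "\<And>x. x \<in> X \<Longrightarrow> norm (f x) \<le> C"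
  using compact_imp_bounded[OF compact_continuous_image[OF assms(2,1)]]
  unfolding bounded_pos by auto

definition pbox :: "real \<Rightarrow> real \<Rightarrow> real \<Rightarrow> real \<Rightarrow> (complex \<times> complex \<times> complex) set" where
  "pbox s0 t0 k0 r = cball (of_real s0) r \<times> cball (of_real t0) r \<times> cball (of_real k0) r"

lemma compact_pbox: "compact (pbox s0 t0 k0 r)"
  by (simp add: pbox_def compact_Times)

lemma pbox_Re:
  assumes "(s,t,k) \<in> pbox s0 t0 k0 r"
  shows "\<bar>Re s - s0\<bar> \<le> r" "\<bar>Re t - t0\<bar> \<le> r" "norm s \<le> \<bar>s0\<bar> + r"
  using assms abs_Re_le_cmod[of "s - of_real s0"] abs_Re_le_cmod[of "t - of_real t0"]
    norm_triangle_ineq[of "of_real s0" "s - of_real s0"]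
  by (auto simp: pbox_def dist_norm norm_minus_commute)

lemma pbox_Re_gt:
  assumes "(s,t,k) \<in> pbox s0 t0 k0 r" "r \<le> 1/4"
  shows "s0 \<ge> 0 \<Longrightarrow> Re s > -1/2" "t0 \<ge> 0 \<Longrightarrow> Re t > -1/2"
  using pbox_Re(1,2)[OF assms(1)] assms(2) unfolding abs_le_iff by linarith+

lemma pbox_mono: "r \<le> r' \<Longrightarrow> pbox s0 t0 k0 r \<subseteq> pbox s0 t0 k0 r'"
  by (auto simp: pbox_def)

lemma dist_Pair_le: "dist (a, b) (c, d) \<le> dist a c + dist b d"
  unfolding dist_Pair_Pair by (rule sqrt_sum_squares_le_sum) auto

text \<open>At the real centre all terms of the Wronskian are positive, so the constant is nonzero
  there and, by continuity, on a smaller box. The lower bound a is what later prevents A + B g/u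
  from vanishing near z = 0.\<close>

lemma wronskian_const_bounds:
  fixes s0 t0 k0 :: real
  assumes "s0 \<ge> 0" "t0 \<ge> 0" "k0 > 0"
  obtains r a b where "0 < r" "r \<le> 1/4" "0 < a" "0 < b"
    "\<And>s t k. (s,t,k) \<in> pbox s0 t0 k0 r \<Longrightarrow> a \<le> norm (wronskian_const s t k) \<and> norm (wronskian_const s t k) \<le> b"
proof -
  define Q where "Q = pbox s0 t0 k0 (1/4)"
  have Re: "Re s > -1/2" "Re t > -1/2" if "(s,t,k) \<in> Q" for s t k
    using pbox_Re_gt[of s t k s0 t0 k0 "1/4"] that assms by (auto simp: Q_def)
  have cont: "continuous_on Q (\<lambda>p. wronskian_const (fst p) (fst (snd p)) (snd (snd p)))"
    unfolding wronskian_const_def wronskian_def powr_def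
    by (simp, intro continuous_intros continuous_on_hyp') (auto dest: Re)
  have "compact Q" by (simp add: Q_def compact_pbox)
  obtain b where b: "b > 0" "\<And>p. p \<in> Q \<Longrightarrow> norm (wronskian_const (fst p) (fst (snd p)) (snd (snd p))) \<le> b"
    using compact_norm_bound[OF \<open>compact Q\<close> cont] by blast
  define K where "K = norm (wronskian_const (of_real s0) (of_real t0) (of_real k0))"
  have "K > 0"
  proof -
    have "wronskian (of_real s0) (of_real t0) (of_real k0) (1/2) =
       of_real (hyp 0 s0 t0 k0 (1/2) * hyp 1 t0 s0 k0 (1/2) + hyp 1 s0 t0 k0 (1/2) * hyp 0 t0 s0 k0 (1/2))"
      using hyp_of_real[of s0 "1/2" _ t0 k0] hyp_of_real[of t0 "1/2" _ s0 k0] assms by (simp add: wronskian_def)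
    moreover have "hyp 0 s0 t0 k0 (1/2) * hyp 1 t0 s0 k0 (1/2) + hyp 1 s0 t0 k0 (1/2) * hyp 0 t0 s0 k0 (1/2) > 0"
      using assms by (intro add_pos_pos mult_pos_pos hyp_pos) auto
    ultimately have "wronskian (of_real s0) (of_real t0) (of_real k0) (1/2) \<noteq> 0"
      by (metis less_irrefl of_real_eq_0_iff)
    then show ?thesis unfolding K_def wronskian_const_def by simp
  qed
  have base: "(of_real s0, of_real t0, of_real k0) \<in> Q" by (simp add: Q_def pbox_def)
  have "\<exists>d>0. \<forall>p\<in>Q. dist p (of_real s0, of_real t0, of_real k0) < d \<longrightarrow>
     dist (wronskian_const (fst p) (fst (snd p)) (snd (snd p))) (wronskian_const (of_real s0) (of_real t0) (of_real k0)) < K / 2"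
    using cont[unfolded continuous_on_iff, rule_format, OF base, of "K / 2"] \<open>K > 0\<close> by simp
  then obtain d where d: "d > 0" "\<And>p. p \<in> Q \<Longrightarrow> dist p (of_real s0, of_real t0, of_real k0) < d \<Longrightarrow>
     dist (wronskian_const (fst p) (fst (snd p)) (snd (snd p))) (wronskian_const (of_real s0) (of_real t0) (of_real k0)) < K / 2"
    by blast
  \<comment> \<open>Three coordinates at distance at most r give 3r < d; r at most 1/4 keeps the
    real parts of s and t above -1/2.\<close>
  define r where "r = min (1/4) (d / 4)"
  show ?thesis
  proof (rule that[of r "K/2" b])
    fix s t k assume p: "(s,t,k) \<in> pbox s0 t0 k0 r"
    then have pQ: "(s,t,k) \<in> Q" using pbox_mono[of r "1/4" s0 t0 k0] unfolding Q_def r_def by (meson min.cobounded1 subsetD)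
    have "dist (s,t,k) (complex_of_real s0, complex_of_real t0, complex_of_real k0) \<le>
       dist s (of_real s0) + (dist t (of_real t0) + dist k (of_real k0))"
      by (intro order_trans[OF dist_Pair_le] add_mono order_refl dist_Pair_le)
    also have "\<dots> \<le> r + (r + r)" using p by (intro add_mono) (auto simp: pbox_def dist_commute)
    also have "\<dots> < d" using d by (auto simp: r_def)
    finally have "dist (wronskian_const s t k) (wronskian_const (of_real s0) (of_real t0) (of_real k0)) < K / 2"
      using d(2)[OF pQ] by simp
    then show "K / 2 \<le> norm (wronskian_const s t k) \<and> norm (wronskian_const s t k) \<le> b"
      using b(2)[OF pQ] norm_triangle_ineq2[of "wronskian_const (of_real s0) (of_real t0) (of_real k0)" "wronskian_const s t k"]
      by (auto simp: K_def dist_norm norm_minus_commute)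
  qed (use d b \<open>K > 0\<close> in \<open>auto simp: r_def\<close>)
qed

text \<open>What the endpoint analysis uses about the parameters: u away from 0, u' bounded, and the
  regular factor of z (g/u)' equal to 1 up to O(z).\<close>

definition tame :: "real \<Rightarrow> complex \<Rightarrow> complex \<Rightarrow> complex \<Rightarrow> real \<Rightarrow> bool" where
  "tame C s t k z \<longleftrightarrow> 1/2 \<le> norm (hyp 0 s t k (of_real z)) \<and> norm (hyp 1 s t k (of_real z)) \<le> C
     \<and> norm (ratio_factor s t k (of_real z) - 1) \<le> C * z"

text \<open>u and \<open>ratio_factor\<close> equal 1 at z = 0, and their derivatives are bounded on
  a compact set of parameters and arguments; the mean value inequality on the segment from 0 to z
  does the rest.\<close>

lemma tame_near_zero:
  fixes s0 t0 k0 :: real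
  assumes "s0 \<ge> 0" "t0 \<ge> 0"
  obtains C z1 where "0 < C" "0 < z1" "z1 \<le> 1/2"
    "\<And>s t k z. (s,t,k) \<in> pbox s0 t0 k0 (1/4) \<Longrightarrow> 0 \<le> z \<Longrightarrow> z \<le> z1 \<Longrightarrow> tame C s t k z"
proof -
  define Q where "Q = pbox s0 t0 k0 (1/4)"
  have Re: "Re s > -1/2" "Re t > -1/2" if "(s,t,k) \<in> Q" for s t k
    using pbox_Re_gt[of s t k s0 t0 k0 "1/4"] that assms by (auto simp: Q_def)
  have cQ: "compact (Q \<times> {0..z})" for z :: real
    by (simp add: Q_def compact_pbox compact_Times)
  have cH: "continuous_on (Q \<times> {0..1/2}) (\<lambda>(p,z). hyp j (fst p) (fst (snd p)) (snd (snd p)) (complex_of_real z))" for j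
    unfolding case_prod_unfold by (intro continuous_on_hyp' continuous_intros) (auto dest: Re)
  obtain C1 where C1: "C1 > 0" "\<And>s t k z. (s,t,k) \<in> Q \<Longrightarrow> 0 \<le> z \<Longrightarrow> z \<le> 1/2 \<Longrightarrow> norm (hyp 1 s t k (of_real z)) \<le> C1"
    using compact_norm_bound[OF cQ cH[of 1]] by (metis (mono_tags, lifting) SigmaI atLeastAtMost_iff case_prod_conv fst_conv snd_conv)
  have seg: "\<exists>w. x = complex_of_real w \<and> 0 \<le> w \<and> w \<le> z" if x: "x \<in> closed_segment 0 (complex_of_real z)" and z: "z \<ge> 0" for x z
  proof -
    obtain u where "0 \<le> u" "u \<le> 1" "x = complex_of_real (u * z)"
      using x by (auto simp: closed_segment_def scaleR_conv_of_real)
    then show ?thesis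
      using z by (intro exI[of _ "u * z"]) (auto simp: mult_left_le_one_le)
  qed
  \<comment> \<open>C1 z1 <= 1/2 keeps u within 1/2 of its value 1 at z = 0.\<close>
  define z1 where "z1 = min (1/2) (1 / (2 * C1))"
  have z1: "0 < z1" "z1 \<le> 1/2" "C1 * z1 \<le> 1/2"
    using C1(1) by (auto simp: z1_def min_def field_simps)
  have u1: "1/2 \<le> norm (hyp 0 s t k (of_real z))" if p: "(s,t,k) \<in> Q" and z: "0 \<le> z" "z \<le> z1" for s t k z
  proof -
    have "norm (hyp 0 s t k (of_real z) - hyp 0 s t k 0) \<le> C1 * norm (complex_of_real z - 0)"
    proof (rule field_differentiable_bound[where S = "closed_segment 0 (complex_of_real z)" and f' = "hyp 1 s t k"])
      fix x assume "x \<in> closed_segment 0 (complex_of_real z)"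
      then obtain w where w: "x = of_real w" "0 \<le> w" "w \<le> z" using seg z by blast
      have "(hyp 0 s t k has_field_derivative hyp (Suc 0) s t k x) (at x)"
        using Re[OF p] w z z1 by (intro hyp_has_field_derivative) auto
      then show "(hyp 0 s t k has_field_derivative hyp 1 s t k x) (at x within closed_segment 0 (complex_of_real z))"
        by (simp add: has_field_derivative_at_within)
      show "norm (hyp 1 s t k x) \<le> C1"
        using C1(2)[OF p, of w] w z z1 by simp
    qed auto
    also have "\<dots> \<le> C1 * z1" using z C1(1) by simp
    finally have "norm (hyp 0 s t k (of_real z) - 1) \<le> 1/2" using z1(3) by simp
    then show ?thesis
      using norm_triangle_ineq2[of 1 "1 - hyp 0 s t k (of_real z)"] by (simp add: norm_minus_commute)
  qed
  \<comment> \<open>The z-derivative of \<open>ratio_factor\<close>, by the quotient rule.\<close>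
  define dq where "dq s t k z = (1 + t) * (1 - z) powr (-2 - t) / (hyp 0 s t k z)\<^sup>2
     - 2 * (1 - z) powr (-1 - t) * hyp 1 s t k z / (hyp 0 s t k z) ^ 3" for s t k z :: complex
  have nr: "1 - complex_of_real z \<notin> \<real>\<^sub>\<le>\<^sub>0" "1 - complex_of_real z \<noteq> 0" if "z \<le> 1/2" for z
    using that by (auto simp: complex_nonpos_Reals_iff complex_eq_iff)
  have cdq: "continuous_on (Q \<times> {0..z1}) (\<lambda>(p,z). dq (fst p) (fst (snd p)) (snd (snd p)) (complex_of_real z))"
  proof -
    have cH': "continuous_on (Q \<times> {0..z1}) (\<lambda>x. hyp j (fst (fst x)) (fst (snd (fst x))) (snd (snd (fst x))) (complex_of_real (snd x)))" for j
      using cH[of j] z1 by (auto simp: case_prod_unfold intro: continuous_on_subset)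
    have "hyp 0 (fst (fst x)) (fst (snd (fst x))) (snd (snd (fst x))) (complex_of_real (snd x)) \<noteq> 0"
      if "x \<in> Q \<times> {0..z1}" for x
      using u1[of "fst (fst x)" "fst (snd (fst x))" "snd (snd (fst x))" "snd x"] that by force
    then have nzp: "(hyp 0 (fst (fst x)) (fst (snd (fst x))) (snd (snd (fst x))) (complex_of_real (snd x))) ^ n \<noteq> 0"
      if "x \<in> Q \<times> {0..z1}" for x n
      using that by simp
    have cp: "continuous_on (Q \<times> {0..z1}) (\<lambda>x. (1 - complex_of_real (snd x)) powr (a - fst (snd (fst x))))" for a
    proof (rule continuous_on_eq)
      show "continuous_on (Q \<times> {0..z1}) (\<lambda>x. exp ((a - fst (snd (fst x))) * Ln (1 - complex_of_real (snd x))))"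
        using nr(1) z1(2) by (intro continuous_intros) (auto dest: order_trans)
      show "exp ((a - fst (snd (fst x))) * Ln (1 - complex_of_real (snd x))) =
          (1 - complex_of_real (snd x)) powr (a - fst (snd (fst x)))" if "x \<in> Q \<times> {0..z1}" for x
        using nr(2)[of "snd x"] that z1 by (auto simp: powr_def)
    qed
    show ?thesis
      unfolding dq_def case_prod_unfold
      by (intro continuous_on_add continuous_on_diff continuous_on_mult continuous_on_divide continuous_on_power
          continuous_on_const continuous_on_fst continuous_on_snd continuous_on_id cp cH' nzp ballI)
  qed
  obtain C2 where C2: "C2 > 0" "\<And>s t k z. (s,t,k) \<in> Q \<Longrightarrow> 0 \<le> z \<Longrightarrow> z \<le> z1 \<Longrightarrow> norm (dq s t k (of_real z)) \<le> C2"
    using compact_norm_bound[OF cQ cdq] by (metis (mono_tags, lifting) SigmaI atLeastAtMost_iff case_prod_conv fst_conv snd_conv)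
  have q1: "norm (ratio_factor s t k (of_real z) - 1) \<le> C2 * z" if p: "(s,t,k) \<in> Q" and z: "0 \<le> z" "z \<le> z1" for s t k z
  proof -
    have "norm (ratio_factor s t k (of_real z) - ratio_factor s t k 0) \<le> C2 * norm (complex_of_real z - 0)"
    proof (rule field_differentiable_bound[where S = "closed_segment 0 (complex_of_real z)" and f' = "dq s t k"])
      fix x assume "x \<in> closed_segment 0 (complex_of_real z)"
      then obtain w where w: "x = of_real w" "0 \<le> w" "w \<le> z" using seg z by blast
      have dH: "(hyp 0 s t k has_field_derivative hyp 1 s t k x) (at x)"
        using hyp_has_field_derivative[of s x 0 t k] Re[OF p] w z z1 by simp
      have nz: "hyp 0 s t k x \<noteq> 0" using u1[OF p, of w] w z by auto
      have "w \<le> 1/2" using w z z1 by linarith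
      have "((\<lambda>z. 1 - z) has_field_derivative -1) (at x)" by (auto intro!: derivative_eq_intros)
      from DERIV_chain2[OF has_field_derivative_powr[OF nr(1)[OF \<open>w \<le> 1/2\<close>, folded w(1)]] this]
      have "((\<lambda>z. (1 - z) powr (-1 - t)) has_field_derivative (-1 - t) * (1 - x) powr (-1 - t - 1) * -1) (at x)" .
      moreover have "-1 - t - 1 = -2 - t" "(-1 - t) * y * -1 = (1 + t) * y" for y
        by (simp_all add: algebra_simps)
      ultimately have dp: "((\<lambda>z. (1 - z) powr (-1 - t)) has_field_derivative (1 + t) * (1 - x) powr (-2 - t)) (at x)"
        by (simp only:)
      have "(ratio_factor s t k has_field_derivative
         ((1 + t) * (1 - x) powr (-2 - t) * (hyp 0 s t k x)\<^sup>2 - (1 - x) powr (-1 - t) * (2 * hyp 0 s t k x * hyp 1 s t k x))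
           / ((hyp 0 s t k x)\<^sup>2 * (hyp 0 s t k x)\<^sup>2)) (at x)"
        unfolding ratio_factor_def[abs_def] using nz
        by (intro DERIV_divide[OF dp]) (auto intro!: derivative_eq_intros dH)
      moreover have "((1 + t) * (1 - x) powr (-2 - t) * (hyp 0 s t k x)\<^sup>2 - (1 - x) powr (-1 - t) * (2 * hyp 0 s t k x * hyp 1 s t k x))
           / ((hyp 0 s t k x)\<^sup>2 * (hyp 0 s t k x)\<^sup>2) = dq s t k x"
        unfolding dq_def using nz by (simp add: field_simps power2_eq_square power3_eq_cube)
      ultimately show "(ratio_factor s t k has_field_derivative dq s t k x) (at x within closed_segment 0 (complex_of_real z))"
        by (simp add: has_field_derivative_at_within)
      show "norm (dq s t k x) \<le> C2"
        using C2(2)[OF p, of w] w z z1 by simp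
    qed auto
    then show ?thesis using z by (simp add: ratio_factor_def)
  qed
  show ?thesis
  proof (rule that[of "C1 + C2" z1])
    fix s t k z assume p: "(s,t,k) \<in> pbox s0 t0 k0 (1/4)" and z: "0 \<le> z" "z \<le> z1"
    then have pQ: "(s,t,k) \<in> Q" by (simp add: Q_def)
    have "C2 * z \<le> (C1 + C2) * z" using C1(1) z by (intro mult_right_mono) auto
    then show "tame (C1 + C2) s t k z"
      using u1[OF pQ z] q1[OF pQ z] C1(2)[OF pQ, of z] z z1 C1(1) C2(1) by (auto simp: tame_def)
  qed (use C1 C2 z1 in auto)
qed

lemma reflected_hyp_bound:
  fixes s0 t0 k0 :: real
  assumes "t0 \<ge> 0" "0 < d" "d < 1"
  obtains C where "0 < C"
    "\<And>s t k. (s,t,k) \<in> pbox s0 t0 k0 (1/4) \<Longrightarrow> norm (hyp 0 t s k (1 - of_real d)) \<le> C"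
proof -
  have Re: "Re t > -1/2" if "(s,t,k) \<in> pbox s0 t0 k0 (1/4)" for s t k
    using pbox_Re_gt(2)[of s t k s0 t0 k0 "1/4"] that assms by auto
  have "1 - complex_of_real d = of_real (1 - d)" by simp
  then have "norm (1 - complex_of_real d) < 1"
    using assms by (simp only: norm_of_real)
  then have "continuous_on (pbox s0 t0 k0 (1/4)) (\<lambda>p. hyp 0 (fst (snd p)) (fst p) (snd (snd p)) (1 - complex_of_real d))"
    by (intro continuous_on_hyp' continuous_intros) (auto dest: Re)
  from compact_norm_bound[OF compact_pbox this] show ?thesis
    using that by (metis fst_conv snd_conv)
qed

section \<open>Logarithmic derivatives near the left endpoint\<close>

definition sol_ratio :: "complex \<Rightarrow> complex \<Rightarrow> complex \<Rightarrow> complex \<Rightarrow> complex" where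
  "sol_ratio s t k z = hyp 0 t s k (1 - z) / hyp 0 s t k z"

lemma of_real_unit_norms:
  assumes "0 < z" "z < 1"
  shows "norm (complex_of_real z) < 1" "norm (1 - complex_of_real z) < 1"
proof -
  have "1 - complex_of_real z = of_real (1 - z)" by simp
  then show "norm (complex_of_real z) < 1" "norm (1 - complex_of_real z) < 1"
    using assms by (simp_all only: norm_of_real)
qed

text \<open>The Wronskian turns the derivative of g/u into an expression free of g, so that g/u can
  be integrated from an interior point towards 0.\<close>

lemma sol_ratio_has_field_derivative:
  assumes st: "Re s \<ge> -1/2" "Re t \<ge> -1/2" and z: "0 < z" "z < 1"
    and u: "hyp 0 s t k (complex_of_real z) \<noteq> 0"
  shows "(sol_ratio s t k has_field_derivative
     - (wronskian_const s t k * complex_of_real z powr (- s) * ratio_factor s t k (of_real z)) / of_real z) (at (complex_of_real z))"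
proof -
  define w where "w = complex_of_real z"
  have w: "norm w < 1" "norm (1 - w) < 1" "w \<noteq> 0"
    using of_real_unit_norms[OF z] z by (auto simp: w_def)
  have "(sol_ratio s t k has_field_derivative
     (- hyp (Suc 0) t s k (1 - w) * hyp 0 s t k w - hyp 0 t s k (1 - w) * hyp (Suc 0) s t k w)
        / (hyp 0 s t k w * hyp 0 s t k w)) (at w)"
    unfolding sol_ratio_def[abs_def]
    by (rule DERIV_divide[OF hyp_reflect_deriv[OF st(2) w(2)] hyp_has_field_derivative[OF st(1) w(1)]])
      (use u in \<open>simp add: w_def\<close>)
  also have "(- hyp (Suc 0) t s k (1 - w) * hyp 0 s t k w - hyp 0 t s k (1 - w) * hyp (Suc 0) s t k w)
        / (hyp 0 s t k w * hyp 0 s t k w) = - (w * wronskian s t k w / (hyp 0 s t k w)\<^sup>2) / w"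
    using w u by (simp add: wronskian_def field_simps power2_eq_square w_def)
  also have "\<dots> = - (wronskian_const s t k * w powr (- s) * ratio_factor s t k w) / w"
    unfolding w_def wronskian_eq_powr[OF st z] ..
  finally show ?thesis by (simp add: w_def)
qed

text \<open>f'/f may blow up at z = 0, but U contains it only with the factor 4z(1-z); the product z
  f'/f stays bounded.\<close>

definition zlogderiv :: "complex \<Rightarrow> complex \<Rightarrow> complex \<Rightarrow> complex \<Rightarrow> complex \<Rightarrow> real \<Rightarrow> complex" where
  "zlogderiv s t k A B z = of_real z * (lincomb1 s t k A B (of_real z) / lincomb s t k A B (of_real z))"

text \<open>Since \<open>f = u (A + B G)\<close> with \<open>G = sol_ratio\<close>, the logarithmic derivative of \<open>f\<close> is that of \<open>u\<close>
  plus \<open>B G' / (A + B G)\<close>, and \<open>G'\<close> is explicit because the Wronskian is.\<close>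
lemma logderiv_eq:
  assumes st: "Re s \<ge> -1/2" "Re t \<ge> -1/2" and z: "0 < z" "z < 1"
    and u: "hyp 0 s t k (complex_of_real z) \<noteq> 0" and D: "A + B * sol_ratio s t k (of_real z) \<noteq> 0"
  defines "w \<equiv> complex_of_real z"
  shows "lincomb s t k A B w \<noteq> 0"
    and "zlogderiv s t k A B z = w * hyp 1 s t k w / hyp 0 s t k w
        - B * (wronskian_const s t k * w powr (- s) * ratio_factor s t k w) / (A + B * sol_ratio s t k w)"
proof -
  define a a1 b b1 where "a = hyp 0 s t k w" "a1 = hyp 1 s t k w" "b = hyp 0 t s k (1 - w)" "b1 = hyp 1 t s k (1 - w)"
  have a: "a \<noteq> 0" using u by (simp add: a_a1_b_b1_def w_def)
  have f: "lincomb s t k A B w = a * (A + B * sol_ratio s t k w)"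
    using a by (simp add: lincomb_def sol_ratio_def a_a1_b_b1_def algebra_simps)
  then show nz: "lincomb s t k A B w \<noteq> 0" using a D by (simp add: w_def)
  have "a * lincomb1 s t k A B w = a1 * lincomb s t k A B w - B * wronskian s t k w"
    by (simp add: lincomb_def lincomb1_def wronskian_def a_a1_b_b1_def algebra_simps)
  then have "lincomb1 s t k A B w / lincomb s t k A B w = a1 / a - B * wronskian s t k w / (a * lincomb s t k A B w)"
    using a nz by (simp add: field_simps)
  then have "w * (lincomb1 s t k A B w / lincomb s t k A B w) = w * (a1 / a - B * wronskian s t k w / (a * lincomb s t k A B w))"
    by (simp only:)
  also have "\<dots> = w * a1 / a - B * (w * wronskian s t k w / a\<^sup>2) / (A + B * sol_ratio s t k w)"
    unfolding f using a D by (simp add: field_simps power2_eq_square w_def)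
  finally show "zlogderiv s t k A B z = w * hyp 1 s t k w / hyp 0 s t k w
        - B * (wronskian_const s t k * w powr (- s) * ratio_factor s t k w) / (A + B * sol_ratio s t k w)"
    using wronskian_eq_powr[OF st z, of k] by (simp add: a_a1_b_b1_def w_def zlogderiv_def)
qed

text \<open>The majorant \<phi>' may vary along the segment, so singular bounds such as
  \<open>x powr (- \<rho> - 1)\<close> can be integrated.\<close>

lemma norm_diff_le_derivative_bound:
  fixes H :: "complex \<Rightarrow> complex" and \<phi> \<phi>' :: "real \<Rightarrow> real"
  assumes "0 < z" "z \<le> d"
    and H: "\<And>x. z \<le> x \<Longrightarrow> x \<le> d \<Longrightarrow> (H has_field_derivative H' x) (at (complex_of_real x))"
    and \<phi>: "\<And>x. z \<le> x \<Longrightarrow> x \<le> d \<Longrightarrow> (\<phi> has_real_derivative \<phi>' x) (at x)"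
    and le: "\<And>x. z \<le> x \<Longrightarrow> x \<le> d \<Longrightarrow> norm (H' x) \<le> \<phi>' x"
  shows "norm (H (of_real d) - H (of_real z)) \<le> \<phi> d - \<phi> z"
proof (cases "z = d")
  case False
  have H1: "((\<lambda>x. H (of_real x)) has_vector_derivative H' x) (at x)" if "z \<le> x" "x \<le> d" for x
    by (rule has_vector_derivative_real_field[OF H[OF that]])
  have \<phi>1: "(\<phi> has_vector_derivative \<phi>' x) (at x)" if "z \<le> x" "x \<le> d" for x
    using \<phi>[OF that] by (simp add: has_real_derivative_iff_has_vector_derivative)
  have "norm ((\<lambda>x. H (of_real x)) d - (\<lambda>x. H (of_real x)) z) \<le> \<phi> d - \<phi> z"
  proof (rule differentiable_bound_general[where f' = H' and \<phi>' = \<phi>'])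
    show "continuous_on {z..d} (\<lambda>x. H (of_real x))" "continuous_on {z..d} \<phi>"
      using has_vector_derivative_continuous[OF H1] has_vector_derivative_continuous[OF \<phi>1]
      by (auto intro!: continuous_at_imp_continuous_on)
  qed (use False assms H1 \<phi>1 in auto)
  then show ?thesis by simp
qed simp

text \<open>g/u is K z^(-s)/s plus a remainder H. Comparing derivatives, H grows at most like
  \<epsilon> y plus a constant, where y = z^(-Re s), while the leading term is at least 4 \<epsilon>
  y. Hence |A + B g/u| is at least a multiple of y, and the numerator in \<open>logderiv_eq\<close>
  is at most a multiple of y.\<close>

lemma near0_regular:
  fixes s0 t0 k0 A0 B0 :: real
  assumes pos: "s0 > 0" "t0 \<ge> 0" "k0 > 0" "B0 > 0"
  obtains r d C where "0 < r" "0 < d" "d \<le> 1/2" 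
    "\<And>s t k A B z. (s,t,k) \<in> pbox s0 t0 k0 r \<Longrightarrow> norm (A - of_real A0) \<le> r \<Longrightarrow> norm (B - of_real B0) \<le> r \<Longrightarrow>
       0 < z \<Longrightarrow> z \<le> d \<Longrightarrow> lincomb s t k A B (of_real z) \<noteq> 0 \<and>
       norm (zlogderiv s t k A B z) \<le> C"
proof -
  obtain r1 a b where ab: "0 < r1" "r1 \<le> 1/4" "0 < a" "0 < b"
    "\<And>s t k. (s,t,k) \<in> pbox s0 t0 k0 r1 \<Longrightarrow> a \<le> norm (wronskian_const s t k) \<and> norm (wronskian_const s t k) \<le> b"
    using wronskian_const_bounds[of s0 t0 k0] pos by (metis less_imp_le)
  obtain C z1 where C: "0 < C" "0 < z1" "z1 \<le> 1/2"
    "\<And>s t k z. (s,t,k) \<in> pbox s0 t0 k0 (1/4) \<Longrightarrow> 0 \<le> z \<Longrightarrow> z \<le> z1 \<Longrightarrow> tame C s t k z"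
    using tame_near_zero[of s0 t0 k0] pos by (metis less_imp_le)
  define r where "r = Min {r1, s0/2, B0/2, 1}"
  have r: "0 < r" "r \<le> r1" "r \<le> s0/2" "r \<le> B0/2" "r \<le> 1" "r \<le> 1/4"
    using ab pos by (auto simp: r_def)
  \<comment> \<open>\<rho>0 bounds Re s from below and S bounds |s| from above, so 4 \<epsilon> =
    a/S is a lower bound for |K/s|.\<close>
  define \<rho>0 S \<epsilon> where "\<rho>0 = s0/2" and "S = s0 + 1/4" and "\<epsilon> = a / (4 * (s0 + 1/4))"
  have c0: "\<rho>0 > 0" "S > 0" "\<epsilon> > 0" using pos ab by (auto simp: \<rho>0_def S_def \<epsilon>_def)
  \<comment> \<open>Up to z2 the deviation of K times \<open>ratio_factor\<close> from K is at most
    \<epsilon> \<rho>0, so the remainder grows with coefficient \<epsilon> only.\<close>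
  define z2 where "z2 = min z1 (\<epsilon> * \<rho>0 / (b * C))"
  have z2: "0 < z2" "z2 \<le> z1" "b * C * z2 \<le> \<epsilon> * \<rho>0"
    using C ab c0 by (auto simp: z2_def min_def field_simps)
  obtain Cg where Cg: "0 < Cg" "\<And>s t k. (s,t,k) \<in> pbox s0 t0 k0 (1/4) \<Longrightarrow> norm (hyp 0 t s k (1 - of_real z2)) \<le> Cg"
  proof (rule reflected_hyp_bound[of t0 z2 s0 k0])
    show "z2 < 1" using z2 C by linarith
  qed (use pos z2 in auto)
  \<comment> \<open>Bounds H at z2, the point from which it is integrated towards 0.\<close>
  define C4 where "C4 = 2 * Cg + b * z2 powr (-S) / \<rho>0"
  define C5 where "C5 = B0 / 2 * C4 + \<bar>A0\<bar> + 1"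
  have "b * z2 powr (-S) / \<rho>0 \<ge> 0" using ab c0 by simp
  then have C4: "C4 > 0" using Cg(1) unfolding C4_def by linarith
  then have "B0 / 2 * C4 \<ge> 0" using pos by simp
  then have C45: "C4 > 0" "C5 > 0" using C4 unfolding C5_def by linarith+
  \<comment> \<open>For z <= d one has C5 <= B0 \<epsilon> y, so all bounded contributions are
    absorbed and B0 \<epsilon> y / 2 remains as a lower bound.\<close>
  define d where "d = min z2 ((C5 / (B0 * \<epsilon>)) powr (-1 / \<rho>0))"
  have d: "0 < d" "d \<le> z2" using z2 C45 pos c0 by (auto simp: d_def)
  show ?thesis
  proof (rule that[of r d "C + 4 * b * (1 + C) / \<epsilon>"])
    show "d \<le> 1/2" using d z2 C by linarith
    fix s t k A B :: complex and z :: real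
    assume p: "(s,t,k) \<in> pbox s0 t0 k0 r" and A: "norm (A - of_real A0) \<le> r" and B: "norm (B - of_real B0) \<le> r"
      and z: "0 < z" "z \<le> d"
    have p1: "(s,t,k) \<in> pbox s0 t0 k0 r1" "(s,t,k) \<in> pbox s0 t0 k0 (1/4)"
      using p pbox_mono[of r r1 s0 t0 k0] pbox_mono[of r "1/4" s0 t0 k0] r by blast+
    have Rest: "Re s \<ge> -1/2" "Re t \<ge> -1/2"
      using pbox_Re_gt[OF p1(2)] pos by (auto intro: less_imp_le)
    define \<rho> where "\<rho> = Re s"
    have \<rho>: "\<rho>0 \<le> \<rho>" "\<rho> \<le> S" "norm s \<le> S" "s \<noteq> 0" "\<rho> \<le> norm s"
      using pbox_Re[OF p] pbox_Re[OF p1(2)] r pos complex_Re_le_cmod[of s] by (auto simp: \<rho>_def \<rho>0_def S_def abs_if split: if_splits)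
    define K where "K = wronskian_const s t k"
    have K: "a \<le> norm K" "norm K \<le> b" using ab(5)[OF p1(1)] by (auto simp: K_def)
    define H where "H w = sol_ratio s t k w - K * w powr (- s) / s" for w
    have npow: "norm (complex_of_real x powr (- s)) = x powr (- \<rho>)" if "x > 0" for x
      using that by (simp add: norm_powr_real_powr \<rho>_def)
    have u: "1/2 \<le> norm (hyp 0 s t k (of_real x))" "norm (hyp 1 s t k (of_real x)) \<le> C"
      "norm (ratio_factor s t k (of_real x) - 1) \<le> C * x" if "0 < x" "x \<le> z2" for x
      using C(4)[OF p1(2), of x] that z2 by (auto simp: tame_def)
    have unz: "hyp 0 s t k (of_real x) \<noteq> 0" if "0 < x" "x \<le> z2" for x
      using u(1)[OF that] by auto
    have dH: "(H has_field_derivative - K * complex_of_real x powr (- s) * (ratio_factor s t k (of_real x) - 1) / of_real x) (at (complex_of_real x))"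
      if x: "0 < x" "x \<le> z2" for x
    proof -
      have nr: "complex_of_real x \<notin> \<real>\<^sub>\<le>\<^sub>0" "complex_of_real x \<noteq> 0"
        using x by (auto simp: complex_nonpos_Reals_iff)
      have "x < 1" using x z2 C by linarith
      have "((\<lambda>w. K * w powr (- s) / s) has_field_derivative K * (- s * complex_of_real x powr (- s - 1)) / s) (at (of_real x))"
        by (intro DERIV_cdivide DERIV_cmult has_field_derivative_powr nr)
      from DERIV_diff[OF sol_ratio_has_field_derivative[OF Rest x(1) \<open>x < 1\<close> unz[OF x]] this]
      have "(H has_field_derivative - (wronskian_const s t k * complex_of_real x powr (- s) * ratio_factor s t k (of_real x)) / of_real x
          - K * (- s * complex_of_real x powr (- s - 1)) / s) (at (complex_of_real x))"
        unfolding H_def[abs_def] .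
      moreover have "complex_of_real x powr (- s - 1) = complex_of_real x powr (- s) / of_real x"
        using nr by (simp add: powr_diff)
      ultimately show ?thesis
        using \<rho>(4) by (simp add: K_def algebra_simps diff_divide_distrib)
    qed
    have Hz: "norm (H (of_real z2) - H (of_real z)) \<le> - \<epsilon> * z2 powr (- \<rho>) - (- \<epsilon> * z powr (- \<rho>))"
    proof (rule norm_diff_le_derivative_bound[where H = H])
      fix x assume x: "z \<le> x" "x \<le> z2"
      then have x0: "0 < x" using z by simp
      show "(H has_field_derivative - K * complex_of_real x powr (- s) * (ratio_factor s t k (of_real x) - 1) / of_real x) (at (complex_of_real x))"
        by (rule dH[OF x0 x(2)])
      show "((\<lambda>x. - \<epsilon> * x powr (- \<rho>)) has_real_derivative \<epsilon> * \<rho> * x powr (- \<rho> - 1)) (at x)"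
        using x0 by (auto intro!: derivative_eq_intros)
      have "norm (- K * complex_of_real x powr (- s) * (ratio_factor s t k (of_real x) - 1) / of_real x)
          = norm K * norm (ratio_factor s t k (of_real x) - 1) * (x powr (- \<rho>) / x)"
        using x0 by (simp add: norm_mult norm_divide npow)
      also have "\<dots> \<le> (\<epsilon> * \<rho>) * (x powr (- \<rho>) / x)"
      proof (rule mult_right_mono)
        have "norm K * norm (ratio_factor s t k (of_real x) - 1) \<le> b * (C * x)"
          using K u(3)[OF x0 x(2)] ab(4) by (intro mult_mono) auto
        also have "\<dots> \<le> b * C * z2" using x ab C by simp
        also have "\<dots> \<le> \<epsilon> * \<rho>0" by (rule z2)
        also have "\<dots> \<le> \<epsilon> * \<rho>" using c0 \<rho> by simp
        finally show "norm K * norm (ratio_factor s t k (of_real x) - 1) \<le> \<epsilon> * \<rho>" .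
      qed (use x0 in auto)
      also have "x powr (- \<rho>) / x = x powr (- \<rho> - 1)"
        using x0 by (simp add: powr_diff)
      finally show "norm (- K * complex_of_real x powr (- s) * (ratio_factor s t k (of_real x) - 1) / of_real x)
          \<le> \<epsilon> * \<rho> * x powr (- \<rho> - 1)" .
    qed (use z d in auto)
    have Hz2: "norm (H (of_real z2)) \<le> C4"
    proof -
      have "norm (sol_ratio s t k (of_real z2)) \<le> Cg / (1/2)"
        unfolding sol_ratio_def norm_divide using Cg(2)[OF p1(2)] u(1)[of z2] z2 Cg(1) by (intro frac_le) auto
      moreover have "norm (K * complex_of_real z2 powr (- s) / s) \<le> b * z2 powr (- S) / \<rho>0"
        unfolding norm_divide norm_mult npow[OF z2(1)]
      proof (intro frac_le mult_mono)
        show "z2 powr (- \<rho>) \<le> z2 powr (- S)"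
          using \<rho>(2) z2 C by (intro powr_mono') auto
      qed (use K \<rho> c0 ab in auto)
      ultimately show ?thesis
        using norm_triangle_ineq4[of "sol_ratio s t k (of_real z2)" "K * complex_of_real z2 powr (- s) / s"]
        by (simp add: H_def C4_def)
    qed
    define y where "y = z powr (- \<rho>)"
    have y0: "y > 0" using z by (simp add: y_def)
    have "norm (H (of_real z)) \<le> C4 + \<epsilon> * y"
    proof -
      have "norm (H (of_real z)) \<le> norm (H (of_real z2)) + norm (H (of_real z2) - H (of_real z))"
        using norm_triangle_ineq4[of "H (of_real z2)" "H (of_real z2) - H (of_real z)"] by simp
      also have "\<dots> \<le> C4 + (- \<epsilon> * z2 powr (- \<rho>) - (- \<epsilon> * y))"
        using Hz Hz2 unfolding y_def by (intro add_mono)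
      also have "\<dots> \<le> C4 + \<epsilon> * y" using c0 by simp
      finally show ?thesis .
    qed
    moreover have "4 * \<epsilon> * y \<le> norm (K * complex_of_real z powr (- s) / s)"
    proof -
      have "4 * \<epsilon> * y = a * y / S" using c0 by (simp add: \<epsilon>_def S_def field_simps)
      also have "\<dots> \<le> norm K * y / norm s"
        using K \<rho> c0 y0 ab by (intro frac_le mult_right_mono) auto
      also have "\<dots> = norm (K * complex_of_real z powr (- s) / s)"
        using npow[OF z(1)] by (simp add: norm_mult norm_divide y_def)
      finally show ?thesis .
    qed
    ultimately have G: "3 * \<epsilon> * y - C4 \<le> norm (sol_ratio s t k (of_real z))"
      using norm_triangle_ineq4[of "H (of_real z)" "sol_ratio s t k (of_real z)"]
      unfolding H_def by simp
    have nB: "B0 / 2 \<le> norm B" "norm B \<le> 2 * B0"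
      using B r norm_triangle_ineq2[of "of_real B0" B] norm_triangle_ineq2[of B "of_real B0"] pos
      by (auto simp: norm_minus_commute)
    have nA: "norm A \<le> \<bar>A0\<bar> + 1"
      using A r norm_triangle_ineq2[of A "of_real A0"] by auto
    have yl: "C5 \<le> B0 * \<epsilon> * y"
    proof -
      have "d powr (- \<rho>0) \<le> z powr (- \<rho>0)"
        using z c0 by (intro powr_mono2') auto
      also have "\<dots> \<le> y"
        unfolding y_def using z d z2 C \<rho> by (intro powr_mono') auto
      finally have 1: "d powr (- \<rho>0) \<le> y" .
      have "C5 / (B0 * \<epsilon>) = ((C5 / (B0 * \<epsilon>)) powr (-1 / \<rho>0)) powr (- \<rho>0)"
        using C45 pos c0 by (simp add: powr_powr)
      also have "\<dots> \<le> d powr (- \<rho>0)"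
        using d c0 by (intro powr_mono2') (auto simp: d_def)
      finally have "C5 / (B0 * \<epsilon>) \<le> y" using 1 by simp
      then show ?thesis using pos c0 by (simp add: divide_le_eq mult_ac)
    qed
    have D: "B0 / 2 * (\<epsilon> * y) \<le> norm (A + B * sol_ratio s t k (of_real z))"
    proof -
      have "B0 / 2 * (3 * \<epsilon> * y - C4) \<le> B0 / 2 * norm (sol_ratio s t k (of_real z))"
        using G pos by (intro mult_left_mono) auto
      also have "\<dots> \<le> norm B * norm (sol_ratio s t k (of_real z))"
        using nB by (intro mult_right_mono) auto
      finally have "B0 / 2 * (3 * \<epsilon> * y - C4) - (\<bar>A0\<bar> + 1) \<le> norm (A + B * sol_ratio s t k (of_real z))"
        using nA norm_triangle_ineq4[of "A + B * sol_ratio s t k (of_real z)" A] by (simp add: norm_mult)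
      moreover have "B0 / 2 * (3 * \<epsilon> * y - C4) - (\<bar>A0\<bar> + 1) = B0 / 2 * (\<epsilon> * y) + (B0 * \<epsilon> * y - C5)"
        by (simp add: C5_def algebra_simps)
      ultimately show ?thesis using yl by linarith
    qed
    have Dpos: "B0 / 2 * (\<epsilon> * y) > 0" using pos c0 y0 by simp
    have zz: "z \<le> z2" "z < 1" using z d z2 C by auto
    have nz: "A + B * sol_ratio s t k (of_real z) \<noteq> 0" using D Dpos by auto
    note LD = logderiv_eq[OF Rest z(1) zz(2) unz[OF z(1) zz(1)] nz]
    have "norm (of_real z * hyp 1 s t k (of_real z) / hyp 0 s t k (of_real z)) \<le> C"
    proof -
      have "norm (of_real z * hyp 1 s t k (of_real z)) \<le> (1/2) * C"
        unfolding norm_mult using u(2)[OF z(1) zz(1)] z zz z2 C by (intro mult_mono) auto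
      then have "norm (of_real z * hyp 1 s t k (of_real z)) / norm (hyp 0 s t k (of_real z)) \<le> ((1/2) * C) / (1/2)"
        using u(1)[OF z(1) zz(1)] C by (intro frac_le) auto
      then show ?thesis by (simp add: norm_divide)
    qed
    moreover have "norm (B * (K * complex_of_real z powr (- s) * ratio_factor s t k (of_real z)) / (A + B * sol_ratio s t k (of_real z)))
        \<le> 4 * b * (1 + C) / \<epsilon>"
    proof -
      have "norm (ratio_factor s t k (of_real z)) \<le> 1 + C * z"
        using u(3)[OF z(1) zz(1)] norm_triangle_ineq2[of "ratio_factor s t k (of_real z)" 1] by simp
      also have "\<dots> \<le> 1 + C" using zz C z by (simp add: mult_left_le)
      finally have q: "norm (ratio_factor s t k (of_real z)) \<le> 1 + C" .
      have "norm (B * (K * complex_of_real z powr (- s) * ratio_factor s t k (of_real z))) \<le> (2 * B0) * (b * y * (1 + C))"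
        unfolding norm_mult npow[OF z(1)] y_def[symmetric]
        using nB q K y0 pos ab C by (intro mult_mono) auto
      then have "norm (B * (K * complex_of_real z powr (- s) * ratio_factor s t k (of_real z))) / norm (A + B * sol_ratio s t k (of_real z))
          \<le> (2 * B0) * (b * y * (1 + C)) / (B0 / 2 * (\<epsilon> * y))"
        using D Dpos pos ab y0 C by (intro frac_le) auto
      also have "\<dots> = 4 * b * (1 + C) / \<epsilon>"
        using pos y0 c0 by (simp add: field_simps)
      finally show ?thesis by (simp add: norm_divide)
    qed
    ultimately show "lincomb s t k A B (of_real z) \<noteq> 0 \<and>
       norm (zlogderiv s t k A B z) \<le> C + 4 * b * (1 + C) / \<epsilon>"
      using LD(1) unfolding LD(2) K_def[symmetric]
      by (intro conjI order_trans[OF norm_triangle_ineq4] add_mono)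
  qed (use r d in auto)
qed

text \<open>A cancels: z f'/f is z u'/u, and u stays away from 0 near z = 0.\<close>

lemma near0_analytic:
  fixes s0 t0 k0 A0 :: real
  assumes pos: "s0 \<ge> 0" "t0 \<ge> 0" "A0 > 0"
  obtains r d C where "0 < r" "0 < d" "d \<le> 1/2" 
    "\<And>s t k A z. (s,t,k) \<in> pbox s0 t0 k0 r \<Longrightarrow> norm (A - of_real A0) \<le> r \<Longrightarrow>
       0 < z \<Longrightarrow> z \<le> d \<Longrightarrow> lincomb s t k A 0 (of_real z) \<noteq> 0 \<and>
       norm (zlogderiv s t k A 0 z) \<le> C"
proof -
  obtain C z1 where C: "0 < C" "0 < z1" "z1 \<le> 1/2"
    "\<And>s t k z. (s,t,k) \<in> pbox s0 t0 k0 (1/4) \<Longrightarrow> 0 \<le> z \<Longrightarrow> z \<le> z1 \<Longrightarrow> tame C s t k z"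
    using tame_near_zero[of s0 t0 k0] pos by metis
  define r where "r = min (1/4) (A0/2)"
  show ?thesis
  proof (rule that[of r z1 C])
    fix s t k A :: complex and z :: real
    assume p: "(s,t,k) \<in> pbox s0 t0 k0 r" and A: "norm (A - of_real A0) \<le> r" and z: "0 < z" "z \<le> z1"
    have p1: "(s,t,k) \<in> pbox s0 t0 k0 (1/4)"
      using p pbox_mono[of r "1/4" s0 t0 k0] unfolding r_def by (meson min.cobounded1 subsetD)
    have A0: "A \<noteq> 0" using A pos by (auto simp: r_def)
    have u: "1/2 \<le> norm (hyp 0 s t k (of_real z))" "norm (hyp 1 s t k (of_real z)) \<le> C"
      using C(4)[OF p1, of z] z by (auto simp: tame_def)
    have "norm (of_real z * hyp 1 s t k (of_real z)) \<le> (1/2) * C"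
      unfolding norm_mult using u z C by (intro mult_mono) auto
    then have "norm (of_real z * hyp 1 s t k (of_real z)) / norm (hyp 0 s t k (of_real z)) \<le> ((1/2) * C) / (1/2)"
      using u C by (intro frac_le) auto
    moreover have "hyp 0 s t k (of_real z) \<noteq> 0" using u by auto
    ultimately show "lincomb s t k A 0 (of_real z) \<noteq> 0 \<and>
       norm (zlogderiv s t k A 0 z) \<le> C"
      using A0 by (simp add: lincomb_def lincomb1_def zlogderiv_def norm_divide norm_mult)
  qed (use C pos in \<open>auto simp: r_def\<close>)
qed

text \<open>From -ln y <= 1/y with y = sqrt z; squaring and ln z = 2 ln y produce the constant
  4.\<close>

lemma mult_ln_square_le:
  fixes z :: real
  assumes "0 < z" "z \<le> 1"
  shows "z * (ln z)\<^sup>2 \<le> 4"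
proof -
  define y where "y = sqrt z"
  have y: "0 < y" "y \<le> 1" "z = y\<^sup>2" using assms by (auto simp: y_def)
  have "- ln y = ln (1 / y)" using y by (simp add: ln_div)
  also have "\<dots> \<le> 1 / y - 1" using y by (intro ln_le_minus_one) auto
  finally have "- ln y \<le> 1 / y" by simp
  then have "y * (- ln y) \<le> 1" using y by (simp add: field_simps)
  moreover have "0 \<le> y * (- ln y)" using y by (simp add: mult_nonneg_nonpos)
  ultimately have "(y * (- ln y))\<^sup>2 \<le> 1" by (intro power_le_one)
  moreover have "ln z = 2 * ln y" using y by (simp add: ln_realpow)
  ultimately show ?thesis using y by (simp add: power_mult_distrib)
qed

text \<open>For s = 0 the derivative of g/u integrates to g/u = -K ln z + H with H bounded. So A + B
  g/u = -B K (ln z - X) with X bounded, and z f'/f = O(z) + q/(ln z - X) with q = 1 + O(z).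
  Replacing q by 1 costs O(z), and replacing ln z - X by l = ln(2z/3) costs O(1/ln^2 z); both remain
  bounded after multiplication by l^2.\<close>

lemma near0_log:
  fixes t0 k0 A0 B0 :: real
  assumes pos: "t0 \<ge> 0" "k0 > 0" "B0 > 0"
  obtains r d C where "0 < r" "0 < d" "d \<le> 1/2" 
    "\<And>t k A B z. (0,t,k) \<in> pbox 0 t0 k0 r \<Longrightarrow> norm (A - of_real A0) \<le> r \<Longrightarrow> norm (B - of_real B0) \<le> r \<Longrightarrow>
       0 < z \<Longrightarrow> z \<le> d \<Longrightarrow> lincomb 0 t k A B (of_real z) \<noteq> 0 \<and>
       (ln (2 * z / 3))\<^sup>2 * norm (zlogderiv 0 t k A B z
           - of_real (1 / ln (2 * z / 3))) \<le> C"
proof -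
  obtain r1 a b where ab: "0 < r1" "r1 \<le> 1/4" "0 < a" "0 < b"
    "\<And>s t k. (s,t,k) \<in> pbox 0 t0 k0 r1 \<Longrightarrow> a \<le> norm (wronskian_const s t k) \<and> norm (wronskian_const s t k) \<le> b"
    using wronskian_const_bounds[of 0 t0 k0] pos by (metis order_refl)
  obtain C z1 where C: "0 < C" "0 < z1" "z1 \<le> 1/2"
    "\<And>s t k z. (s,t,k) \<in> pbox 0 t0 k0 (1/4) \<Longrightarrow> 0 \<le> z \<Longrightarrow> z \<le> z1 \<Longrightarrow> tame C s t k z"
    using tame_near_zero[of 0 t0 k0] pos by (metis order_refl)
  define r where "r = Min {r1, B0/2, 1}"
  have r: "0 < r" "r \<le> r1" "r \<le> B0/2" "r \<le> 1" "r \<le> 1/4"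
    using ab pos by (auto simp: r_def)
  obtain Cg where Cg: "0 < Cg" "\<And>s t k. (s,t,k) \<in> pbox 0 t0 k0 (1/4) \<Longrightarrow> norm (hyp 0 t s k (1 - of_real z1)) \<le> Cg"
  proof (rule reflected_hyp_bound[of t0 z1 0 k0])
    show "z1 < 1" using C by linarith
  qed (use pos C in auto)
  define C4 where "C4 = 2 * Cg + b * \<bar>ln z1\<bar> + b * C"
  \<comment> \<open>The bound for |X|: numerator |A + B H| against the lower bound (B0/2) a for |B
    K|.\<close>
  define C5 where "C5 = (\<bar>A0\<bar> + 1 + 2 * B0 * C4) / (B0 / 2 * a)"
  have "b * \<bar>ln z1\<bar> \<ge> 0" "b * C \<ge> 0"
    by (rule mult_nonneg_nonneg; use ab(4) C(1) in simp)+
  then have C4: "C4 > 0" using Cg(1) unfolding C4_def by linarith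
  then have "2 * B0 * C4 \<ge> 0" using pos by simp
  then have "\<bar>A0\<bar> + 1 + 2 * B0 * C4 > 0" by linarith
  moreover have "B0 / 2 * a > 0" using pos ab by simp
  ultimately have C45: "C4 > 0" "C5 > 0" using C4 unfolding C5_def by auto
  \<comment> \<open>For z <= d this gives ln z <= -2 C5 - 1; hence |ln z| >= 1, and |ln z - X| >=
    |ln z|/2 because |X| <= C5.\<close>
  define d where "d = min z1 (exp (- 2 * C5 - 1))"
  have d: "0 < d" "d \<le> z1" "d \<le> exp (- 2 * C5 - 1)" using C by (auto simp: d_def)
  show ?thesis
  \<comment> \<open>32 C from each of the two terms containing z, by z ln^2 z <= 4 and l^2 <= 4 ln^2
    z, and 2 (1 + 2 C5) from 1/(ln z - X) - 1/l.\<close>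
  proof (rule that[of r d "64 * C + 2 + 4 * C5"])
    show "d \<le> 1/2" using d C by linarith
    fix t k A B :: complex and z :: real
    assume p: "(0,t,k) \<in> pbox 0 t0 k0 r" and A: "norm (A - of_real A0) \<le> r" and B: "norm (B - of_real B0) \<le> r"
      and z: "0 < z" "z \<le> d"
    have p1: "(0,t,k) \<in> pbox 0 t0 k0 r1" "(0,t,k) \<in> pbox 0 t0 k0 (1/4)"
      using p pbox_mono[of r r1 0 t0 k0] pbox_mono[of r "1/4" 0 t0 k0] r by blast+
    have Rest: "Re 0 \<ge> -1/2" "Re t \<ge> -1/2"
      using pbox_Re_gt[OF p1(2)] pos by (auto intro: less_imp_le)
    define K where "K = wronskian_const 0 t k"
    have K: "a \<le> norm K" "norm K \<le> b" using ab(5)[OF p1(1)] by (auto simp: K_def)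
    have K0: "K \<noteq> 0" using K ab by auto
    define H where "H w = sol_ratio 0 t k w + K * Ln w" for w
    have u: "1/2 \<le> norm (hyp 0 0 t k (of_real x))" "norm (hyp 1 0 t k (of_real x)) \<le> C"
      "norm (ratio_factor 0 t k (of_real x) - 1) \<le> C * x" if "0 < x" "x \<le> z1" for x
      using C(4)[OF p1(2), of x] that by (auto simp: tame_def)
    have unz: "hyp 0 0 t k (of_real x) \<noteq> 0" if "0 < x" "x \<le> z1" for x
      using u(1)[OF that] by auto
    have dH: "(H has_field_derivative - K * (ratio_factor 0 t k (of_real x) - 1) / of_real x) (at (complex_of_real x))"
      if x: "0 < x" "x \<le> z1" for x
    proof -
      have nr: "complex_of_real x \<notin> \<real>\<^sub>\<le>\<^sub>0" "complex_of_real x \<noteq> 0"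
        using x by (auto simp: complex_nonpos_Reals_iff)
      have "x < 1" using x C by linarith
      have "((\<lambda>w. K * Ln w) has_field_derivative K * inverse (of_real x)) (at (of_real x))"
        by (intro DERIV_cmult has_field_derivative_Ln nr)
      from DERIV_add[OF sol_ratio_has_field_derivative[OF Rest x(1) \<open>x < 1\<close> unz[OF x]] this]
      have "(H has_field_derivative - (wronskian_const 0 t k * complex_of_real x powr (- 0) * ratio_factor 0 t k (of_real x)) / of_real x
          + K * inverse (of_real x)) (at (complex_of_real x))"
        unfolding H_def[abs_def] .
      then show ?thesis
        using nr by (simp add: K_def field_simps)
    qed
    have Hz: "norm (H (of_real z1) - H (of_real z)) \<le> b * C * z1 - b * C * z"
    proof (rule norm_diff_le_derivative_bound[where H = H])
      fix x assume x: "z \<le> x" "x \<le> z1"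
      then have x0: "0 < x" using z by simp
      show "(H has_field_derivative - K * (ratio_factor 0 t k (of_real x) - 1) / of_real x) (at (complex_of_real x))"
        by (rule dH[OF x0 x(2)])
      show "((\<lambda>x. b * C * x) has_real_derivative b * C) (at x)"
        by (auto intro!: derivative_eq_intros)
      have "norm K * norm (ratio_factor 0 t k (of_real x) - 1) \<le> b * (C * x)"
        using K u(3)[OF x0 x(2)] ab(4) by (intro mult_mono) auto
      then show "norm (- K * (ratio_factor 0 t k (of_real x) - 1) / of_real x) \<le> b * C"
        using x0 by (simp add: norm_mult norm_divide divide_le_eq mult.assoc)
    qed (use z d in auto)
    have Lnz: "Ln (complex_of_real x) = of_real (ln x)" if "0 < x" for x
      using that by (simp add: Ln_of_real)
    have HC: "norm (H (of_real z)) \<le> C4"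
    proof -
      have "norm (sol_ratio 0 t k (of_real z1)) \<le> Cg / (1/2)"
        unfolding sol_ratio_def norm_divide using Cg(2)[OF p1(2)] u(1)[of z1] C Cg(1) by (intro frac_le) auto
      moreover have "norm (K * Ln (complex_of_real z1)) \<le> b * \<bar>ln z1\<bar>"
        using K C(2) by (simp add: Lnz norm_mult mult_right_mono)
      ultimately have "norm (H (of_real z1)) \<le> 2 * Cg + b * \<bar>ln z1\<bar>"
        using norm_triangle_ineq[of "sol_ratio 0 t k (of_real z1)" "K * Ln (complex_of_real z1)"]
        by (simp add: H_def)
      moreover have "b * C * z1 - b * C * z \<le> b * C"
      proof -
        have "b * C * z1 \<le> b * C * 1" using C ab by (intro mult_left_mono) auto
        moreover have "0 \<le> b * C * z" using C ab z by simp
        ultimately show ?thesis by simp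
      qed
      moreover have "norm (H (of_real z)) \<le> norm (H (of_real z1)) + norm (H (of_real z1) - H (of_real z))"
        using norm_triangle_ineq4[of "H (of_real z1)" "H (of_real z1) - H (of_real z)"] by simp
      ultimately show ?thesis using Hz unfolding C4_def by linarith
    qed
    have nB: "B0 / 2 \<le> norm B" "norm B \<le> 2 * B0"
      using B r norm_triangle_ineq2[of "of_real B0" B] norm_triangle_ineq2[of B "of_real B0"] pos
      by (auto simp: norm_minus_commute)
    have B0': "B \<noteq> 0" using nB pos by auto
    have nA: "norm A \<le> \<bar>A0\<bar> + 1"
      using A r norm_triangle_ineq2[of A "of_real A0"] by auto
    define X where "X = (A + B * H (of_real z)) / (B * K)"
    have X: "norm X \<le> C5"
    proof -
      have "norm (A + B * H (of_real z)) \<le> (\<bar>A0\<bar> + 1) + 2 * B0 * C4"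
        using nA nB HC pos by (intro order_trans[OF norm_triangle_ineq] add_mono) (auto simp: norm_mult intro!: mult_mono)
      moreover have "B0 / 2 * a \<le> norm (B * K)"
        unfolding norm_mult using nB K ab pos by (intro mult_mono) auto
      ultimately show ?thesis
        unfolding X_def C5_def norm_divide using pos ab C45 by (intro frac_le) auto
    qed
    define L l where "L = ln z" and "l = ln (2 * z / 3)"
    have zz: "z \<le> z1" "z < 1" using z d C by auto
    have L: "L \<le> - 2 * C5 - 1"
    proof -
      have "L \<le> ln (exp (- 2 * C5 - 1))" unfolding L_def using z d by (subst ln_le_cancel_iff) auto
      then show ?thesis by simp
    qed
    have l: "l = L - ln (3/2)" using z by (simp add: l_def L_def ln_div ln_mult)
    have ln32: "0 < ln (3/2::real)" "ln (3/2::real) \<le> 1/2" using ln_le_minus_one[of "3/2::real"] by auto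
    have lL: "l < 0" "\<bar>L\<bar> \<le> \<bar>l\<bar>" "\<bar>l\<bar> \<le> 2 * \<bar>L\<bar>" "1 \<le> \<bar>L\<bar>"
      using l ln32 L C45 by linarith+
    have LX: "\<bar>L\<bar> / 2 \<le> norm (of_real L - X)"
      using norm_triangle_ineq2[of "of_real L" X] X L C45 by (auto simp: abs_if split: if_splits)
    have LX0: "of_real L - X \<noteq> 0" using LX lL by auto
    have DG: "A + B * sol_ratio 0 t k (of_real z) = - (B * K) * (of_real L - X)"
      using B0' K0 by (simp add: X_def H_def Lnz[OF z(1)] L_def field_simps)
    then have nz: "A + B * sol_ratio 0 t k (of_real z) \<noteq> 0" using B0' K0 LX0 by simp
    note LD = logderiv_eq[OF Rest z(1) zz(2) unz[OF z(1) zz(1)] nz]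
    define q where "q = ratio_factor 0 t k (of_real z)"
    define v where "v = of_real z * hyp 1 0 t k (of_real z) / hyp 0 0 t k (of_real z)"
    have "B * (wronskian_const 0 t k * complex_of_real z powr (- 0) * q) / (A + B * sol_ratio 0 t k (of_real z)) = - (q / (of_real L - X))"
      unfolding DG K_def[symmetric] using B0' K0 LX0 z by (simp add: field_simps)
    then have E: "zlogderiv 0 t k A B z = v + q / (of_real L - X)"
      unfolding LD(2) q_def[symmetric] v_def[symmetric] by simp
    have part: "(m - D) / (D * m) = 1 / D - 1 / m" if "D \<noteq> 0" "m \<noteq> 0" for D m :: complex
      using that by (simp add: diff_divide_distrib)
    have l0: "complex_of_real l \<noteq> 0" and lLX: "of_real (l - L) + X = of_real l - (of_real L - X)"
      using lL by auto
    have "v + q / (of_real L - X) - of_real (1 / l) = v + (q - 1) / (of_real L - X) + (of_real (l - L) + X) / ((of_real L - X) * of_real l)"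
      unfolding lLX part[OF LX0 l0] diff_divide_distrib[of q 1] by simp
    also have "norm \<dots> \<le> norm v + norm ((q - 1) / (of_real L - X)) + norm ((of_real (l - L) + X) / ((of_real L - X) * of_real l))"
      by (intro order_trans[OF norm_triangle_ineq] add_mono order_refl norm_triangle_ineq)
    also have "\<dots> \<le> 2 * C * z + C * z / (\<bar>L\<bar> / 2) + (1/2 + C5) / (\<bar>L\<bar> / 2 * \<bar>l\<bar>)"
    proof (intro add_mono)
      have "norm (of_real z * hyp 1 0 t k (of_real z)) / norm (hyp 0 0 t k (of_real z)) \<le> (z * C) / (1/2)"
        using u[OF z(1) zz(1)] z C unfolding norm_mult by (intro frac_le mult_mono) auto
      then show "norm v \<le> 2 * C * z" by (simp add: v_def norm_divide mult_ac)
      show "norm ((q - 1) / (of_real L - X)) \<le> C * z / (\<bar>L\<bar> / 2)"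
        unfolding norm_divide q_def using u(3)[OF z(1) zz(1)] LX lL z C by (intro frac_le) auto
      have "norm (of_real (l - L) + X) \<le> 1/2 + C5"
        using l ln32 X by (intro order_trans[OF norm_triangle_ineq] add_mono) auto
      moreover have "0 < \<bar>L\<bar> / 2 * \<bar>l\<bar>" by (rule mult_pos_pos) (use lL in linarith)+
      moreover have "\<bar>L\<bar> / 2 * \<bar>l\<bar> \<le> norm ((of_real L - X) * complex_of_real l)"
        unfolding norm_mult using LX by (intro mult_mono) auto
      ultimately show "norm ((of_real (l - L) + X) / ((of_real L - X) * of_real l)) \<le> (1/2 + C5) / (\<bar>L\<bar> / 2 * \<bar>l\<bar>)"
        unfolding norm_divide using C45 by (intro frac_le) auto
    qed
    finally have E2: "norm (v + q / (of_real L - X) - of_real (1 / l)) \<le> 2 * C * z + C * z / (\<bar>L\<bar> / 2) + (1/2 + C5) / (\<bar>L\<bar> / 2 * \<bar>l\<bar>)" .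
    have zL: "z * L\<^sup>2 \<le> 4" unfolding L_def using z zz by (intro mult_ln_square_le) auto
    have l2: "l\<^sup>2 \<le> 4 * L\<^sup>2" using power_mono[OF lL(3), of 2] by (simp add: power_mult_distrib)
    have "l\<^sup>2 * norm (v + q / (of_real L - X) - of_real (1 / l)) \<le>
        l\<^sup>2 * (2 * C * z + C * z / (\<bar>L\<bar> / 2) + (1/2 + C5) / (\<bar>L\<bar> / 2 * \<bar>l\<bar>))"
      by (intro mult_left_mono E2) auto
    also have "\<dots> = l\<^sup>2 * (2 * C * z) + l\<^sup>2 * (C * z / (\<bar>L\<bar> / 2)) + (1 + 2 * C5) * (\<bar>l\<bar> / \<bar>L\<bar>)"
    proof -
      have "m\<^sup>2 * ((1/2 + c) / (p / 2 * m)) = (1 + 2 * c) * (m / p)" if "m > 0" "p > 0" for m p c :: real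
        using that by (simp add: field_simps power2_eq_square)
      from this[of "\<bar>l\<bar>" "\<bar>L\<bar>" C5] show ?thesis
        using lL by (simp only: distrib_left power2_abs)
    qed
    also have "\<dots> \<le> 32 * C + 32 * C + (1 + 2 * C5) * 2"
    proof (intro add_mono mult_left_mono)
      have "l\<^sup>2 * (2 * C * z) \<le> (4 * L\<^sup>2) * (2 * C * z)"
        using l2 C z by (intro mult_right_mono) auto
      also have "\<dots> = 8 * C * (z * L\<^sup>2)" by simp
      also have "\<dots> \<le> 8 * C * 4" using zL C by (intro mult_left_mono) auto
      finally show "l\<^sup>2 * (2 * C * z) \<le> 32 * C" by simp
      have "C * z / (\<bar>L\<bar> / 2) \<le> C * z / (1 / 2)"
        using lL C z by (intro divide_left_mono) auto
      then have "l\<^sup>2 * (C * z / (\<bar>L\<bar> / 2)) \<le> l\<^sup>2 * (2 * C * z)"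
        by (intro mult_left_mono) auto
      then show "l\<^sup>2 * (C * z / (\<bar>L\<bar> / 2)) \<le> 32 * C"
        using \<open>l\<^sup>2 * (2 * C * z) \<le> 32 * C\<close> by (rule order_trans)
      have "0 < \<bar>L\<bar>" using lL by linarith
      then show "\<bar>l\<bar> / \<bar>L\<bar> \<le> 2" using lL(3) by (simp only: pos_divide_le_eq)
    qed (use C45 in auto)
    finally have "l\<^sup>2 * norm (v + q / (of_real L - X) - of_real (1 / l)) \<le> 64 * C + 2 + 4 * C5" by simp
    then show "lincomb 0 t k A B (of_real z) \<noteq> 0 \<and>
       (ln (2 * z / 3))\<^sup>2 * norm (zlogderiv 0 t k A B z
           - of_real (1 / ln (2 * z / 3))) \<le> 64 * C + 2 + 4 * C5"
      using LD(1) unfolding E l_def by blast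
  qed (use r d in auto)
qed

section \<open>Uniform bounds in a complex parameter neighbourhood\<close>

definition param_box :: "real \<Rightarrow> real \<Rightarrow> real \<Rightarrow> real \<Rightarrow> real \<Rightarrow> real \<Rightarrow>
    ((complex \<times> complex \<times> complex) \<times> complex \<times> complex) set" where
  "param_box s0 t0 k0 A0 B0 r = pbox s0 t0 k0 r \<times> cball (of_real A0) r \<times> cball (of_real B0) r"

lemma param_box_mono: "r \<le> r' \<Longrightarrow> param_box s0 t0 k0 A0 B0 r \<subseteq> param_box s0 t0 k0 A0 B0 r'"
  by (auto simp: param_box_def pbox_def)

lemma lincomb_of_real:
  fixes s t k A B z :: real
  assumes "s \<ge> 0" "t \<ge> 0" "0 < z" "z < 1"
  shows "lincomb (complex_of_real s) (of_real t) (of_real k) (of_real A) (of_real B) (of_real z) = of_real (lincomb s t k A B z)"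
    and "lincomb1 (complex_of_real s) (of_real t) (of_real k) (of_real A) (of_real B) (of_real z) = of_real (lincomb1 s t k A B z)"
proof -
  have "1 - complex_of_real z = of_real (1 - z)" by simp
  then have *: "hyp j (complex_of_real s) (of_real t) (of_real k) (of_real z) = of_real (hyp j s t k z)"
    "hyp j (complex_of_real t) (of_real s) (of_real k) (1 - of_real z) = of_real (hyp j t s k (1 - z))" for j
    using hyp_of_real[of s z j t k] hyp_of_real[of t "1 - z" j s k] assms by auto
  show "lincomb (complex_of_real s) (of_real t) (of_real k) (of_real A) (of_real B) (of_real z) = of_real (lincomb s t k A B z)"
    and "lincomb1 (complex_of_real s) (of_real t) (of_real k) (of_real A) (of_real B) (of_real z) = of_real (lincomb1 s t k A B z)"
    unfolding lincomb_def lincomb1_def * by simp_all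
qed

lemma riccati_U_of_real:
  fixes s t k A B z :: real
  assumes "s \<ge> 0" "t \<ge> 0" "0 < z" "z < 1"
  shows "riccati_U (complex_of_real s) (of_real t) (of_real k) (of_real A) (of_real B) (of_real z) = of_real (riccati_U s t k A B z)"
  unfolding riccati_U_def lincomb_of_real[OF assms] by simp

text \<open>At the real centre f is positive on (0,1), and [d, 1/2] is compact, so the tube lemma
  gives a complex parameter neighbourhood, independent of z, on which f has no zero.\<close>

lemma middle_bound:
  fixes s0 t0 k0 A0 B0 d :: real
  assumes pos: "s0 \<ge> 0" "t0 \<ge> 0" "k0 > 0" "A0 \<ge> 0" "B0 \<ge> 0" "A0 + B0 > 0" and d: "0 < d" "d \<le> 1/2"
  obtains r C where "0 < r"
    "\<And>s t k A B z. ((s,t,k),A,B) \<in> param_box s0 t0 k0 A0 B0 r \<Longrightarrow> d \<le> z \<Longrightarrow> z \<le> 1/2 \<Longrightarrow>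
       lincomb s t k A B (of_real z) \<noteq> 0 \<and>
       norm (zlogderiv s t k A B z) \<le> C"
proof -
  define f where "f = (\<lambda>(((s,t,k),A,B),z). lincomb s t k A B (complex_of_real z))"
  define f1 where "f1 = (\<lambda>(((s,t,k),A,B),z). lincomb1 s t k A B (complex_of_real z))"
  define D :: "(((complex \<times> complex \<times> complex) \<times> complex \<times> complex) \<times> real) set" where
    "D = (({s. Re s > -1/2} \<times> {t. Re t > -1/2} \<times> UNIV) \<times> UNIV \<times> UNIV) \<times> {0<..<1}"
  have "open D" unfolding D_def
    by (intro open_Times open_halfspace_Re_gt open_UNIV open_greaterThanLessThan)
  have cH: "continuous_on D (\<lambda>x. hyp j (fst (fst (fst x))) (fst (snd (fst (fst x)))) (snd (snd (fst (fst x)))) (complex_of_real (snd x)))"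
    "continuous_on D (\<lambda>x. hyp j (fst (snd (fst (fst x)))) (fst (fst (fst x))) (snd (snd (fst (fst x)))) (1 - complex_of_real (snd x)))" for j
    by (intro continuous_on_hyp' continuous_intros; use of_real_unit_norms in \<open>force simp: D_def\<close>)+
  have cf: "continuous_on D f" "continuous_on D f1"
    unfolding f_def f1_def case_prod_unfold lincomb_def lincomb1_def
    by (intro continuous_on_add continuous_on_diff continuous_on_mult cH continuous_intros)+
  define W where "W = D \<inter> f -` (- {0})"
  have "open W" unfolding W_def
    using cf \<open>open D\<close> by (intro continuous_open_preimage) auto
  define p0 where "p0 = ((complex_of_real s0, complex_of_real t0, complex_of_real k0), complex_of_real A0, complex_of_real B0)"
  have "{p0} \<times> {d..1/2} \<subseteq> W"
  proof
    fix q assume "q \<in> {p0} \<times> {d..1/2}"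
    then obtain z where q: "q = (p0, z)" and z: "z \<in> {d..1/2}" by blast
    note pos0 = pos
    \<comment> \<open>A vector c is manufactured from s0, t0, k0 to make \<open>lincomb_pos\<close>
      available.\<close>
    interpret riccati_params "vector [s0\<^sup>2 - 1, t0\<^sup>2 - 1, 2 * k0 - (s0 + t0) * (s0 + t0 + 2) / 2]" s0 t0 k0
      using pos by unfold_locales auto
    have "lincomb s0 t0 k0 A0 B0 z > 0"
      using pos0 z d by (intro lincomb_pos) auto
    then have "f (p0, z) \<noteq> 0"
      using lincomb_of_real(1)[of s0 t0 z k0 A0 B0] pos0 z d by (simp add: f_def p0_def)
    then show "q \<in> W"
      unfolding q using pos0 z d by (auto simp: W_def D_def p0_def)
  qed
  from Elementary_Topology.tube_lemma[OF compact_Icc \<open>open W\<close> this]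
  obtain X where X: "p0 \<in> X" "open X" "X \<times> {d..1/2} \<subseteq> W" by blast
  then obtain e where e: "e > 0" "ball p0 e \<subseteq> X"
    using open_contains_ball by blast
  \<comment> \<open>The five coordinate distances sum to at most 5r < e.\<close>
  define r where "r = e / 6"
  have sub: "param_box s0 t0 k0 A0 B0 r \<subseteq> X"
  proof
    fix p assume p: "p \<in> param_box s0 t0 k0 A0 B0 r"
    obtain s t k A B where pe: "p = ((s,t,k),A,B)" by (metis surj_pair)
    have "dist p0 p \<le> (dist (of_real s0) s + (dist (of_real t0) t + dist (of_real k0) k)) + (dist (of_real A0) A + dist (of_real B0) B)"
      unfolding pe p0_def by (intro order_trans[OF dist_Pair_le] add_mono order_refl dist_Pair_le)
    also have "\<dots> \<le> (r + (r + r)) + (r + r)"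
      using p unfolding pe by (intro add_mono) (auto simp: param_box_def pbox_def)
    also have "\<dots> < e" using e by (simp add: r_def)
    finally show "p \<in> X" using e by auto
  qed
  define Q where "Q = param_box s0 t0 k0 A0 B0 r \<times> {d..1/2}"
  have QW: "Q \<subseteq> W" using sub X(3) by (auto simp: Q_def)
  have "compact Q"
    unfolding Q_def param_box_def by (intro compact_Times compact_pbox compact_cball compact_Icc)
  moreover have "continuous_on Q (\<lambda>x. of_real (snd x) * (f1 x / f x))"
    using QW by (intro continuous_intros continuous_on_subset[OF cf(1)] continuous_on_subset[OF cf(2)]) (auto simp: W_def)
  ultimately obtain C where C: "\<And>x. x \<in> Q \<Longrightarrow> norm (of_real (snd x) * (f1 x / f x)) \<le> C"
    using compact_norm_bound by blast
  show ?thesis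
  proof (rule that[of r C])
    fix s t k A B :: complex and z :: real
    assume "((s,t,k),A,B) \<in> param_box s0 t0 k0 A0 B0 r" "d \<le> z" "z \<le> 1/2"
    then have "(((s,t,k),A,B),z) \<in> Q" by (simp add: Q_def)
    then show "lincomb s t k A B (of_real z) \<noteq> 0 \<and>
       norm (zlogderiv s t k A B z) \<le> C"
      using C[of "(((s,t,k),A,B),z)"] QW by (auto simp: f_def f1_def W_def zlogderiv_def)
  qed (use e in \<open>simp add: r_def\<close>)
qed

lemma norm_inverse_le_one: "l \<le> -1 \<Longrightarrow> norm (complex_of_real (1 / l)) \<le> 1"
  unfolding norm_of_real abs_divide by (subst pos_divide_le_eq) auto

text \<open>2z/3 <= 1/3 <= 1/e: the divisor 3 in the weights keeps the logarithm at most -1, so its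
  square is at least 1.\<close>

lemma ln_weight_bounds:
  fixes z :: real
  assumes "0 < z" "z \<le> 1/2"
  shows "ln (2 * z / 3) \<le> -1" "z * (ln (2 * z / 3))\<^sup>2 \<le> 6"
proof -
  have "2 * z / 3 \<le> inverse 3" using assms by simp
  also have "\<dots> \<le> exp (-1)"
    unfolding exp_minus using exp_le by (intro le_imp_inverse_le) auto
  finally have "2 * z / 3 \<le> exp (-1)" .
  then have "ln (2 * z / 3) \<le> ln (exp (-1))"
    using assms by (subst ln_le_cancel_iff) auto
  then show "ln (2 * z / 3) \<le> -1" by simp
  show "z * (ln (2 * z / 3))\<^sup>2 \<le> 6"
    using mult_ln_square_le[of "2 * z / 3"] assms by simp
qed

text \<open>A parameter s or B that vanishes at the centre is kept 0: a nonzero B would add the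
  singular solution, a nonzero s would turn the logarithm into a power. Then one of the three
  regimes at z = 0 applies on (0, d], and \<open>middle_bound\<close> covers [d, 1/2].\<close>

lemma left_half_bound:
  fixes s0 t0 k0 A0 B0 :: real
  assumes pos: "s0 \<ge> 0" "t0 \<ge> 0" "k0 > 0" "A0 \<ge> 0" "B0 \<ge> 0" "A0 + B0 > 0"
  obtains r C where "0 < r" "0 < C"
    "\<And>s t k A B z. ((s,t,k),A,B) \<in> param_box s0 t0 k0 A0 B0 r \<Longrightarrow> (s0 = 0 \<longrightarrow> s = 0) \<Longrightarrow> (B0 = 0 \<longrightarrow> B = 0) \<Longrightarrow>
       0 < z \<Longrightarrow> z \<le> 1/2 \<Longrightarrow> lincomb s t k A B (of_real z) \<noteq> 0 \<and> norm (riccati_U s t k A B (of_real z)) \<le> C \<and>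
       (s0 = 0 \<and> B0 > 0 \<longrightarrow>
         (ln (2 * z / 3))\<^sup>2 * norm (riccati_U s t k A B (of_real z) - of_real (2 + 4 / ln (2 * z / 3))) \<le> C)"
proof -
  define lg where "lg \<longleftrightarrow> s0 = 0 \<and> B0 > 0"
  have "\<exists>r d C. 0 < r \<and> 0 < d \<and> d \<le> 1/2 \<and> (\<forall>s t k A B z. ((s,t,k),A,B) \<in> param_box s0 t0 k0 A0 B0 r \<longrightarrow>
       (s0 = 0 \<longrightarrow> s = 0) \<longrightarrow> (B0 = 0 \<longrightarrow> B = 0) \<longrightarrow>
       0 < z \<longrightarrow> z \<le> d \<longrightarrow> lincomb s t k A B (of_real z) \<noteq> 0 \<and> norm (zlogderiv s t k A B z) \<le> C \<and>
       (lg \<longrightarrow> (ln (2 * z / 3))\<^sup>2 * norm (zlogderiv s t k A B z - of_real (1 / ln (2 * z / 3))) \<le> C))"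
  proof -
    consider "B0 = 0" | "B0 > 0" "s0 > 0" | "B0 > 0" "s0 = 0" using pos by linarith
    then show ?thesis
    proof cases
      case 1
      then have "A0 > 0" using pos by simp
      obtain r d C where "0 < r" "0 < d" "d \<le> 1/2" "\<And>s t k A z. (s,t,k) \<in> pbox s0 t0 k0 r \<Longrightarrow> norm (A - of_real A0) \<le> r \<Longrightarrow>
         0 < z \<Longrightarrow> z \<le> d \<Longrightarrow> lincomb s t k A 0 (of_real z) \<noteq> 0 \<and> norm (zlogderiv s t k A 0 z) \<le> C"
        using near0_analytic[OF pos(1,2) \<open>A0 > 0\<close>, of k0] by metis
      then show ?thesis
        using 1 by (intro exI[of _ r] exI[of _ d] exI[of _ C])
          (auto simp: lg_def param_box_def dist_norm norm_minus_commute)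
    next
      case 2
      obtain r d C where "0 < r" "0 < d" "d \<le> 1/2" "\<And>s t k A B z. (s,t,k) \<in> pbox s0 t0 k0 r \<Longrightarrow> norm (A - of_real A0) \<le> r \<Longrightarrow>
         norm (B - of_real B0) \<le> r \<Longrightarrow> 0 < z \<Longrightarrow> z \<le> d \<Longrightarrow> lincomb s t k A B (of_real z) \<noteq> 0 \<and> norm (zlogderiv s t k A B z) \<le> C"
        using near0_regular[OF 2(2) pos(2,3) 2(1), of A0] by metis
      then show ?thesis
        using 2 by (intro exI[of _ r] exI[of _ d] exI[of _ C])
          (auto simp: lg_def param_box_def dist_norm norm_minus_commute)
    next
      case 3
      obtain r d C where rd: "0 < r" "0 < d" "d \<le> 1/2" and C: "\<And>t k A B z. (0,t,k) \<in> pbox 0 t0 k0 r \<Longrightarrow> norm (A - of_real A0) \<le> r \<Longrightarrow>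
         norm (B - of_real B0) \<le> r \<Longrightarrow> 0 < z \<Longrightarrow> z \<le> d \<Longrightarrow> lincomb 0 t k A B (of_real z) \<noteq> 0 \<and>
         (ln (2 * z / 3))\<^sup>2 * norm (zlogderiv 0 t k A B z - of_real (1 / ln (2 * z / 3))) \<le> C"
        using near0_log[OF pos(2,3) 3(1), of A0] by metis
      \<comment> \<open>The weighted estimate implies the plain one, since l^2 >= 1 and |1/l| <=
        1.\<close>
      have bd: "norm (zlogderiv 0 t k A B z) \<le> 1 + \<bar>C\<bar>" if "(0,t,k) \<in> pbox 0 t0 k0 r" "norm (A - of_real A0) \<le> r"
         "norm (B - of_real B0) \<le> r" "0 < z" "z \<le> d" for t k A B z
      proof -
        define l where "l = ln (2 * z / 3)"
        have l: "l \<le> -1" using ln_weight_bounds[of z] that rd by (simp add: l_def)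
        have "1 * norm (zlogderiv 0 t k A B z - of_real (1 / l)) \<le> l\<^sup>2 * norm (zlogderiv 0 t k A B z - of_real (1 / l))"
          using l power_mono[of 1 "- l" 2] by (intro mult_right_mono) auto
        also have "\<dots> \<le> C" using C[OF that] by (simp add: l_def)
        finally have "norm (zlogderiv 0 t k A B z - of_real (1 / l)) \<le> \<bar>C\<bar>" by simp
        moreover have "norm (complex_of_real (1 / l)) \<le> 1"
          using l by (rule norm_inverse_le_one)
        ultimately show ?thesis
          using norm_triangle_ineq2[of "zlogderiv 0 t k A B z" "of_real (1 / l)"] by simp
      qed
      show ?thesis
      proof (rule exI[of _ r], rule exI[of _ d], rule exI[of _ "1 + \<bar>C\<bar>"], intro conjI rd allI impI)
        fix s t k A B :: complex and z :: real
        assume "((s,t,k),A,B) \<in> param_box s0 t0 k0 A0 B0 r" "s0 = 0 \<longrightarrow> s = 0" and z: "0 < z" "z \<le> d"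
        then have s: "s = 0" and p: "(0,t,k) \<in> pbox 0 t0 k0 r" "norm (A - of_real A0) \<le> r" "norm (B - of_real B0) \<le> r"
          using 3 by (auto simp: param_box_def dist_norm norm_minus_commute)
        show "lincomb s t k A B (of_real z) \<noteq> 0" "norm (zlogderiv s t k A B z) \<le> 1 + \<bar>C\<bar>"
          "(ln (2 * z / 3))\<^sup>2 * norm (zlogderiv s t k A B z - of_real (1 / ln (2 * z / 3))) \<le> 1 + \<bar>C\<bar>"
          using C[OF p z] bd[OF p z] unfolding s by auto
      qed
    qed
  qed
  then obtain r1 d C1 where rd: "0 < r1" "0 < d" "d \<le> 1/2" and C1: "\<And>s t k A B z. ((s,t,k),A,B) \<in> param_box s0 t0 k0 A0 B0 r1 \<Longrightarrow>
       (s0 = 0 \<longrightarrow> s = 0) \<Longrightarrow> (B0 = 0 \<longrightarrow> B = 0) \<Longrightarrow>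
       0 < z \<Longrightarrow> z \<le> d \<Longrightarrow> lincomb s t k A B (of_real z) \<noteq> 0 \<and> norm (zlogderiv s t k A B z) \<le> C1 \<and>
       (lg \<longrightarrow> (ln (2 * z / 3))\<^sup>2 * norm (zlogderiv s t k A B z - of_real (1 / ln (2 * z / 3))) \<le> C1)"
    by blast
  obtain r2 C2 where r2: "0 < r2" and C2: "\<And>s t k A B z. ((s,t,k),A,B) \<in> param_box s0 t0 k0 A0 B0 r2 \<Longrightarrow> d \<le> z \<Longrightarrow> z \<le> 1/2 \<Longrightarrow>
       lincomb s t k A B (of_real z) \<noteq> 0 \<and> norm (zlogderiv s t k A B z) \<le> C2"
    using middle_bound[OF pos rd(2,3)] by metis
  define r where "r = Min {r1, r2, 1}"
  have r: "0 < r" "r \<le> r1" "r \<le> r2" "r \<le> 1" using rd r2 by (auto simp: r_def)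
  \<comment> \<open>On [d, 1/2] the weight l^2 is at most its value at d, which turns the plain
    bound C2 into a weighted one.\<close>
  define C3 where "C3 = \<bar>C1\<bar> + \<bar>C2\<bar> + (ln (2 * d / 3))\<^sup>2 * (\<bar>C2\<bar> + 1)"
  define N where "N = 4 + 2 * (s0 + 1) + 2 * (t0 + 1)"
  show ?thesis
  proof (rule that[of r "N + 6 * N + 24 + 4 * C3"])
    have "C3 \<ge> 0" by (simp add: C3_def)
    then show "0 < N + 6 * N + 24 + 4 * C3" using pos by (simp add: N_def)
    fix s t k A B :: complex and z :: real
    assume p: "((s,t,k),A,B) \<in> param_box s0 t0 k0 A0 B0 r" and s: "s0 = 0 \<longrightarrow> s = 0" and B: "B0 = 0 \<longrightarrow> B = 0"
      and z: "0 < z" "z \<le> 1/2"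
    have p1: "((s,t,k),A,B) \<in> param_box s0 t0 k0 A0 B0 r1" "((s,t,k),A,B) \<in> param_box s0 t0 k0 A0 B0 r2"
      using p r param_box_mono by blast+
    have st: "norm s \<le> s0 + 1" "norm t \<le> t0 + 1"
      using p r norm_triangle_ineq2[of s "of_real s0"] norm_triangle_ineq2[of t "of_real t0"] pos
      by (auto simp: param_box_def pbox_def dist_norm norm_minus_commute)
    define l where "l = ln (2 * z / 3)"
    have l: "l \<le> -1" "z * l\<^sup>2 \<le> 6" using ln_weight_bounds[OF z] by (auto simp: l_def)
    have main: "lincomb s t k A B (of_real z) \<noteq> 0 \<and> norm (zlogderiv s t k A B z) \<le> C3 \<and>
       (lg \<longrightarrow> l\<^sup>2 * norm (zlogderiv s t k A B z - of_real (1 / l)) \<le> C3)"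
    proof (cases "z \<le> d")
      case True
      have "C1 \<le> C3" by (simp add: C3_def add_increasing2)
      then show ?thesis
        using C1[OF p1(1) s B z(1) True] unfolding l_def by force
    next
      case False
      have R: "lincomb s t k A B (of_real z) \<noteq> 0" "norm (zlogderiv s t k A B z) \<le> \<bar>C2\<bar>"
        using C2[OF p1(2) _ z(2)] False by force+
      have "l\<^sup>2 \<le> (ln (2 * d / 3))\<^sup>2"
      proof -
        have "ln (2 * d / 3) \<le> l" unfolding l_def using False rd by (subst ln_le_cancel_iff) auto
        then have "(- l)\<^sup>2 \<le> (- ln (2 * d / 3))\<^sup>2" using l by (intro power_mono) auto
        then show ?thesis by simp
      qed
      moreover have "norm (complex_of_real (1 / l)) \<le> 1"
        using l(1) by (rule norm_inverse_le_one)
      then have "norm (zlogderiv s t k A B z - of_real (1 / l)) \<le> \<bar>C2\<bar> + 1"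
        using R(2) norm_triangle_ineq4[of "zlogderiv s t k A B z" "of_real (1 / l)"] by linarith
      ultimately have "l\<^sup>2 * norm (zlogderiv s t k A B z - of_real (1 / l)) \<le> (ln (2 * d / 3))\<^sup>2 * (\<bar>C2\<bar> + 1)"
        by (intro mult_mono) auto
      then have "l\<^sup>2 * norm (zlogderiv s t k A B z - of_real (1 / l)) \<le> C3"
        unfolding C3_def by linarith
      moreover have "norm (zlogderiv s t k A B z) \<le> C3"
        using R(2) unfolding C3_def by (smt (verit) mult_nonneg_nonneg zero_le_power2)
      ultimately show ?thesis using R(1) by blast
    qed
    have U: "riccati_U s t k A B (of_real z) = 2 * (1 + s) * of_real (1 - z) - 2 * (1 + t) * of_real z + of_real (4 * (1 - z)) * zlogderiv s t k A B z"
    proof -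
      have "4 * w * (1 - w) * R = 4 * (1 - w) * (w * R)" for w R :: complex
        by (simp add: mult_ac)
      then show ?thesis
        by (simp only: riccati_U_def zlogderiv_def of_real_mult of_real_diff of_real_1 of_real_numeral)
    qed
    have C30: "C3 \<ge> 0" by (simp add: C3_def)
    have b1: "norm (2 * (1 + s) * of_real (1 - z)) \<le> 2 * (1 + (s0 + 1))"
    proof -
      have "norm (1 + s) \<le> 1 + (s0 + 1)" using st norm_triangle_ineq[of 1 s] by simp
      then have "norm (2 * (1 + s)) * norm (complex_of_real (1 - z)) \<le> 2 * (1 + (s0 + 1)) * 1"
        using z pos unfolding norm_of_real norm_mult by (intro mult_mono) auto
      then show ?thesis by (simp add: norm_mult)
    qed
    have b2: "norm (2 * (1 + t) * of_real z) \<le> 2 * (1 + (t0 + 1)) * z"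
    proof -
      have "norm (1 + t) \<le> 1 + (t0 + 1)" using st norm_triangle_ineq[of 1 t] by simp
      moreover have "norm (2 * (1 + t) * of_real z) = 2 * norm (1 + t) * z"
        using z by (simp only: norm_mult norm_of_real norm_numeral abs_of_pos)
      ultimately show ?thesis using z by (auto intro!: mult_right_mono)
    qed
    have b2': "2 * (1 + (t0 + 1)) * z \<le> 2 * (1 + (t0 + 1))"
      using z pos by (intro mult_left_le) auto
    have b3: "norm (of_real (4 * (1 - z)) * w) \<le> 4 * norm w" for w :: complex
      unfolding norm_mult norm_of_real using z by (intro mult_right_mono) auto
    have "norm (riccati_U s t k A B (of_real z)) \<le> norm (2 * (1 + s) * of_real (1 - z)) + norm (2 * (1 + t) * of_real z)
        + norm (of_real (4 * (1 - z)) * zlogderiv s t k A B z)"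
      unfolding U by (intro order_trans[OF norm_triangle_ineq] add_mono norm_triangle_ineq4 order_refl)
    also have "\<dots> \<le> 2 * (1 + (s0 + 1)) + 2 * (1 + (t0 + 1)) + 4 * C3"
      using b1 b2 b2' b3[of "zlogderiv s t k A B z"] main by linarith
    also have "\<dots> \<le> N + 6 * N + 24 + 4 * C3"
      using pos by (simp add: N_def)
    finally have UB: "norm (riccati_U s t k A B (of_real z)) \<le> N + 6 * N + 24 + 4 * C3" .
    have "l\<^sup>2 * norm (riccati_U s t k A B (of_real z) - of_real (2 + 4 / l)) \<le> N + 6 * N + 24 + 4 * C3" if "lg"
    proof -
      have "s = 0" using s that by (simp add: lg_def)
      \<comment> \<open>With s = 0, everything besides the multiple of z f'/f - 1/l is O(z), and z
        l^2 is bounded.\<close>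
      have "riccati_U s t k A B (of_real z) - of_real (2 + 4 / l) = - (2 * of_real z) - 2 * (1 + t) * of_real z
         + of_real (4 * (1 - z)) * (zlogderiv s t k A B z - of_real (1 / l)) - of_real (4 * z / l)"
        unfolding U using l by (simp add: \<open>s = 0\<close> field_simps)
      also have "norm \<dots> \<le> norm (2 * complex_of_real z) + norm (2 * (1 + t) * of_real z)
         + norm (of_real (4 * (1 - z)) * (zlogderiv s t k A B z - of_real (1 / l))) + norm (complex_of_real (4 * z / l))"
        by (intro order_trans[OF norm_triangle_ineq4] order_trans[OF norm_triangle_ineq] add_mono order_refl
            order_trans[OF norm_triangle_ineq4]) auto
      also have "\<dots> \<le> 2 * z + 2 * (1 + (t0 + 1)) * z + 4 * norm (zlogderiv s t k A B z - of_real (1 / l)) + 4 * z"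
      proof (intro add_mono b2 b3)
        show "norm (complex_of_real (4 * z / l)) \<le> 4 * z"
        proof -
          have "\<bar>1 / l\<bar> \<le> 1" using norm_inverse_le_one[OF l(1)] by (simp only: norm_of_real)
          moreover have "\<bar>4 * z / l\<bar> = 4 * z * \<bar>1 / l\<bar>" using z by (simp add: abs_mult)
          ultimately show ?thesis
            unfolding norm_of_real using z by (simp only:) (intro mult_left_le, auto)
        qed
      qed (use z in \<open>simp add: norm_mult\<close>)
      also have "\<dots> = (6 + 2 * (1 + (t0 + 1))) * z + 4 * norm (zlogderiv s t k A B z - of_real (1 / l))"
        by (simp add: algebra_simps)
      finally have "l\<^sup>2 * norm (riccati_U s t k A B (of_real z) - of_real (2 + 4 / l)) \<le>
          l\<^sup>2 * ((6 + 2 * (1 + (t0 + 1))) * z + 4 * norm (zlogderiv s t k A B z - of_real (1 / l)))"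
        by (intro mult_left_mono) auto
      also have "\<dots> = (6 + 2 * (1 + (t0 + 1))) * (z * l\<^sup>2) + 4 * (l\<^sup>2 * norm (zlogderiv s t k A B z - of_real (1 / l)))"
        by (simp add: algebra_simps)
      also have "\<dots> \<le> (6 + 2 * (1 + (t0 + 1))) * 6 + 4 * C3"
        using l main that pos by (intro add_mono mult_left_mono) auto
      also have "\<dots> \<le> N + 6 * N + 24 + 4 * C3"
        using pos by (simp add: N_def)
      finally show ?thesis .
    qed
    then show "lincomb s t k A B (of_real z) \<noteq> 0 \<and> norm (riccati_U s t k A B (of_real z)) \<le> N + 6 * N + 24 + 4 * C3 \<and>
       (s0 = 0 \<and> B0 > 0 \<longrightarrow>
         (ln (2 * z / 3))\<^sup>2 * norm (riccati_U s t k A B (of_real z) - of_real (2 + 4 / ln (2 * z / 3))) \<le> N + 6 * N + 24 + 4 * C3)"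
      using main UB unfolding lg_def l_def by blast
  qed (use r in auto)
qed

text \<open>The part of the boundary behaviour that does not depend on the parameters; subtracting it leaves
  the remainder to which Cauchy's estimates are applied.\<close>
definition log_profile :: "bool \<Rightarrow> bool \<Rightarrow> real \<Rightarrow> real" where
  "log_profile L R z = (if z \<le> 1/2 then (if L then 2 + 4 / ln (2 * z / 3) else 0)
                 else (if R then - (2 + 4 / ln (2 * (1 - z) / 3)) else 0))"

definition log_weight :: "bool \<Rightarrow> real \<Rightarrow> real" where
  "log_weight L z = (if L then (ln (2 * z / 3))\<^sup>2 else 1)"

text \<open>Away from its own endpoint a weight is bounded, by (ln 3)^2 <= 4, so in a product of two
  weights only the nearby one matters.\<close>

lemma log_weight_far: "1/2 \<le> z \<Longrightarrow> z < 1 \<Longrightarrow> log_weight L z \<le> 4"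
proof -
  assume z: "1/2 \<le> z" "z < 1"
  have "ln (1/3) \<le> ln (2 * z / 3)" "ln (2 * z / 3) \<le> 0" using z by (auto simp: ln_le_cancel_iff)
  moreover have "ln (1/3 :: real) = - ln 3" by (simp add: ln_div)
  moreover have "ln (3 :: real) \<le> 2" using ln_le_minus_one[of "3::real"] by simp
  ultimately have "(- ln (2 * z / 3))\<^sup>2 \<le> 2\<^sup>2" by (intro power_mono) auto
  then show ?thesis by (simp add: log_weight_def)
qed

lemma log_weight_nonneg: "log_weight L z \<ge> 0" by (simp add: log_weight_def)

text \<open>The right half is the left half with s, t and A, B exchanged, through
  \<open>riccati_U_swap\<close>. On a half without logarithm the profile is 0 and the nearby weight
  1, so there the weighted bound follows from the plain one.\<close>

lemma parameter_nbhd_bound: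
  fixes s0 t0 k0 A0 B0 :: real
  assumes pos: "s0 \<ge> 0" "t0 \<ge> 0" "k0 > 0" "A0 \<ge> 0" "B0 \<ge> 0" "A0 + B0 > 0"
  defines "L \<equiv> s0 = 0 \<and> B0 > 0" and "R \<equiv> t0 = 0 \<and> A0 > 0"
  obtains r C where "0 < r" "0 < C"
    "\<And>s t k A B z. ((s,t,k),A,B) \<in> param_box s0 t0 k0 A0 B0 r \<Longrightarrow> (s0 = 0 \<longrightarrow> s = 0) \<Longrightarrow> (t0 = 0 \<longrightarrow> t = 0) \<Longrightarrow>
       (A0 = 0 \<longrightarrow> A = 0) \<Longrightarrow> (B0 = 0 \<longrightarrow> B = 0) \<Longrightarrow>
       0 < z \<Longrightarrow> z < 1 \<Longrightarrow> lincomb s t k A B (of_real z) \<noteq> 0 \<and> norm (riccati_U s t k A B (of_real z)) \<le> C \<and>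
       log_weight L z * log_weight R (1 - z) * norm (riccati_U s t k A B (of_real z) - of_real (log_profile L R z)) \<le> C"
proof -
  obtain r1 C1 where r1: "0 < r1" "0 < C1" and C1: "\<And>s t k A B z. ((s,t,k),A,B) \<in> param_box s0 t0 k0 A0 B0 r1 \<Longrightarrow>
       (s0 = 0 \<longrightarrow> s = 0) \<Longrightarrow> (B0 = 0 \<longrightarrow> B = 0) \<Longrightarrow>
       0 < z \<Longrightarrow> z \<le> 1/2 \<Longrightarrow> lincomb s t k A B (of_real z) \<noteq> 0 \<and> norm (riccati_U s t k A B (of_real z)) \<le> C1 \<and>
       (s0 = 0 \<and> B0 > 0 \<longrightarrow>
         (ln (2 * z / 3))\<^sup>2 * norm (riccati_U s t k A B (of_real z) - of_real (2 + 4 / ln (2 * z / 3))) \<le> C1)"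
    using left_half_bound[OF pos] by metis
  have pos': "t0 \<ge> 0" "s0 \<ge> 0" "k0 > 0" "B0 \<ge> 0" "A0 \<ge> 0" "B0 + A0 > 0" using pos by auto
  obtain r2 C2 where r2: "0 < r2" "0 < C2" and C2: "\<And>t s k B A z. ((t,s,k),B,A) \<in> param_box t0 s0 k0 B0 A0 r2 \<Longrightarrow>
       (t0 = 0 \<longrightarrow> t = 0) \<Longrightarrow> (A0 = 0 \<longrightarrow> A = 0) \<Longrightarrow>
       0 < z \<Longrightarrow> z \<le> 1/2 \<Longrightarrow> lincomb t s k B A (of_real z) \<noteq> 0 \<and> norm (riccati_U t s k B A (of_real z)) \<le> C2 \<and>
       (t0 = 0 \<and> A0 > 0 \<longrightarrow>
         (ln (2 * z / 3))\<^sup>2 * norm (riccati_U t s k B A (of_real z) - of_real (2 + 4 / ln (2 * z / 3))) \<le> C2)"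
    using left_half_bound[OF pos'] by metis
  define r where "r = min r1 r2"
  show ?thesis
  proof (rule that[of r "4 * C1 + 4 * C2"])
    fix s t k A B :: complex and z :: real
    assume p: "((s,t,k),A,B) \<in> param_box s0 t0 k0 A0 B0 r" and s: "s0 = 0 \<longrightarrow> s = 0" and t: "t0 = 0 \<longrightarrow> t = 0"
      and A: "A0 = 0 \<longrightarrow> A = 0" and B: "B0 = 0 \<longrightarrow> B = 0" and z: "0 < z" "z < 1"
    have p1: "((s,t,k),A,B) \<in> param_box s0 t0 k0 A0 B0 r1"
      using p by (auto simp: r_def param_box_def pbox_def)
    have p2: "((t,s,k),B,A) \<in> param_box t0 s0 k0 B0 A0 r2"
      using p by (auto simp: r_def param_box_def pbox_def)
    define X where "X = norm (riccati_U s t k A B (of_real z) - of_real (log_profile L R z))"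
    show "lincomb s t k A B (of_real z) \<noteq> 0 \<and> norm (riccati_U s t k A B (of_real z)) \<le> 4 * C1 + 4 * C2 \<and>
       log_weight L z * log_weight R (1 - z) * norm (riccati_U s t k A B (of_real z) - of_real (log_profile L R z)) \<le> 4 * C1 + 4 * C2"
      unfolding X_def[symmetric]
    proof (cases "z \<le> 1/2")
      case True
      note * = C1[OF p1 s B z(1) True]
      have "log_weight L z * X \<le> C1"
        using * True by (simp add: log_weight_def log_profile_def X_def L_def)
      then have "log_weight R (1 - z) * (log_weight L z * X) \<le> 4 * C1"
        using log_weight_far[of "1 - z" R] z True r1 by (intro mult_mono) (auto simp: log_weight_nonneg X_def)
      then show "lincomb s t k A B (of_real z) \<noteq> 0 \<and> norm (riccati_U s t k A B (of_real z)) \<le> 4 * C1 + 4 * C2 \<and>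
          log_weight L z * log_weight R (1 - z) * X \<le> 4 * C1 + 4 * C2"
        using * r1 r2 by (simp add: mult_ac)
    next
      case False
      then have "0 < 1 - z" "1 - z \<le> 1/2" using z by auto
      note * = C2[OF p2 t A this]
      have sw: "lincomb s t k A B (of_real z) = lincomb t s k B A (of_real (1 - z))"
        "riccati_U s t k A B (of_real z) = - riccati_U t s k B A (of_real (1 - z))"
        using lincomb_swap[of s t k A B "of_real z"] riccati_U_swap[of s t k A B "of_real z"] by simp_all
      have "log_weight R (1 - z) * X \<le> C2"
      proof (cases R)
        case True
        then have "riccati_U s t k A B (of_real z) - of_real (log_profile L R z) =
            - (riccati_U t s k B A (of_real (1 - z)) - of_real (2 + 4 / ln (2 * (1 - z) / 3)))"
          unfolding sw using False by (simp add: log_profile_def)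
        then have "X = norm (riccati_U t s k B A (of_real (1 - z)) - of_real (2 + 4 / ln (2 * (1 - z) / 3)))"
          unfolding X_def by (metis norm_minus_cancel)
        then show ?thesis using * True by (simp add: log_weight_def R_def)
      next
        case False
        then show ?thesis using * \<open>\<not> z \<le> 1/2\<close> by (simp add: log_weight_def log_profile_def X_def sw)
      qed
      then have "log_weight L z * (log_weight R (1 - z) * X) \<le> 4 * C2"
        using log_weight_far[of z L] z False r2 by (intro mult_mono) (auto simp: log_weight_nonneg X_def)
      moreover have "norm (riccati_U s t k A B (of_real z)) \<le> C2" unfolding sw norm_minus_cancel using * by blast
      ultimately show "lincomb s t k A B (of_real z) \<noteq> 0 \<and> norm (riccati_U s t k A B (of_real z)) \<le> 4 * C1 + 4 * C2 \<and>
          log_weight L z * log_weight R (1 - z) * X \<le> 4 * C1 + 4 * C2"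
        using * r1 r2 unfolding sw(1) by (auto simp: mult_ac)
    qed
  qed (use r1 r2 in \<open>auto simp: r_def\<close>)
qed

section \<open>Holomorphic extension of the solution map\<close>

text \<open>The pairs (1, 0) and (0, 1) for l = 2 and l = 3 are the extremal solutions; their
  normalisation is free because U depends only on the ratio of A and B.\<close>

definition A_coef :: "nat \<Rightarrow> 'a::{real_normed_field,banach} \<Rightarrow> 'a \<Rightarrow> 'a \<Rightarrow> 'a \<Rightarrow> 'a" where
  "A_coef l \<gamma> s t k = (if l = 1 then hyp 1 t s k (1/2) + (\<gamma> - s + t) * hyp 0 t s k (1/2) else if l = 2 then 1 else 0)"

definition B_coef :: "nat \<Rightarrow> 'a::{real_normed_field,banach} \<Rightarrow> 'a \<Rightarrow> 'a \<Rightarrow> 'a \<Rightarrow> 'a" where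
  "B_coef l \<gamma> s t k = (if l = 1 then hyp 1 s t k (1/2) - (\<gamma> - s + t) * hyp 0 s t k (1/2) else if l = 2 then 0 else 1)"

text \<open>The coordinates fixed on \<open>Ikl k l\<close> are replaced by their values, as in \<open>eff_c\<close>: a complex
  neighbourhood must not leave \<open>s = 0\<close> or \<open>t = 0\<close>, where the square root branches.\<close>
definition s_par :: "nat \<Rightarrow> complex^5 \<Rightarrow> complex" where
  "s_par k q = (if k = 2 \<or> k = 4 then 0 else csqrt (1 + q$1))"

definition t_par :: "nat \<Rightarrow> complex^5 \<Rightarrow> complex" where
  "t_par k q = (if k = 3 \<or> k = 4 then 0 else csqrt (1 + q$2))"

definition k_par :: "nat \<Rightarrow> complex^5 \<Rightarrow> complex" where
  "k_par k q = (q$3 + (s_par k q + t_par k q) * (s_par k q + t_par k q + 2) / 2) / 2"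

definition A_par :: "nat \<Rightarrow> nat \<Rightarrow> complex^5 \<Rightarrow> complex" where
  "A_par k l q = A_coef l (q$4) (s_par k q) (t_par k q) (k_par k q)"

definition B_par :: "nat \<Rightarrow> nat \<Rightarrow> complex^5 \<Rightarrow> complex" where
  "B_par k l q = B_coef l (q$4) (s_par k q) (t_par k q) (k_par k q)"

definition f_ext :: "nat \<Rightarrow> nat \<Rightarrow> complex^5 \<Rightarrow> complex" where
  "f_ext k l q = lincomb (s_par k q) (t_par k q) (k_par k q) (A_par k l q) (B_par k l q) ((1 + q$5) / 2)"

definition U_ext :: "nat \<Rightarrow> nat \<Rightarrow> complex^5 \<Rightarrow> complex" where
  "U_ext k l q = riccati_U (s_par k q) (t_par k q) (k_par k q) (A_par k l q) (B_par k l q) ((1 + q$5) / 2)"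

text \<open>On Re c1 > -1 the principal root of 1 + c1 is holomorphic with positive real part, and
  likewise for c2; for a frozen coordinate the root is the constant 0.\<close>

definition Pdom :: "nat \<Rightarrow> (complex^5) set" where
  "Pdom k = {q. k \<in> {2,4} \<or> Re (q$1) > -1} \<inter> {q. k \<in> {3,4} \<or> Re (q$2) > -1}"

definition Zdom :: "nat \<Rightarrow> (complex^5) set" where
  "Zdom k = Pdom k \<inter> {q. norm ((1 + q$5) / 2) < 1 \<and> norm (1 - (1 + q$5) / 2) < 1}"

definition Udom :: "nat \<Rightarrow> nat \<Rightarrow> (complex^5) set" where
  "Udom k l = Zdom k \<inter> f_ext k l -` (- {0})"

lemma open_Pdom: "open (Pdom k)"
proof -
  have "open {q :: complex^5. Re (q $ i) > -1}" for i
    by (intro open_Collect_less continuous_intros)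
  then show ?thesis
    unfolding Pdom_def by (intro open_Int) (cases "k \<in> {2,4}"; cases "k \<in> {3,4}"; simp)+
qed

lemma open_Zdom: "open (Zdom k)"
  unfolding Zdom_def
  by (intro open_Int open_Pdom open_Collect_conj open_Collect_less continuous_intros) auto

lemma holomorphic_csqrt_right: "csqrt holomorphic_on {w. Re w > 0}"
  by (intro holomorphic_on_subset[OF holomorphic_on_csqrt]) (auto simp: complex_nonpos_Reals_iff)

lemma sep_holo_st: "sep_holo (Pdom k) (s_par k)" "sep_holo (Pdom k) (t_par k)"
proof -
  have c: "sep_holo (Pdom k) (\<lambda>q. c)" for c by (rule sep_holo_const[OF open_Pdom])
  have n: "sep_holo (Pdom k) (\<lambda>q. 1 + q $ i)" for i
    by (intro sep_holo_add c sep_holo_nth open_Pdom)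
  have op: "open {w. Re w > 0}" by (rule open_halfspace_Re_gt)
  show "sep_holo (Pdom k) (s_par k)"
  proof (cases "k = 2 \<or> k = 4")
    case True
    then show ?thesis unfolding s_par_def[abs_def] using c[of 0] by simp
  next
    case False
    have "sep_holo (Pdom k) (\<lambda>q. csqrt (1 + q $ 1))"
      by (rule sep_holo_compose1[OF n holomorphic_csqrt_right op]) (use False in \<open>auto simp: Pdom_def\<close>)
    then show ?thesis unfolding s_par_def[abs_def] using False by simp
  qed
  show "sep_holo (Pdom k) (t_par k)"
  proof (cases "k = 3 \<or> k = 4")
    case True
    then show ?thesis unfolding t_par_def[abs_def] using c[of 0] by simp
  next
    case False
    have "sep_holo (Pdom k) (\<lambda>q. csqrt (1 + q $ 2))"
      by (rule sep_holo_compose1[OF n holomorphic_csqrt_right op]) (use False in \<open>auto simp: Pdom_def\<close>)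
    then show ?thesis unfolding t_par_def[abs_def] using False by simp
  qed
qed

lemma Re_st: "Re (s_par k q) \<ge> 0" "Re (t_par k q) \<ge> 0"
  using Re_csqrt by (simp_all add: s_par_def t_par_def del: csqrt.simps)

lemma sep_holo_k: "sep_holo (Pdom k) (k_par k)"
  unfolding k_par_def[abs_def]
  by (intro sep_holo_divide sep_holo_add sep_holo_mult sep_holo_st sep_holo_nth sep_holo_const open_Pdom) auto

lemma sep_holo_hyp_pars:
  assumes "open S" "S \<subseteq> Pdom k" "sep_holo S z" "\<And>q. q \<in> S \<Longrightarrow> norm (z q) < 1"
  shows "sep_holo S (\<lambda>q. hyp j (s_par k q) (t_par k q) (k_par k q) (z q))"
    and "sep_holo S (\<lambda>q. hyp j (t_par k q) (s_par k q) (k_par k q) (z q))"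
proof -
  have st: "Re (s_par k q) > -1/2" "Re (t_par k q) > -1/2" for q
    using Re_st[where k = k and q = q] by linarith+
  have sub: "sep_holo S (s_par k)" "sep_holo S (t_par k)" "sep_holo S (k_par k)"
    by (rule sep_holo_subset[OF _ assms(1,2)], rule sep_holo_st sep_holo_k)+
  show "sep_holo S (\<lambda>q. hyp j (s_par k q) (t_par k q) (k_par k q) (z q))"
    by (rule sep_holo_hyp[OF sub assms(3)]) (intro conjI st assms(4))
  show "sep_holo S (\<lambda>q. hyp j (t_par k q) (s_par k q) (k_par k q) (z q))"
    by (rule sep_holo_hyp[OF sub(2,1,3) assms(3)]) (intro conjI st assms(4))
qed

lemma sep_holo_AB: "sep_holo (Pdom k) (A_par k l)" "sep_holo (Pdom k) (B_par k l)"
proof -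
  have c: "sep_holo (Pdom k) (\<lambda>q. c)" for c by (rule sep_holo_const[OF open_Pdom])
  have h: "sep_holo (Pdom k) (\<lambda>q. hyp j (s_par k q) (t_par k q) (k_par k q) (1/2))"
    "sep_holo (Pdom k) (\<lambda>q. hyp j (t_par k q) (s_par k q) (k_par k q) (1/2))" for j
    by (rule sep_holo_hyp_pars[OF open_Pdom order_refl c]; simp)+
  have m: "sep_holo (Pdom k) (\<lambda>q. q$4 - s_par k q + t_par k q)"
    by (intro sep_holo_add sep_holo_diff sep_holo_st sep_holo_nth open_Pdom)
  have "sep_holo (Pdom k) (\<lambda>q. hyp 1 (t_par k q) (s_par k q) (k_par k q) (1/2) + (q$4 - s_par k q + t_par k q) * hyp 0 (t_par k q) (s_par k q) (k_par k q) (1/2))"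
    by (intro sep_holo_add sep_holo_mult m h)
  then show "sep_holo (Pdom k) (A_par k l)"
    unfolding A_par_def[abs_def] A_coef_def using c[of 0] c[of 1] by (cases "l = 1"; cases "l = 2") simp_all
  have "sep_holo (Pdom k) (\<lambda>q. hyp 1 (s_par k q) (t_par k q) (k_par k q) (1/2) - (q$4 - s_par k q + t_par k q) * hyp 0 (s_par k q) (t_par k q) (k_par k q) (1/2))"
    by (intro sep_holo_diff sep_holo_mult m h)
  then show "sep_holo (Pdom k) (B_par k l)"
    unfolding B_par_def[abs_def] B_coef_def using c[of 0] c[of 1] by (cases "l = 1"; cases "l = 2") simp_all
qed

lemma Zdom_subset: "Zdom k \<subseteq> Pdom k" by (simp add: Zdom_def)

lemma sep_holo_lincomb:
  shows "sep_holo (Zdom k) (f_ext k l)"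
    and "sep_holo (Zdom k) (\<lambda>q. lincomb1 (s_par k q) (t_par k q) (k_par k q) (A_par k l q) (B_par k l q) ((1 + q$5) / 2))"
proof -
  note sub = sep_holo_subset[OF _ open_Zdom Zdom_subset]
  have c: "sep_holo (Zdom k) (\<lambda>q. c)" for c by (rule sep_holo_const[OF open_Zdom])
  have z: "sep_holo (Zdom k) (\<lambda>q. (1 + q$5) / 2)"
    by (intro sep_holo_divide sep_holo_add c sep_holo_nth open_Zdom) auto
  have z': "sep_holo (Zdom k) (\<lambda>q. 1 - (1 + q$5) / 2)"
    by (intro sep_holo_diff c z)
  have h: "sep_holo (Zdom k) (\<lambda>q. hyp j (s_par k q) (t_par k q) (k_par k q) ((1 + q$5) / 2))"
    "sep_holo (Zdom k) (\<lambda>q. hyp j (t_par k q) (s_par k q) (k_par k q) (1 - (1 + q$5) / 2))" for j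
    by (rule sep_holo_hyp_pars(1)[OF open_Zdom Zdom_subset z], simp add: Zdom_def)
      (rule sep_holo_hyp_pars(2)[OF open_Zdom Zdom_subset z'], simp add: Zdom_def)
  show "sep_holo (Zdom k) (f_ext k l)"
    unfolding f_ext_def[abs_def] lincomb_def
    by (intro sep_holo_add sep_holo_mult h sub sep_holo_AB)
  show "sep_holo (Zdom k) (\<lambda>q. lincomb1 (s_par k q) (t_par k q) (k_par k q) (A_par k l q) (B_par k l q) ((1 + q$5) / 2))"
    unfolding lincomb1_def
    by (intro sep_holo_diff sep_holo_mult h sub sep_holo_AB)
qed

lemma open_Udom: "open (Udom k l)"
  unfolding Udom_def
  by (intro continuous_open_preimage open_Zdom) (use sep_holo_lincomb(1) in \<open>auto simp: sep_holo_def\<close>)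

lemma sep_holo_U_ext: "sep_holo (Udom k l) (U_ext k l)"
proof -
  have UZ: "Udom k l \<subseteq> Zdom k" "Udom k l \<subseteq> Pdom k" by (auto simp: Udom_def Zdom_def)
  note subZ = sep_holo_subset[OF _ open_Udom UZ(1)]
  note subP = sep_holo_subset[OF _ open_Udom UZ(2)]
  have c: "sep_holo (Udom k l) (\<lambda>q. c)" for c by (rule sep_holo_const[OF open_Udom])
  have z: "sep_holo (Udom k l) (\<lambda>q. (1 + q$5) / 2)"
    by (intro sep_holo_divide sep_holo_add c sep_holo_nth open_Udom) auto
  have "sep_holo (Udom k l) (\<lambda>q. lincomb1 (s_par k q) (t_par k q) (k_par k q) (A_par k l q) (B_par k l q) ((1 + q$5) / 2) / f_ext k l q)"
    by (rule sep_holo_divide[OF subZ[OF sep_holo_lincomb(2)] subZ[OF sep_holo_lincomb(1)]]) (simp add: Udom_def)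
  then have r: "sep_holo (Udom k l) (\<lambda>q. lincomb1 (s_par k q) (t_par k q) (k_par k q) (A_par k l q) (B_par k l q) ((1 + q$5) / 2)
      / lincomb (s_par k q) (t_par k q) (k_par k q) (A_par k l q) (B_par k l q) ((1 + q$5) / 2))"
    by (simp only: f_ext_def)
  show ?thesis
    unfolding U_ext_def[abs_def] riccati_U_def
    by (intro sep_holo_add sep_holo_diff sep_holo_mult r z c subP[OF sep_holo_st(1)] subP[OF sep_holo_st(2)])
qed

section \<open>Values at real points, and an open real neighbourhood of the cylinder\<close>

lemma AB_coef_of_real:
  fixes s t k \<gamma> :: real
  assumes "s \<ge> 0" "t \<ge> 0"
  shows "A_coef l (complex_of_real \<gamma>) (of_real s) (of_real t) (of_real k) = of_real (A_coef l \<gamma> s t k)"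
    and "B_coef l (complex_of_real \<gamma>) (of_real s) (of_real t) (of_real k) = of_real (B_coef l \<gamma> s t k)"
  using hyp_of_real[of s "1/2" _ t k] hyp_of_real[of t "1/2" _ s k] assms
  by (simp_all add: A_coef_def B_coef_def)

text \<open>Only the coordinates that are free on the stratum have to match c and \<gamma>; this
  makes it applicable to points with arbitrary dummy coordinates.\<close>

lemma real_pars:
  fixes c :: "real^3" and q :: "complex^5"
  assumes "k \<in> {2,4} \<longrightarrow> c$1 = -1" "k \<in> {3,4} \<longrightarrow> c$2 = -1" "c$1 \<ge> -1" "c$2 \<ge> -1"
    and "k \<notin> {2,4} \<longrightarrow> q$1 = of_real (c$1)" "k \<notin> {3,4} \<longrightarrow> q$2 = of_real (c$2)"
    and "q$3 = of_real (c$3)" "l = 1 \<longrightarrow> q$4 = of_real \<gamma>"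
  defines "s \<equiv> sqrt (1 + c$1)" and "t \<equiv> sqrt (1 + c$2)" and "\<kappa> \<equiv> (c$3 - cbar3 (c$1) (c$2)) / 2"
  shows "s_par k q = of_real s" "t_par k q = of_real t" "k_par k q = of_real \<kappa>"
    "A_par k l q = of_real (A_coef l \<gamma> s t \<kappa>)" "B_par k l q = of_real (B_coef l \<gamma> s t \<kappa>)"
proof -
  have st: "s \<ge> 0" "t \<ge> 0" using assms by (auto simp: s_def t_def)
  have sqr: "csqrt (1 + complex_of_real x) = of_real (sqrt (1 + x))" if "x \<ge> -1" for x
    using csqrt_of_real_nonneg[of "1 + complex_of_real x"] that by simp
  show 1: "s_par k q = of_real s" "t_par k q = of_real t"
    using assms(1-6) sqr by (auto simp: s_par_def t_par_def s_def t_def)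
  show 2: "k_par k q = of_real \<kappa>"
  proof -
    have ke: "\<kappa> = (c$3 + (s + t) * (s + t + 2) / 2) / 2"
      unfolding \<kappa>_def cbar3_def s_def t_def by simp
    show ?thesis
      unfolding k_par_def 1 assms(7) ke by simp
  qed
  show "A_par k l q = of_real (A_coef l \<gamma> s t \<kappa>)" "B_par k l q = of_real (B_coef l \<gamma> s t \<kappa>)"
    unfolding A_par_def B_par_def 1 2 AB_coef_of_real[OF st, symmetric]
    using assms(8) by (auto simp: A_coef_def B_coef_def)
qed

lemma Jk_pars:
  fixes c :: "real^3"
  assumes "c \<in> Jk k" "1 \<le> k" "k \<le> 4"
  shows "k \<in> {2,4} \<Longrightarrow> c$1 = -1" "k \<in> {3,4} \<Longrightarrow> c$2 = -1" "k \<notin> {2,4} \<Longrightarrow> c$1 > -1" "k \<notin> {3,4} \<Longrightarrow> c$2 > -1"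
    "c$1 \<ge> -1" "c$2 \<ge> -1" "c$3 > cbar3 (c$1) (c$2)"
proof -
  have "k = 1 \<or> k = 2 \<or> k = 3 \<or> k = 4" using assms by linarith
  then show "k \<in> {2,4} \<Longrightarrow> c$1 = -1" "k \<in> {3,4} \<Longrightarrow> c$2 = -1" "k \<notin> {2,4} \<Longrightarrow> c$1 > -1" "k \<notin> {3,4} \<Longrightarrow> c$2 > -1"
    "c$1 \<ge> -1" "c$2 \<ge> -1" "c$3 > cbar3 (c$1) (c$2)"
    using assms by (auto simp: Jk_def Jset_def)
qed

lemma eff_c_nth:
  fixes p :: "real^5"
  shows
  "eff_c k p $ 1 = (if k = 2 \<or> k = 4 then -1 else p$1)" "eff_c k p $ 2 = (if k = 3 \<or> k = 4 then -1 else p$2)"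
  "eff_c k p $ 3 = p$3"
  by (simp_all add: eff_c_def)

lemma cvec_nth [simp]: "(cvec p :: complex^'n::finite) $ i = of_real (p $ i)"
  by (simp add: cvec_def)

text \<open>The cylinder is not open in 5-space, and smoothness is shown on this open superset:
  membership in \<open>Ikl\<close> is replaced by the open conditions k > 0 and, for l = 1, A > 0
  and B > 0, that is gamma^- < gamma < gamma^+.\<close>

definition Ndom :: "nat \<Rightarrow> nat \<Rightarrow> (real^5) set" where
  "Ndom k l = {p. cvec p \<in> Pdom k \<and> -1 < p$5 \<and> p$5 < 1 \<and> Re (k_par k (cvec p)) > 0 \<and>
     (l = 1 \<longrightarrow> Re (A_par k l (cvec p)) > 0 \<and> Re (B_par k l (cvec p)) > 0)}"

lemma open_Ndom: "open (Ndom k l)"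
proof -
  define N0 where "N0 = {p :: real^5. cvec p \<in> Pdom k} \<inter> {p. -1 < p$5 \<and> p$5 < 1}"
  have "continuous_on UNIV (cvec :: real^5 \<Rightarrow> complex^5)"
    using continuous_on_cvec[OF continuous_on_id] by simp
  then have "open ((cvec :: real^5 \<Rightarrow> complex^5) -` Pdom k)"
    using open_Pdom by (intro open_vimage)
  then have N0: "open N0"
    unfolding N0_def by (intro open_Int open_Collect_conj open_Collect_less continuous_intros) (auto simp: vimage_def)
  have comp: "continuous_on N0 (\<lambda>p. Re (h (cvec p)))" if "sep_holo (Pdom k) h" for h
  proof -
    have "continuous_on N0 (\<lambda>p. h (cvec p))"
      by (rule continuous_on_compose2[of "Pdom k" h])
        (use that in \<open>auto simp: sep_holo_def N0_def intro!: continuous_intros\<close>)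
    then show ?thesis by (intro continuous_intros)
  qed
  have op: "open (N0 \<inter> (\<lambda>p. Re (h (cvec p))) -` {0<..})" if "sep_holo (Pdom k) h" for h
    by (intro continuous_open_preimage comp that N0 open_greaterThan)
  have "Ndom k l = (N0 \<inter> (\<lambda>p. Re (k_par k (cvec p))) -` {0<..}) \<inter>
     (if l = 1 then (N0 \<inter> (\<lambda>p. Re (A_par k l (cvec p))) -` {0<..}) \<inter> (N0 \<inter> (\<lambda>p. Re (B_par k l (cvec p))) -` {0<..}) else UNIV)"
    by (auto simp: Ndom_def N0_def)
  also have "open \<dots>"
    using op[OF sep_holo_k] op[OF sep_holo_AB(1)] op[OF sep_holo_AB(2)] by auto
  finally show ?thesis .
qed

text \<open>At real points the extension is real, and f is positive there because A and B are
  nonnegative and not both 0; the corresponding Riccati solution is the one selected by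
  \<open>Usol\<close>.\<close>

lemma Ndom_facts:
  assumes p: "p \<in> Ndom k l" and kl: "1 \<le> k" "k \<le> 4" "1 \<le> l" "l \<le> 3"
  shows "cvec p \<in> Udom k l" "Fmap k l p = Re (U_ext k l (cvec p))"
proof -
  define c where "c = eff_c k p"
  define s t \<kappa> where "s = sqrt (1 + c$1)" and "t = sqrt (1 + c$2)" and "\<kappa> = (c$3 - cbar3 (c$1) (c$2)) / 2"
  define A B where "A = A_coef l (p$4) s t \<kappa>" and "B = B_coef l (p$4) s t \<kappa>"
  define z where "z = (1 + p$5) / 2"
  have z: "0 < z" "z < 1" "z = (1 + p$5) / 2" and p5: "-1 < p$5" "p$5 < 1"
    using p by (auto simp: Ndom_def z_def)
  have c1: "k \<in> {2,4} \<longrightarrow> c$1 = -1" "k \<in> {3,4} \<longrightarrow> c$2 = -1" "c$1 \<ge> -1" "c$2 \<ge> -1"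
    "k \<notin> {2,4} \<longrightarrow> cvec p$1 = of_real (c$1)" "k \<notin> {3,4} \<longrightarrow> cvec p$2 = of_real (c$2)"
    "cvec p$3 = of_real (c$3)" "l = 1 \<longrightarrow> cvec p$4 = of_real (p$4)"
    using p by (auto simp: c_def eff_c_nth Ndom_def Pdom_def)
  note par = real_pars[OF c1, folded s_def t_def \<kappa>_def, folded A_def B_def]
  have \<kappa>: "\<kappa> > 0" using p par(3) by (simp add: Ndom_def)
  interpret riccati_params c s t \<kappa>
    using riccati_paramsI[of c] c1 \<kappa> by (simp add: s_def t_def \<kappa>_def)
  have AB: "A \<ge> 0" "B \<ge> 0" "A + B > 0" "l = 1 \<Longrightarrow> A > 0 \<and> B > 0"
    using p par(4,5) by (auto simp: Ndom_def A_def B_def A_coef_def B_coef_def)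
  have zc: "(1 + cvec p $ 5) / 2 = of_real z" by (simp add: z_def)
  have f: "f_ext k l (cvec p) = of_real (lincomb s t \<kappa> A B z)"
    unfolding f_ext_def par zc using st z by (intro lincomb_of_real)
  have U: "U_ext k l (cvec p) = of_real (riccati_U s t \<kappa> A B z)"
    unfolding U_ext_def par zc using st z by (intro riccati_U_of_real)
  have "lincomb s t \<kappa> A B z > 0" using AB z by (intro lincomb_pos)
  then show "cvec p \<in> Udom k l"
    using p f z of_real_unit_norms[OF z(1,2)] unfolding Udom_def Zdom_def zc[symmetric] by (auto simp: Ndom_def)
  have l: "l = 1 \<or> l = 2 \<or> l = 3" using kl by linarith
  then have "Fmap k l p = riccati_U s t \<kappa> A B z"
  proof (elim disjE)
    assume l: "l = 1"
    then show ?thesis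
      using Usol_between[of "p$4" "p$5"] AB(4) p5
      by (simp add: Fmap_def eff_g_def c_def[symmetric] A_def B_def A_coef_def B_coef_def z_def)
  next
    assume l: "l = 2"
    then show ?thesis
      using Usol_gamma_plus[OF p5]
      by (simp add: Fmap_def eff_g_def c_def[symmetric] A_def B_def A_coef_def B_coef_def z_def)
  next
    assume l: "l = 3"
    then show ?thesis
      using Usol_gamma_minus[OF p5]
      by (simp add: Fmap_def eff_g_def c_def[symmetric] A_def B_def A_coef_def B_coef_def z_def)
  qed
  then show "Fmap k l p = Re (U_ext k l (cvec p))" by (simp add: U)
qed

text \<open>The strata are told apart by which of s, t, A, B vanish; this translates k and l into
  the regimes at the two endpoints.\<close>

lemma Ikl_pars:
  fixes c :: "real^3"
  assumes "(c, \<gamma>) \<in> Ikl k l" and kl: "1 \<le> k" "k \<le> 4" "1 \<le> l" "l \<le> 3"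
  defines "s \<equiv> sqrt (1 + c$1)" and "t \<equiv> sqrt (1 + c$2)" and "\<kappa> \<equiv> (c$3 - cbar3 (c$1) (c$2)) / 2"
  shows "s \<ge> 0" "t \<ge> 0" "\<kappa> > 0" "A_coef l \<gamma> s t \<kappa> \<ge> 0" "B_coef l \<gamma> s t \<kappa> \<ge> 0" "A_coef l \<gamma> s t \<kappa> + B_coef l \<gamma> s t \<kappa> > 0"
    "s = 0 \<longleftrightarrow> k \<in> {2,4}" "t = 0 \<longleftrightarrow> k \<in> {3,4}"
    "A_coef l \<gamma> s t \<kappa> > 0 \<longleftrightarrow> l \<noteq> 3" "B_coef l \<gamma> s t \<kappa> > 0 \<longleftrightarrow> l \<noteq> 2"
proof -
  have c: "c \<in> Jk k" using assms by (simp add: Ikl_def)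
  note J = Jk_pars[OF c kl(1,2)]
  interpret riccati_params c s t \<kappa>
    using riccati_paramsI[of c] J by (simp add: s_def t_def \<kappa>_def)
  show "s \<ge> 0" "t \<ge> 0" "\<kappa> > 0" by (rule st k)+
  show "s = 0 \<longleftrightarrow> k \<in> {2,4}"
    using J(1,3) unfolding s_def real_sqrt_eq_zero_cancel_iff by (cases "k \<in> {2,4}") force+
  show "t = 0 \<longleftrightarrow> k \<in> {3,4}"
    using J(2,4) unfolding t_def real_sqrt_eq_zero_cancel_iff by (cases "k \<in> {3,4}") force+
  have l1: "l = 1 \<Longrightarrow> A_coef l \<gamma> s t \<kappa> > 0 \<and> B_coef l \<gamma> s t \<kappa> > 0"
    using assms(1) coef_pos_iff[of \<gamma>] by (auto simp: Ikl_def A_coef_def B_coef_def)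
  have "l = 1 \<or> l = 2 \<or> l = 3" using kl by linarith
  then show "A_coef l \<gamma> s t \<kappa> \<ge> 0" "B_coef l \<gamma> s t \<kappa> \<ge> 0" "A_coef l \<gamma> s t \<kappa> + B_coef l \<gamma> s t \<kappa> > 0"
    "A_coef l \<gamma> s t \<kappa> > 0 \<longleftrightarrow> l \<noteq> 3" "B_coef l \<gamma> s t \<kappa> > 0 \<longleftrightarrow> l \<noteq> 2"
    using l1 by (auto simp: A_coef_def B_coef_def)
qed

lemma cyl_subset_Ndom:
  assumes K: "K \<subseteq> Ikl k l" and kl: "1 \<le> k" "k \<le> 4" "1 \<le> l" "l \<le> 3"
  shows "cyl k l K \<subseteq> Ndom k l"
proof
  fix p assume "p \<in> cyl k l K"
  then have I: "(eff_c k p, eff_g k l p) \<in> Ikl k l" and p5: "-1 < p$5" "p$5 < 1"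
    using K by (auto simp: cyl_def)
  define c where "c = eff_c k p"
  have c: "c \<in> Jk k" using I by (simp add: Ikl_def c_def)
  note J = Jk_pars[OF c kl(1,2)]
  have q: "k \<notin> {2,4} \<longrightarrow> cvec p$1 = of_real (c$1)" "k \<notin> {3,4} \<longrightarrow> cvec p$2 = of_real (c$2)"
    "cvec p$3 = of_real (c$3)" "l = 1 \<longrightarrow> cvec p$4 = of_real (eff_g k l p)"
    by (auto simp: c_def eff_c_nth eff_g_def)
  have J12: "k \<in> {2,4} \<longrightarrow> c$1 = -1" "k \<in> {3,4} \<longrightarrow> c$2 = -1"
    using J(1,2) by blast+
  note par = real_pars[OF J12 J(5,6) q]
  note Ik = Ikl_pars[OF I kl, folded c_def]
  have "cvec p \<in> Pdom k"
    unfolding Pdom_def Int_iff mem_Collect_eq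
    using J(3,4) q(1,2) by (metis Re_complex_of_real)
  then show "p \<in> Ndom k l"
    using p5 Ik(3,9,10) unfolding Ndom_def mem_Collect_eq par Re_complex_of_real by (cases "l = 1") simp_all
qed

lemma five_exhaust: "(i::5) = 1 \<or> i = 2 \<or> i = 3 \<or> i = 4 \<or> i = 5"
proof (induct i)
  case (of_int z)
  then have "0 \<le> z" "z < 5" by simp_all
  then have "z = 0 \<or> z = 1 \<or> z = 2 \<or> z = 3 \<or> z = 4" by arith
  then show ?case by auto
qed

lemma five_notin: "(5::5) \<notin> {1,2,3,4}" by simp

text \<open>The parameters as a point of complex 5-space; x is supplied separately, as the last
  coordinate of q in \<open>good\<close>.\<close>

definition base_point :: "(real^3) \<times> real \<Rightarrow> complex^5" where
  "base_point y = vector [of_real (fst y $ 1), of_real (fst y $ 2), of_real (fst y $ 3), of_real (snd y), 0]"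

section \<open>Compactness and conclusion\<close>

text \<open>\<open>s_par\<close>, \<open>t_par\<close>, \<open>A_par\<close> and
  \<open>B_par\<close> ignore the coordinates that are dummies on the stratum.\<close>

lemma pars_cong:
  fixes q w :: "complex^5"
  assumes "k \<notin> {2,4} \<longrightarrow> w$1 = q$1" "k \<notin> {3,4} \<longrightarrow> w$2 = q$2" "w$3 = q$3" "l = 1 \<longrightarrow> w$4 = q$4" "w$5 = q$5"
  shows "w \<in> Udom k l \<longleftrightarrow> q \<in> Udom k l" "U_ext k l w = U_ext k l q"
proof -
  have st: "s_par k w = s_par k q" "t_par k w = t_par k q" using assms by (auto simp: s_par_def t_par_def)
  then have kk: "k_par k w = k_par k q" using assms by (simp add: k_par_def)
  have AB: "A_par k l w = A_par k l q" "B_par k l w = B_par k l q"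
    unfolding A_par_def B_par_def st kk using assms(4) by (auto simp: A_coef_def B_coef_def)
  have "w \<in> Pdom k \<longleftrightarrow> q \<in> Pdom k" using assms(1,2) by (auto simp: Pdom_def)
  then show "w \<in> Udom k l \<longleftrightarrow> q \<in> Udom k l" "U_ext k l w = U_ext k l q"
    unfolding Udom_def Zdom_def U_ext_def f_ext_def st kk AB assms(5) by (auto simp: f_ext_def st kk AB assms(5))
qed

definition Ubound :: "nat \<Rightarrow> nat \<Rightarrow> real \<Rightarrow> complex^5 \<Rightarrow> real \<Rightarrow> bool" where
  "Ubound k l C q x \<longleftrightarrow> q \<in> Udom k l \<and> norm (U_ext k l q) \<le> C \<and>
     log_weight (k \<in> {2,4} \<and> l \<noteq> 2) ((1 + x) / 2) * log_weight (k \<in> {3,4} \<and> l \<noteq> 3) ((1 - x) / 2) *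
       norm (U_ext k l q - of_real (log_profile (k \<in> {2,4} \<and> l \<noteq> 2) (k \<in> {3,4} \<and> l \<noteq> 3) ((1 + x) / 2))) \<le> C"

text \<open>One radius e and one bound C for all x in (-1,1), as needed for Cauchy's estimates with
  x frozen.\<close>

definition good :: "nat \<Rightarrow> nat \<Rightarrow> real \<Rightarrow> real \<Rightarrow> (real^3) \<times> real \<Rightarrow> bool" where
  "good k l e C y \<longleftrightarrow> (\<forall>q x. (\<forall>i\<in>{1,2,3,4}. norm (q$i - base_point y $ i) < e) \<longrightarrow> q$5 = complex_of_real x \<longrightarrow>
     -1 < x \<longrightarrow> x < 1 \<longrightarrow> Ubound k l C q x)"

lemma base_point_nth:
  "base_point y $ 1 = of_real (fst y $ 1)" "base_point y $ 2 = of_real (fst y $ 2)" "base_point y $ 3 = of_real (fst y $ 3)"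
  "base_point y $ 4 = of_real (snd y)"
  unfolding base_point_def vector_def by simp_all

lemma norm_vec5_le: "norm (v :: complex^5) \<le> norm (v$1) + norm (v$2) + norm (v$3) + norm (v$4) + norm (v$5)"
proof -
  have U: "(UNIV :: 5 set) = {1,2,3,4,5}" using five_exhaust by auto
  have "norm v \<le> (\<Sum>i\<in>UNIV. norm (v $ i))"
    unfolding norm_vec_def by (rule L2_set_le_sum) simp
  also have "\<dots> = norm (v$1) + norm (v$2) + norm (v$3) + norm (v$4) + norm (v$5)"
    unfolding U by simp
  finally show ?thesis .
qed

text \<open>Continuity of the parameter map carries the box of \<open>parameter_nbhd_bound\<close>
  back to a neighbourhood of (c, \<gamma>); parameters that vanish on the stratum stay exactly 0 by
  construction of \<open>s_par\<close>, \<open>t_par\<close>, \<open>A_par\<close>,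
  \<open>B_par\<close>.\<close>

lemma exists_good:
  assumes y: "y \<in> Ikl k l" and kl: "1 \<le> k" "k \<le> 4" "1 \<le> l" "l \<le> 3"
  shows "\<exists>e>0. \<exists>C. good k l e C y"
proof -
  obtain c \<gamma> where y': "y = (c, \<gamma>)" by force
  define s0 t0 \<kappa>0 where "s0 = sqrt (1 + c$1)" and "t0 = sqrt (1 + c$2)" and "\<kappa>0 = (c$3 - cbar3 (c$1) (c$2)) / 2"
  define A0 B0 where "A0 = A_coef l \<gamma> s0 t0 \<kappa>0" and "B0 = B_coef l \<gamma> s0 t0 \<kappa>0"
  note I = Ikl_pars[OF y[unfolded y'] kl, folded s0_def t0_def \<kappa>0_def, folded A0_def B0_def]
  have c: "c \<in> Jk k" using y y' by (simp add: Ikl_def)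
  note J = Jk_pars[OF c kl(1,2)]
  obtain r C where r: "0 < r" "0 < C" and C: "\<And>s t k A B z. ((s,t,k),A,B) \<in> param_box s0 t0 \<kappa>0 A0 B0 r \<Longrightarrow>
       (s0 = 0 \<longrightarrow> s = 0) \<Longrightarrow> (t0 = 0 \<longrightarrow> t = 0) \<Longrightarrow> (A0 = 0 \<longrightarrow> A = 0) \<Longrightarrow> (B0 = 0 \<longrightarrow> B = 0) \<Longrightarrow>
       0 < z \<Longrightarrow> z < 1 \<Longrightarrow> lincomb s t k A B (of_real z) \<noteq> 0 \<and> norm (riccati_U s t k A B (of_real z)) \<le> C \<and>
       log_weight (s0 = 0 \<and> B0 > 0) z * log_weight (t0 = 0 \<and> A0 > 0) (1 - z) * norm (riccati_U s t k A B (of_real z) -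
          of_real (log_profile (s0 = 0 \<and> B0 > 0) (t0 = 0 \<and> A0 > 0) z)) \<le> C"
    by (rule parameter_nbhd_bound[OF I(1-6)]) (rule that; assumption)
  have LR: "(s0 = 0 \<and> B0 > 0) = (k \<in> {2,4} \<and> l \<noteq> 2)" "(t0 = 0 \<and> A0 > 0) = (k \<in> {3,4} \<and> l \<noteq> 3)"
    by (simp_all only: I(7-10))
  define b where "b = base_point y"
  have bP: "b \<in> Pdom k"
    unfolding b_def Pdom_def Int_iff mem_Collect_eq base_point_nth y' fst_conv Re_complex_of_real using J(3,4) by blast
  have J12: "k \<in> {2,4} \<longrightarrow> c$1 = -1" "k \<in> {3,4} \<longrightarrow> c$2 = -1"
    using J(1,2) by blast+
  have bq: "k \<notin> {2,4} \<longrightarrow> b$1 = of_real (c$1)" "k \<notin> {3,4} \<longrightarrow> b$2 = of_real (c$2)"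
    "b$3 = of_real (c$3)" "l = 1 \<longrightarrow> b$4 = of_real \<gamma>"
    by (simp_all add: b_def base_point_nth y')
  note par = real_pars[OF J12 J(5,6) bq, folded s0_def t0_def \<kappa>0_def, folded A0_def B0_def]
  define \<Phi> where "\<Phi> q = ((s_par k q, t_par k q, k_par k q), A_par k l q, B_par k l q)" for q
  have "continuous_on (Pdom k) \<Phi>"
    unfolding \<Phi>_def using sep_holo_st[of k] sep_holo_k[of k] sep_holo_AB[of k l]
    by (intro continuous_on_Pair) (auto simp: sep_holo_def)
  then have "open (Pdom k \<inter> \<Phi> -` ((ball (of_real s0) r \<times> ball (of_real t0) r \<times> ball (of_real \<kappa>0) r) \<times> ball (of_real A0) r \<times> ball (of_real B0) r))"
    by (intro continuous_open_preimage open_Pdom open_Times open_ball)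
  moreover have "b \<in> Pdom k \<inter> \<Phi> -` ((ball (of_real s0) r \<times> ball (of_real t0) r \<times> ball (of_real \<kappa>0) r) \<times> ball (of_real A0) r \<times> ball (of_real B0) r)"
    using bP r par by (simp add: \<Phi>_def)
  ultimately obtain e where e: "e > 0" "ball b e \<subseteq> Pdom k \<inter> \<Phi> -` ((ball (of_real s0) r \<times> ball (of_real t0) r \<times> ball (of_real \<kappa>0) r) \<times> ball (of_real A0) r \<times> ball (of_real B0) r)"
    using open_contains_ball by meson
  \<comment> \<open>Four coordinates, each off by less than e/5, and no error in the fifth.\<close>
  have "good k l (e / 5) C y"
    unfolding good_def
  proof (intro allI impI)
    fix q :: "complex^5" and x :: real
    assume q: "\<forall>i\<in>{1,2,3,4}. norm (q $ i - base_point y $ i) < e / 5" and q5: "q $ 5 = of_real x" and x: "-1 < x" "x < 1"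
    \<comment> \<open>q may be far from b because its last entry is x; the parameters do not see
      that entry, so it is replaced by the one of b.\<close>
    define w where "w = (\<chi> i. if i = 5 then b $ 5 else q $ i)"
    have w: "w$1 = q$1" "w$2 = q$2" "w$3 = q$3" "w$4 = q$4" "w$5 = b$5" by (simp_all add: w_def)
    have "norm (w - b) \<le> norm (w$1 - b$1) + norm (w$2 - b$2) + norm (w$3 - b$3) + norm (w$4 - b$4) + norm (w$5 - b$5)"
      using norm_vec5_le[of "w - b"] by simp
    also have "\<dots> < e" using q e(1) unfolding w b_def[symmetric] by auto
    finally have "w \<in> ball b e" by (simp add: dist_norm norm_minus_commute)
    then have wP: "w \<in> Pdom k" and w\<Phi>: "\<Phi> w \<in> (ball (of_real s0) r \<times> ball (of_real t0) r \<times> ball (of_real \<kappa>0) r) \<times> ball (of_real A0) r \<times> ball (of_real B0) r"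
      using e(2) by auto
    have eq: "s_par k w = s_par k q" "t_par k w = t_par k q" "k_par k w = k_par k q" by (simp_all add: s_par_def t_par_def k_par_def w)
    have eqA: "A_par k l w = A_par k l q" "B_par k l w = B_par k l q" by (simp_all add: A_par_def B_par_def w eq)
    have qP: "q \<in> Pdom k" using wP by (simp add: Pdom_def w)
    have box: "((s_par k q, t_par k q, k_par k q), A_par k l q, B_par k l q) \<in> param_box s0 t0 \<kappa>0 A0 B0 r"
      using w\<Phi> by (auto simp: \<Phi>_def param_box_def pbox_def eq eqA)
    define z where "z = (1 + x) / 2"
    have z: "0 < z" "z < 1" "1 - z = (1 - x) / 2" using x by (auto simp: z_def field_simps)
    have zc: "(1 + q $ 5) / 2 = of_real z" by (simp add: z_def q5)
    have imp: "s0 = 0 \<longrightarrow> s_par k q = 0" "t0 = 0 \<longrightarrow> t_par k q = 0" "A0 = 0 \<longrightarrow> A_par k l q = 0" "B0 = 0 \<longrightarrow> B_par k l q = 0"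
    proof -
      have "A0 = 0 \<Longrightarrow> l = 3" "B0 = 0 \<Longrightarrow> l = 2" using I(9,10) by auto
      then show "s0 = 0 \<longrightarrow> s_par k q = 0" "t0 = 0 \<longrightarrow> t_par k q = 0" "A0 = 0 \<longrightarrow> A_par k l q = 0" "B0 = 0 \<longrightarrow> B_par k l q = 0"
        unfolding I(7,8) by (auto simp: s_par_def t_par_def A_par_def B_par_def A_coef_def B_coef_def)
    qed
    note F = C[OF box imp z(1,2), unfolded LR]
    have "q \<in> Udom k l"
      unfolding Udom_def Zdom_def Int_iff mem_Collect_eq vimage_eq f_ext_def zc
      using qP F of_real_unit_norms[OF z(1,2)] by blast
    then show "Ubound k l C q x"
      using F unfolding Ubound_def U_ext_def zc z(3)[symmetric] z_def[symmetric] by blast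
  qed
  then show ?thesis using e(1) by (intro exI[of _ "e / 5"] conjI exI[of _ C]) auto
qed

lemma good_mono: "good k l e C y \<Longrightarrow> C \<le> C' \<Longrightarrow> e' \<le> e \<Longrightarrow> good k l e' C' y"
  unfolding good_def Ubound_def by (meson order_less_le_trans order_trans)

lemma base_point_dist: "i \<in> {1,2,3,4} \<Longrightarrow> norm (base_point y $ i - base_point y' $ i) \<le> dist y y'"
proof -
  assume "i \<in> {1,2,3,4}"
  moreover have "\<bar>fst y $ j - fst y' $ j\<bar> \<le> dist y y'" for j
  proof -
    have "\<bar>(fst y - fst y') $ j\<bar> \<le> norm (fst y - fst y')" by (rule component_le_norm_cart)
    also have "\<dots> \<le> dist y y'" using dist_fst_le[of y y'] by (simp add: dist_norm)
    finally show ?thesis by simp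
  qed
  moreover have "\<bar>snd y - snd y'\<bar> \<le> dist y y'"
    using dist_snd_le[of y y'] by (simp add: dist_real_def)
  ultimately show ?thesis
    by (auto simp: base_point_nth simp flip: of_real_diff)
qed

lemma good_near:
  assumes "good k l e C y" "dist y y' < e / 2"
  shows "good k l (e / 2) C y'"
  unfolding good_def
proof (intro allI impI)
  fix q :: "complex^5" and x :: real
  assume q: "\<forall>i\<in>{1,2,3,4}. norm (q $ i - base_point y' $ i) < e / 2" and q5: "q $ 5 = of_real x" and x: "-1 < x" "x < 1"
  have "\<forall>i\<in>{1,2,3,4}. norm (q $ i - base_point y $ i) < e"
  proof
    fix i :: 5 assume i: "i \<in> {1,2,3,4}"
    have "norm (q $ i - base_point y $ i) \<le> norm (q $ i - base_point y' $ i) + norm (base_point y' $ i - base_point y $ i)"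
      using norm_triangle_ineq[of "q $ i - base_point y' $ i" "base_point y' $ i - base_point y $ i"] by simp
    also have "\<dots> < e / 2 + e / 2"
      using q i base_point_dist[OF i, of y' y] assms(2) by (intro add_less_le_mono) (auto simp: dist_commute)
    finally show "norm (q $ i - base_point y $ i) < e" by simp
  qed
  with assms(1) q5 x show "Ubound k l C q x"
    unfolding good_def by blast
qed

text \<open>Lebesgue number argument: finitely many balls of half the local radius cover K, and the
  other half absorbs the change of centre.\<close>

lemma uniformly_good:
  assumes K: "compact K" "K \<subseteq> Ikl k l" and kl: "1 \<le> k" "k \<le> 4" "1 \<le> l" "l \<le> 3"
  obtains R C where "R > 0" "C > 0" "\<And>y. y \<in> K \<Longrightarrow> good k l R C y"
proof -
  have "\<forall>y\<in>K. \<exists>e C. e > 0 \<and> good k l e C y"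
    using exists_good[OF _ kl] K(2) by blast
  then obtain e C where eC: "\<And>y. y \<in> K \<Longrightarrow> e y > 0 \<and> good k l (e y) (C y) y"
    by metis
  obtain T where T: "T \<subseteq> K" "finite T" "K \<subseteq> (\<Union>y\<in>T. ball y (e y / 2))"
  proof (rule compactE_image[OF K(1), of K "\<lambda>y. ball y (e y / 2)"])
    show "K \<subseteq> (\<Union>y\<in>K. ball y (e y / 2))" using eC by force
  qed auto
  \<comment> \<open>The inserted 1 keeps the minimum and the maximum defined when K is empty, and
    makes D positive.\<close>
  define R where "R = Min (insert 1 ((\<lambda>y. e y / 2) ` T))"
  define D where "D = Max (insert 1 (C ` T))"
  show ?thesis
  proof (rule that[of R D])
    show "R > 0" unfolding R_def using T eC by (subst Min_gr_iff) auto
    have "1 \<le> D" unfolding D_def using T by (intro Max_ge) auto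
    then show "D > 0" by simp
    fix y assume "y \<in> K"
    then obtain y0 where y0: "y0 \<in> T" "dist y0 y < e y0 / 2" using T(3) by auto
    have "good k l (e y0 / 2) (C y0) y"
      using good_near eC y0 T(1) by blast
    moreover have "C y0 \<le> D" unfolding D_def using T y0 by (intro Max_ge) auto
    moreover have "R \<le> e y0 / 2" unfolding R_def using T y0 by (intro Min_le) auto
    ultimately show "good k l R D y" by (rule good_mono)
  qed
qed

text \<open>The Cauchy estimate is applied to U minus the profile at the fixed x, which is bounded
  by C divided by the weight. The profile is constant in the parameters, so all derivatives of order
  at least 1 inherit this bound; order 0 keeps the plain one.\<close>

lemma derivative_bounds:
  fixes K :: "((real^3) \<times> real) set"
  assumes K: "compact K" "K \<subseteq> Ikl k l" and kl: "1 \<le> k" "k \<le> 4" "1 \<le> l" "l \<le> 3"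
  shows "\<exists>C. \<forall>p\<in>cyl k l K. \<forall>is. set is \<subseteq> {1,2,3,4} \<longrightarrow> length is \<le> m \<longrightarrow>
     (is \<noteq> [] \<longrightarrow> log_weight (k \<in> {2,4} \<and> l \<noteq> 2) ((1 + p$5) / 2) * log_weight (k \<in> {3,4} \<and> l \<noteq> 3) ((1 - p$5) / 2) *
        \<bar>iter_partial is (Fmap k l) p\<bar> \<le> C) \<and> (is = [] \<longrightarrow> \<bar>Fmap k l p\<bar> \<le> C)"
proof -
  define L where "L \<longleftrightarrow> k \<in> {2,4} \<and> l \<noteq> 2"
  define Rr where "Rr \<longleftrightarrow> k \<in> {3,4} \<and> l \<noteq> 3"
  obtain R C where RC: "R > 0" "C > 0" and good: "\<And>y. y \<in> K \<Longrightarrow> good k l R C y"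
    using uniformly_good[OF K kl] by blast
  obtain D where D: "D > 0" and CE: "\<And>is S G (p::complex^5) B T. set is \<subseteq> {1,2,3,4} \<Longrightarrow> length is \<le> m \<Longrightarrow>
     sep_holo S G \<Longrightarrow> polydisc {1,2,3,4} p R \<subseteq> S \<Longrightarrow>
     (\<forall>q\<in>polydisc {1,2,3,4} p R. norm (G q - T) \<le> B) \<Longrightarrow> (is = [] \<longrightarrow> T = 0) \<Longrightarrow>
     norm (iter_cpartial is G p) \<le> D * B"
    using Cauchy_estimate_uniform[OF RC(1), where m = m and I = "{1,2,3,4::5}"] by metis
  show ?thesis
    unfolding L_def[symmetric] Rr_def[symmetric]
  proof (intro exI[of _ "D * C"] ballI allI impI)
    fix p and "is" :: "5 list"
    assume p: "p \<in> cyl k l K" and "is": "set is \<subseteq> {1,2,3,4}" "length is \<le> m"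
    define x where "x = p$5"
    have x: "-1 < x" "x < 1" using p by (auto simp: cyl_def x_def)
    define y where "y = (eff_c k p, eff_g k l p)"
    have y: "y \<in> K" using p by (simp add: cyl_def y_def)
    define \<omega> where "\<omega> = log_weight L ((1 + x) / 2) * log_weight Rr ((1 - x) / 2)"
    define T where "T = complex_of_real (log_profile L Rr ((1 + x) / 2))"
    have wpos: "log_weight b z > 0" if "0 < z" "z < 1" for b z
    proof -
      have "ln (2 * z / 3) < ln 1" using that by (subst ln_less_cancel_iff) auto
      then show ?thesis by (simp add: log_weight_def)
    qed
    have \<omega>: "\<omega> > 0" unfolding \<omega>_def using x by (intro mult_pos_pos wpos) auto
    have mem: "q \<in> Udom k l \<and> norm (U_ext k l q) \<le> C \<and> \<omega> * norm (U_ext k l q - T) \<le> C"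
      if q: "q \<in> polydisc {1,2,3,4} (cvec p) R" for q
    proof -
      \<comment> \<open>The dummy coordinates of p are arbitrary, whereas
        \<open>base_point y\<close> carries the effective values, so they are exchanged before
        \<open>good\<close> is applied.\<close>
      define w where "w = (\<chi> i. if i = 1 \<and> k \<in> {2,4} then base_point y $ 1 else if i = 2 \<and> k \<in> {3,4} then base_point y $ 2
         else if i = 4 \<and> l \<noteq> 1 then base_point y $ 4 else q $ i)"
      have w: "w$1 = (if k \<in> {2,4} then base_point y $ 1 else q$1)" "w$2 = (if k \<in> {3,4} then base_point y $ 2 else q$2)"
        "w$3 = q$3" "w$4 = (if l \<noteq> 1 then base_point y $ 4 else q$4)" "w$5 = q$5"
        by (simp_all add: w_def)
      have qn: "norm (q$1 - of_real (p$1)) < R" "norm (q$2 - of_real (p$2)) < R" "norm (q$3 - of_real (p$3)) < R"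
        "norm (q$4 - of_real (p$4)) < R" and q5: "q$5 = of_real x"
        using q five_notin by (auto simp: polydisc_def x_def)
      have "norm (w$1 - base_point y $ 1) < R" "norm (w$2 - base_point y $ 2) < R" "norm (w$3 - base_point y $ 3) < R" "norm (w$4 - base_point y $ 4) < R"
        using qn RC(1) unfolding w by (auto simp: base_point_nth y_def eff_c_nth eff_g_def)
      then have "w \<in> Udom k l \<and> norm (U_ext k l w) \<le> C \<and> \<omega> * norm (U_ext k l w - T) \<le> C"
        using good[OF y] x w(5) q5 unfolding good_def Ubound_def \<omega>_def T_def L_def Rr_def by auto
      moreover have "w \<in> Udom k l \<longleftrightarrow> q \<in> Udom k l" "U_ext k l w = U_ext k l q"
        by (rule pars_cong; simp add: w)+
      ultimately show ?thesis by simp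
    qed
    have pN: "p \<in> Ndom k l" using cyl_subset_Ndom[OF K(2) kl] p by blast
    have ip: "iter_partial is (Fmap k l) p = Re (iter_cpartial is (U_ext k l) (cvec p))"
      by (rule iter_partial_eq_Re[OF sep_holo_U_ext open_Ndom _ _ pN]) (use Ndom_facts[OF _ kl] in auto)
    show "(is \<noteq> [] \<longrightarrow> log_weight L ((1 + p$5) / 2) * log_weight Rr ((1 - p$5) / 2) * \<bar>iter_partial is (Fmap k l) p\<bar> \<le> D * C)
       \<and> (is = [] \<longrightarrow> \<bar>Fmap k l p\<bar> \<le> D * C)"
    proof (intro conjI impI)
      assume ne: "is \<noteq> []"
      have "norm (iter_cpartial is (U_ext k l) (cvec p)) \<le> D * (C / \<omega>)"
        by (rule CE[OF "is" sep_holo_U_ext, where T = T]) (use mem \<omega> ne in \<open>auto simp: le_divide_eq mult.commute\<close>)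
      then have "\<bar>iter_partial is (Fmap k l) p\<bar> \<le> D * (C / \<omega>)"
        unfolding ip using abs_Re_le_cmod order_trans by blast
      then have "\<omega> * \<bar>iter_partial is (Fmap k l) p\<bar> \<le> \<omega> * (D * (C / \<omega>))"
        using \<omega> by (intro mult_left_mono) auto
      then show "log_weight L ((1 + p$5) / 2) * log_weight Rr ((1 - p$5) / 2) * \<bar>iter_partial is (Fmap k l) p\<bar> \<le> D * C"
        using \<omega> unfolding \<omega>_def[symmetric, unfolded x_def] by simp
    next
      assume "is = []"
      have "norm (iter_cpartial is (U_ext k l) (cvec p)) \<le> D * C"
        by (rule CE[OF "is" sep_holo_U_ext, where T = 0]) (use mem in auto)
      then have "\<bar>iter_partial is (Fmap k l) p\<bar> \<le> D * C"
        unfolding ip using abs_Re_le_cmod order_trans by blast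
      then show "\<bar>Fmap k l p\<bar> \<le> D * C" using \<open>is = []\<close> by simp
    qed
  qed
qed

theorem theorem1p5:
  fixes K :: "((real^3) \<times> real) set" and k l :: nat
  assumes "1 \<le> k" "k \<le> 4" "1 \<le> l" "l \<le> 3"
    and "compact K" and "K \<subseteq> Ikl k l"
  shows "(\<exists>N. open N \<and> cyl k l K \<subseteq> N \<and> C_infinity_on N (Fmap k l))
    \<and> ((k = 1 \<or> (k = 2 \<and> l = 2) \<or> (k = 3 \<and> l = 3)) \<longrightarrow>
         (\<forall>m. \<exists>C. \<forall>p\<in>cyl k l K. \<forall>a1 a2 a3 j.
            a1 + a2 + a3 + j \<le> m \<and> (l \<in> {2, 3} \<longrightarrow> j = 0)
            \<and> (k = 2 \<longrightarrow> a1 = 0) \<and> (k = 3 \<longrightarrow> a2 = 0) \<longrightarrow>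
            \<bar>Dcg a1 a2 a3 j (Fmap k l) p\<bar> \<le> C))
    \<and> ((k, l) \<in> {(2, 1), (2, 3), (4, 3)} \<longrightarrow>
         (\<forall>m. \<exists>C. \<forall>p\<in>cyl k l K. \<forall>a1 a2 a3 j.
            1 \<le> a1 + a2 + a3 + j \<and> a1 + a2 + a3 + j \<le> m \<and> a1 = 0
            \<and> (l = 3 \<longrightarrow> j = 0) \<and> (k = 4 \<longrightarrow> a2 = 0) \<longrightarrow>
            (ln ((1 + p$5) / 3))\<^sup>2 * \<bar>Dcg a1 a2 a3 j (Fmap k l) p\<bar> \<le> C))
    \<and> ((k, l) \<in> {(3, 1), (3, 2), (4, 2)} \<longrightarrow>
         (\<forall>m. \<exists>C. \<forall>p\<in>cyl k l K. \<forall>a1 a2 a3 j.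
            1 \<le> a1 + a2 + a3 + j \<and> a1 + a2 + a3 + j \<le> m \<and> a2 = 0
            \<and> (l = 2 \<longrightarrow> j = 0) \<and> (k = 4 \<longrightarrow> a1 = 0) \<longrightarrow>
            (ln ((1 - p$5) / 3))\<^sup>2 * \<bar>Dcg a1 a2 a3 j (Fmap k l) p\<bar> \<le> C))
    \<and> ((k, l) = (4, 1) \<longrightarrow>
         (\<forall>m. \<exists>C. \<forall>p\<in>cyl k l K. \<forall>a1 a2 a3 j.
            1 \<le> a1 + a2 + a3 + j \<and> a1 + a2 + a3 + j \<le> m \<and> a1 = 0 \<and> a2 = 0 \<longrightarrow>
            (ln ((1 + p$5) / 3))\<^sup>2 * (ln ((1 - p$5) / 3))\<^sup>2
              * \<bar>Dcg a1 a2 a3 j (Fmap k l) p\<bar> \<le> C))"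
proof -
  note kl = assms(1-4)
  \<comment> \<open>The left logarithm occurs when s = 0 and B > 0, i.e. k in {2,4} and l \<noteq>
    2; the right one when t = 0 and A > 0, i.e. k in {3,4} and l \<noteq> 3. The four estimates
    correspond to the four combinations of truth values.\<close>
  define W where "W p = log_weight (k \<in> {2,4} \<and> l \<noteq> 2) ((1 + p$5) / 2) * log_weight (k \<in> {3,4} \<and> l \<noteq> 3) ((1 - p$5) / 2)" for p :: "real^5"
  have smooth: "\<exists>N. open N \<and> cyl k l K \<subseteq> N \<and> C_infinity_on N (Fmap k l)"
    by (intro exI[of _ "Ndom k l"] conjI open_Ndom cyl_subset_Ndom[OF assms(6) kl]
        C_infinity_on_Re[OF sep_holo_U_ext open_Ndom]) (use Ndom_facts[OF _ kl] in auto)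
  have bd: "\<exists>C. \<forall>p\<in>cyl k l K. \<forall>a1 a2 a3 j. a1 + a2 + a3 + j \<le> m \<longrightarrow>
      (1 \<le> a1 + a2 + a3 + j \<longrightarrow> W p * \<bar>Dcg a1 a2 a3 j (Fmap k l) p\<bar> \<le> C) \<and>
      (a1 + a2 + a3 + j = 0 \<longrightarrow> \<bar>Dcg a1 a2 a3 j (Fmap k l) p\<bar> \<le> C)" for m
  proof -
    obtain C where C: "\<And>p is. p \<in> cyl k l K \<Longrightarrow> set is \<subseteq> {1,2,3,4} \<Longrightarrow> length is \<le> m \<Longrightarrow>
      (is \<noteq> [] \<longrightarrow> W p * \<bar>iter_partial is (Fmap k l) p\<bar> \<le> C) \<and> (is = [] \<longrightarrow> \<bar>Fmap k l p\<bar> \<le> C)"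
      using derivative_bounds[OF assms(5,6) kl, of m] unfolding W_def by blast
    show ?thesis
    proof (intro exI[of _ C] ballI allI impI)
      fix p a1 a2 a3 j assume p: "p \<in> cyl k l K" and le: "a1 + a2 + a3 + j \<le> m"
      define "is" where "is = replicate a1 (1::5) @ replicate a2 2 @ replicate a3 3 @ replicate j 4"
      have "set is \<subseteq> {1,2,3,4}" "length is = a1 + a2 + a3 + j" by (auto simp: is_def)
      then show "(1 \<le> a1 + a2 + a3 + j \<longrightarrow> W p * \<bar>Dcg a1 a2 a3 j (Fmap k l) p\<bar> \<le> C) \<and>
         (a1 + a2 + a3 + j = 0 \<longrightarrow> \<bar>Dcg a1 a2 a3 j (Fmap k l) p\<bar> \<le> C)"
        using C[OF p, of "is"] le unfolding Dcg_def is_def[symmetric] by (cases "is = []") auto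
    qed
  qed
  have z: "2 * ((1 + x) / 2) / 3 = (1 + x) / 3" "2 * ((1 - x) / 2) / 3 = (1 - x) / 3" for x :: real
    by simp_all
  have i: "\<exists>C. \<forall>p\<in>cyl k l K. \<forall>a1 a2 a3 j. a1 + a2 + a3 + j \<le> m \<longrightarrow> \<bar>Dcg a1 a2 a3 j (Fmap k l) p\<bar> \<le> C"
    if "k = 1 \<or> (k = 2 \<and> l = 2) \<or> (k = 3 \<and> l = 3)" for m
  proof -
    have "W p = 1" for p using that by (auto simp: W_def log_weight_def)
    moreover obtain C where C: "\<And>p a1 a2 a3 j. p \<in> cyl k l K \<Longrightarrow> a1 + a2 + a3 + j \<le> m \<Longrightarrow>
      (1 \<le> a1 + a2 + a3 + j \<longrightarrow> W p * \<bar>Dcg a1 a2 a3 j (Fmap k l) p\<bar> \<le> C) \<and>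
      (a1 + a2 + a3 + j = 0 \<longrightarrow> \<bar>Dcg a1 a2 a3 j (Fmap k l) p\<bar> \<le> C)"
      using bd[of m] by blast
    moreover have "1 \<le> n \<or> n = 0" for n :: nat by linarith
    ultimately show ?thesis by (metis mult_1)
  qed
  have ii: "W p = (ln ((1 + p$5) / 3))\<^sup>2" if "(k, l) \<in> {(2, 1), (2, 3), (4, 3)}" for p
    using that unfolding W_def log_weight_def z by auto
  have iii: "W p = (ln ((1 - p$5) / 3))\<^sup>2" if "(k, l) \<in> {(3, 1), (3, 2), (4, 2)}" for p
    using that unfolding W_def log_weight_def z by auto
  have iv: "W p = (ln ((1 + p$5) / 3))\<^sup>2 * (ln ((1 - p$5) / 3))\<^sup>2" if "(k, l) = (4, 1)" for p
    using that unfolding W_def log_weight_def z by auto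
  show ?thesis
  proof (intro conjI impI allI, rule smooth, goal_cases)
    case (1 m)
    from i[OF 1, of m] show ?case by blast
  next
    case (2 m)
    from ii[OF 2] bd[of m] show ?case by (simp only:) blast
  next
    case (3 m)
    from iii[OF 3] bd[of m] show ?case by (simp only:) blast
  next
    case (4 m)
    from iv[OF 4] bd[of m] show ?case by (simp only:) blast
  qed
qed

end
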